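(* The decision problem Static$(\mathcal{X}_d,\mathcal{U}_d)$ is in $\Sigma_2^p$.
   Context: An instance of Static consists of rational data encoded in binary: vectors $a\in\mathbb{Q}^{m_x}$, $b\in\mathbb{Q}^{m_u}$, matrices $A\in\mathbb{Q}^{m_x\times n_x}$, $B\in\mathbb{Q}^{m_u\times n_u}$, and $H_\ell\in\mathbb{Q}^{n_u\times n_x}$ for $\ell\in[L]=\{1,\dots,L\}$. Let $\mathcal{X}_d=\{x\in\mathbb{R}_+^{n_x}: Ax\le a\}\cap\mathbb{Z}^{n_x}$ and $\mathcal{U}_d=\{u\in\mathbb{R}_+^{n_u}: Bu\le b\}\cap\mathbb{Z}^{n_u}$ (these sets may be unbounded). Static$(\mathcal{X}_d,\mathcal{U}_d)$ is the decision problem $$\exists x\in\mathcal{X}_d\ \ \forall u\in\mathcal{U}_d:\ u^\top H_\ell x\le 0\ \text{ for all }\ell\in[L]\,?$$ $\Sigma_2^p$ is the class of problems expressible as $\exists X\,\forall Y: P(I,X,Y)$, where $I$ is the instance, $X,Y$ range over objects of encoding length polynomial in that of $I$, and $P$ is decidable in polynomial time. *)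

theory Defs
  imports
    Complex_Main
    "HOL-Computational_Algebra.Polynomial"
    "Jordan_Normal_Form.Matrix"
begin

section \<open>Deterministic multi-tape Turing machines\<close>

datatype move = Move_Left | Stay | Move_Right

text \<open>
  Tape symbols are natural numbers, \<open>0\<close> is the blank. A tape is infinite in both directions:
  \<open>(l, r)\<close> has the symbols \<open>l\<close> to the left of the head (nearest first), and \<open>r\<close> from the head
  cell onwards; all further cells are blank.
\<close>

type_synonym tape = "nat list \<times> nat list"

fun head_symbol :: "nat list \<Rightarrow> nat" where
  "head_symbol [] = 0"
| "head_symbol (s # ss) = s"

definition tape_read :: "tape \<Rightarrow> nat" where
  "tape_read t = head_symbol (snd t)"

fun tape_act :: "nat \<times> move \<Rightarrow> tape \<Rightarrow> tape" where
  "tape_act (s, Move_Left) (l, r) = (tl l, head_symbol l # s # tl r)"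
| "tape_act (s, Stay) (l, r) = (l, s # tl r)"
| "tape_act (s, Move_Right) (l, r) = (s # l, tl r)"

record tm =
  num_tapes :: nat
  num_symbols :: nat
  num_states :: nat
  accept_state :: nat
  reject_state :: nat
  trans_fun :: "nat \<Rightarrow> nat list \<Rightarrow> nat \<times> (nat \<times> move) list"

text \<open>
  Symbols and states are \<open>{0..<num_symbols}\<close> and \<open>{0..<num_states}\<close>, so only finitely many
  values of the transition function matter. The start state is \<open>0\<close>.
\<close>

definition wf_tm :: "tm \<Rightarrow> bool" where
  "wf_tm M \<longleftrightarrow>
     3 \<le> num_symbols M \<and> 0 < num_states M \<and>
     accept_state M < num_states M \<and> reject_state M < num_states M \<and>
     accept_state M \<noteq> reject_state M \<and>
     (\<forall>q < num_states M. \<forall>ss. length ss = num_tapes M \<and> set ss \<subseteq> {..<num_symbols M} \<longrightarrow>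
        (case trans_fun M q ss of (q', acts) \<Rightarrow>
           q' < num_states M \<and> length acts = num_tapes M \<and>
           (\<forall>(s, d) \<in> set acts. s < num_symbols M)))"

type_synonym config = "nat \<times> tape list"

fun tm_step :: "tm \<Rightarrow> config \<Rightarrow> config" where
  "tm_step M (q, ts) =
     (if q = accept_state M \<or> q = reject_state M then (q, ts)
      else case trans_fun M q (map tape_read ts) of (q', acts) \<Rightarrow> (q', map2 tape_act acts ts))"

definition word_tape :: "bool list \<Rightarrow> tape" where
  "word_tape w = ([], map (\<lambda>b. if b then 2 else 1) w)"

text \<open>A tuple of binary words is given on separate tapes; the remaining tapes are blank.\<close>

definition tm_init :: "tm \<Rightarrow> bool list list \<Rightarrow> config" where
  "tm_init M ws = (0, map word_tape ws @ replicate (num_tapes M - length ws) ([], []))"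

definition tm_accepts_within :: "tm \<Rightarrow> bool list list \<Rightarrow> nat \<Rightarrow> bool" where
  "tm_accepts_within M ws t \<longleftrightarrow> fst ((tm_step M ^^ t) (tm_init M ws)) = accept_state M"

definition tm_rejects_within :: "tm \<Rightarrow> bool list list \<Rightarrow> nat \<Rightarrow> bool" where
  "tm_rejects_within M ws t \<longleftrightarrow> fst ((tm_step M ^^ t) (tm_init M ws)) = reject_state M"

definition poly_time_decidable :: "nat \<Rightarrow> (bool list list \<Rightarrow> bool) \<Rightarrow> bool" where
  "poly_time_decidable k P \<longleftrightarrow>
     (\<exists>M (p :: nat poly). wf_tm M \<and> k \<le> num_tapes M \<and>
        (\<forall>ws. length ws = k \<longrightarrow>
           (let t = poly p (sum_list (map length ws)) in
              if P ws then tm_accepts_within M ws t else tm_rejects_within M ws t)))"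


section \<open>The class \<open>\<Sigma>\<^sub>2\<^sup>p\<close>\<close>

definition Sigma2p :: "bool list set set" where
  "Sigma2p =
     {L. \<exists>P (p :: nat poly) (q :: nat poly). poly_time_decidable 3 P \<and>
           (\<forall>I. I \<in> L \<longleftrightarrow>
              (\<exists>X. length X \<le> poly p (length I) \<and>
                 (\<forall>Y. length Y \<le> poly q (length I) \<longrightarrow> P [I, X, Y])))}"


section \<open>The decision problem Static\<close>

text \<open>
  The dimensions are those of the matrices: \<open>A\<close> is \<open>m\<^sub>x \<times> n\<^sub>x\<close>, \<open>B\<close> is \<open>m\<^sub>u \<times> n\<^sub>u\<close>, and
  \<open>L\<close> is the length of the list of the \<open>H\<^sub>l\<close>.
\<close>

record static_instance =
  vec_a :: "rat vec"
  vec_b :: "rat vec"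
  mat_A :: "rat mat"
  mat_B :: "rat mat"
  mats_H :: "rat mat list"

definition wf_instance :: "static_instance \<Rightarrow> bool" where
  "wf_instance I \<longleftrightarrow>
     vec_a I \<in> carrier_vec (dim_row (mat_A I)) \<and>
     vec_b I \<in> carrier_vec (dim_row (mat_B I)) \<and>
     (\<forall>H \<in> set (mats_H I). H \<in> carrier_mat (dim_col (mat_B I)) (dim_col (mat_A I)))"

definition integer_points :: "rat mat \<Rightarrow> rat vec \<Rightarrow> real vec set" where
  "integer_points A a =
     {x \<in> carrier_vec (dim_col A).
        0\<^sub>v (dim_col A) \<le> x \<and> map_mat of_rat A *\<^sub>v x \<le> map_vec of_rat a \<and>
        (\<forall>i < dim_col A. x $ i \<in> \<int>)}"

definition Xd :: "static_instance \<Rightarrow> real vec set" where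
  "Xd I = integer_points (mat_A I) (vec_a I)"

definition Ud :: "static_instance \<Rightarrow> real vec set" where
  "Ud I = integer_points (mat_B I) (vec_b I)"

definition static_yes :: "static_instance \<Rightarrow> bool" where
  "static_yes I \<longleftrightarrow>
     (\<exists>x \<in> Xd I. \<forall>u \<in> Ud I. \<forall>H \<in> set (mats_H I). u \<bullet> (map_mat of_rat H *\<^sub>v x) \<le> 0)"


subsection \<open>Binary encoding of instances\<close>

fun nat_bits :: "nat \<Rightarrow> bool list" where
  "nat_bits n = (if n = 0 then [] else odd n # nat_bits (n div 2))"

declare nat_bits.simps [simp del]

text \<open>Every binary digit is preceded by \<open>True\<close>; \<open>False\<close> marks the end of the number.\<close>

definition nat_code :: "nat \<Rightarrow> bool list" where
  "nat_code n = concat (map (\<lambda>b. [True, b]) (nat_bits n)) @ [False]"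

definition int_code :: "int \<Rightarrow> bool list" where
  "int_code z = (z < 0) # nat_code (nat \<bar>z\<bar>)"

text \<open>Fractions need not be in lowest terms, so a rational number has several codes.\<close>

definition rat_codes :: "rat \<Rightarrow> bool list set" where
  "rat_codes r = {int_code z @ nat_code d | z d. 0 < d \<and> r = of_int z / of_nat d}"

definition rats_codes :: "rat list \<Rightarrow> bool list set" where
  "rats_codes rs = {concat ws | ws. list_all2 (\<lambda>w r. w \<in> rat_codes r) ws rs}"

text \<open>
  Only the entries are written in binary. The dimensions are written in unary, so that the
  number of rows and columns is bounded by the encoding length even for matrices without entries.
\<close>

definition unary_code :: "nat \<Rightarrow> bool list" where
  "unary_code n = replicate n True @ [False]"

definition instance_dims :: "static_instance \<Rightarrow> nat list" where
  "instance_dims I =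
     [dim_row (mat_A I), dim_col (mat_A I), dim_row (mat_B I), dim_col (mat_B I),
      length (mats_H I)]"

definition instance_entries :: "static_instance \<Rightarrow> rat list" where
  "instance_entries I =
     list_of_vec (vec_a I) @ list_of_vec (vec_b I) @
     concat (mat_to_list (mat_A I)) @ concat (mat_to_list (mat_B I)) @
     concat (map (concat \<circ> mat_to_list) (mats_H I))"

definition instance_codes :: "static_instance \<Rightarrow> bool list set" where
  "instance_codes I =
     {concat (map unary_code (instance_dims I)) @ w | w. w \<in> rats_codes (instance_entries I)}"

definition Static :: "bool list set" where
  "Static = {w. \<exists>I. wf_instance I \<and> w \<in> instance_codes I \<and> static_yes I}"


subsection \<open>Every instance has a code, and a code determines its instance\<close>

lemma rat_codes_nonempty: "rat_codes r \<noteq> {}"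
proof -
  obtain a b where ab: "quotient_of r = (a, b)" by force
  have "b > 0" using quotient_of_denom_pos[OF ab] .
  moreover have "r = of_int a / of_int b" using quotient_of_div[OF ab] .
  ultimately have "0 < nat b \<and> r = of_int a / of_nat (nat b)" by simp
  thus ?thesis unfolding rat_codes_def by blast
qed

lemma rats_codes_nonempty: "rats_codes rs \<noteq> {}"
proof -
  have "\<exists>ws. list_all2 (\<lambda>w r. w \<in> rat_codes r) ws rs"
  proof (induction rs)
    case (Cons r rs)
    then obtain ws where "list_all2 (\<lambda>w r. w \<in> rat_codes r) ws rs" by blast
    moreover obtain w where "w \<in> rat_codes r" using rat_codes_nonempty by blast
    ultimately have "list_all2 (\<lambda>w r. w \<in> rat_codes r) (w # ws) (r # rs)" by simp
    thus ?case by blast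
  qed simp
  thus ?thesis unfolding rats_codes_def by blast
qed

lemma instance_codes_nonempty: "instance_codes I \<noteq> {}"
  using rats_codes_nonempty unfolding instance_codes_def by blast

lemma nat_bits_0 [simp]: "nat_bits 0 = []"
  by (subst nat_bits.simps) simp

lemma nat_bits_pos: "0 < n \<Longrightarrow> nat_bits n = odd n # nat_bits (n div 2)"
  by (subst nat_bits.simps) simp

lemma nat_bits_inj: "nat_bits m = nat_bits n \<Longrightarrow> m = n"
proof (induction m arbitrary: n rule: less_induct)
  case (less m)
  show ?case
  proof (cases "m = 0 \<or> n = 0")
    case True
    thus ?thesis using less.prems nat_bits_pos[of m] nat_bits_pos[of n] by fastforce
  next
    case False
    hence "odd m # nat_bits (m div 2) = odd n # nat_bits (n div 2)"
      using less.prems nat_bits_pos[of m] nat_bits_pos[of n] by simp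
    hence eq: "odd m = odd n" "nat_bits (m div 2) = nat_bits (n div 2)"
      by simp_all
    have "m div 2 = n div 2" using less.IH[of "m div 2"] False eq(2) by simp
    moreover have "m mod 2 = n mod 2" using eq(1) by (simp add: mod2_eq_if)
    ultimately show ?thesis by (metis div_mult_mod_eq)
  qed
qed

lemma digits_code_prefix:
  "concat (map (\<lambda>b. [True, b]) bs) @ False # v = concat (map (\<lambda>b. [True, b]) cs) @ False # w
   \<Longrightarrow> bs = cs \<and> v = w"
proof (induction bs arbitrary: cs)
  case Nil
  thus ?case by (cases cs) auto
next
  case (Cons b bs)
  thus ?case by (cases cs) auto
qed

lemma nat_code_prefix: "nat_code m @ v = nat_code n @ w \<Longrightarrow> m = n \<and> v = w"
  unfolding nat_code_def append_assoc append_Cons append_Nil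
  by (drule digits_code_prefix) (blast intro: nat_bits_inj)

lemma int_code_prefix: "int_code y @ v = int_code z @ w \<Longrightarrow> y = z \<and> v = w"
  unfolding int_code_def using nat_code_prefix[of "nat \<bar>y\<bar>" v "nat \<bar>z\<bar>" w] by auto

lemma rat_codes_prefix:
  assumes "c \<in> rat_codes r" "d \<in> rat_codes s" "c @ v = d @ w"
  shows "r = s \<and> v = w"
  using assms unfolding rat_codes_def
  by (auto dest!: int_code_prefix nat_code_prefix)

lemma rats_codes_inj:
  assumes "w \<in> rats_codes rs" "w \<in> rats_codes ss" "length rs = length ss"
  shows "rs = ss"
proof -
  have *: "list_all2 (\<lambda>w r. w \<in> rat_codes r) us rs \<Longrightarrow> list_all2 (\<lambda>w r. w \<in> rat_codes r) vs ss \<Longrightarrow>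
      concat us = concat vs \<Longrightarrow> length rs = length ss \<Longrightarrow> rs = ss" for us vs rs ss
  proof (induction us arbitrary: vs rs ss)
    case Nil
    thus ?case by auto
  next
    case (Cons u us)
    then obtain r rs' where rs: "rs = r # rs'" "u \<in> rat_codes r"
        "list_all2 (\<lambda>w r. w \<in> rat_codes r) us rs'"
      by (auto simp: list_all2_Cons1)
    then obtain s ss' where ss: "ss = s # ss'" using Cons.prems by (cases ss) auto
    then obtain v vs' where vs: "vs = v # vs'" "v \<in> rat_codes s"
        "list_all2 (\<lambda>w r. w \<in> rat_codes r) vs' ss'"
      using Cons.prems by (auto simp: list_all2_Cons2)
    have "r = s \<and> concat us = concat vs'"
      using rat_codes_prefix[OF rs(2) vs(2)] Cons.prems(3) vs(1) by simp
    thus ?case using Cons.IH[OF rs(3) vs(3)] Cons.prems(4) rs(1) ss by simp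
  qed
  obtain us vs where "w = concat us" "list_all2 (\<lambda>w r. w \<in> rat_codes r) us rs"
      "w = concat vs" "list_all2 (\<lambda>w r. w \<in> rat_codes r) vs ss"
    using assms(1,2) unfolding rats_codes_def mem_Collect_eq by metis
  thus ?thesis using *[of us rs vs ss] assms(3) by simp
qed

lemma unary_code_prefix: "unary_code m @ v = unary_code n @ w \<Longrightarrow> m = n \<and> v = w"
proof (induction m arbitrary: n)
  case 0
  thus ?case by (cases n) (auto simp: unary_code_def)
next
  case (Suc m)
  thus ?case by (cases n) (auto simp: unary_code_def)
qed

lemma list_of_vec_inj: "list_of_vec v = list_of_vec w \<Longrightarrow> v = w"
  by (metis vec_list)

lemma length_concat_mat_to_list [simp]:
  "length (concat (mat_to_list A)) = dim_row A * dim_col A"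
  by (simp add: mat_to_list_def length_concat comp_def sum_list_triv)

lemma concat_mat_to_list_inj:
  assumes "concat (mat_to_list A) = concat (mat_to_list B)"
    and "dim_row A = dim_row B" "dim_col A = dim_col B"
  shows "A = B"
proof -
  have "mat_to_list A = mat_to_list B"
  proof (rule concat_injective[OF assms(1)])
    show "\<forall>(x, y) \<in> set (zip (mat_to_list A) (mat_to_list B)). length x = length y"
      using assms(2,3) by (auto simp: mat_to_list_def set_zip)
  qed (use assms(2,3) in \<open>simp add: mat_to_list_def\<close>)
  hence "\<forall>i < dim_row A. \<forall>j < dim_col A. A $$ (i, j) = B $$ (i, j)"
    using assms(2,3) by (auto simp: mat_to_list_def)
  thus ?thesis using assms(2,3) by (intro eq_matI) auto
qed

lemma concat_mats_inj:
  assumes "concat (map (concat \<circ> mat_to_list) Hs) = concat (map (concat \<circ> mat_to_list) Ks)"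
    and "length Hs = length Ks"
    and "\<forall>H \<in> set Hs. H \<in> carrier_mat m n" "\<forall>K \<in> set Ks. K \<in> carrier_mat m n"
  shows "Hs = Ks"
  using assms
proof (induction Hs arbitrary: Ks)
  case (Cons H Hs)
  then obtain K Ks' where Ks: "Ks = K # Ks'" by (cases Ks) auto
  hence dims: "dim_row H = m" "dim_col H = n" "dim_row K = m" "dim_col K = n"
    using Cons.prems by auto
  hence "concat (mat_to_list H) = concat (mat_to_list K) \<and>
      concat (map (concat \<circ> mat_to_list) Hs) = concat (map (concat \<circ> mat_to_list) Ks')"
    using Cons.prems(1) unfolding Ks by (simp add: comp_def)
  hence "H = K" "Hs = Ks'"
    using concat_mat_to_list_inj[of H K] dims Cons.IH[of Ks'] Cons.prems Ks by auto
  thus ?case using Ks by simp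
qed auto

theorem instance_code_unique:
  assumes "wf_instance I" "wf_instance J" "w \<in> instance_codes I" "w \<in> instance_codes J"
  shows "I = J"
proof -
  obtain u v where w: "w = concat (map unary_code (instance_dims I)) @ u"
      "w = concat (map unary_code (instance_dims J)) @ v"
    and u: "u \<in> rats_codes (instance_entries I)" and v: "v \<in> rats_codes (instance_entries J)"
    using assms(3,4) unfolding instance_codes_def by blast
  have "concat (map unary_code ms) @ u = concat (map unary_code ns) @ v \<Longrightarrow>
      length ms = length ns \<Longrightarrow> ms = ns \<and> u = v" for ms ns
    by (induction ms ns rule: list_induct2') (auto dest!: unary_code_prefix)
  from this[OF w(1)[symmetric, THEN trans, OF w(2)]]
  have dims: "instance_dims I = instance_dims J \<and> u = v"
    by (simp add: instance_dims_def)
  hence D: "dim_row (mat_A I) = dim_row (mat_A J)" "dim_col (mat_A I) = dim_col (mat_A J)"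
      "dim_row (mat_B I) = dim_row (mat_B J)" "dim_col (mat_B I) = dim_col (mat_B J)"
      "length (mats_H I) = length (mats_H J)"
    unfolding instance_dims_def by auto
  have len: "length (concat (map (concat \<circ> mat_to_list) Hs)) = length Hs * (m * n)"
    if "\<forall>H \<in> set Hs. H \<in> carrier_mat m n" for Hs :: "rat mat list" and m n
    using that by (induction Hs) auto
  have vecs: "dim_vec (vec_a I) = dim_vec (vec_a J)" "dim_vec (vec_b I) = dim_vec (vec_b J)"
    using assms(1,2) D(1,3) unfolding wf_instance_def carrier_vec_def mem_Collect_eq by metis+
  have mats: "\<forall>H \<in> set (mats_H I). H \<in> carrier_mat (dim_col (mat_B I)) (dim_col (mat_A I))"
      "\<forall>H \<in> set (mats_H J). H \<in> carrier_mat (dim_col (mat_B I)) (dim_col (mat_A I))"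
    using assms(1,2) unfolding wf_instance_def D(2,4) by blast+
  have "length (instance_entries I) = length (instance_entries J)"
    unfolding instance_entries_def length_append len[OF mats(1)] len[OF mats(2)] D
      length_concat_mat_to_list length_list_of_vec vecs ..
  hence eq: "instance_entries I = instance_entries J"
    using rats_codes_inj[OF u] v conjunct2[OF dims] by simp
  have app: "xs = ys \<and> us = vs" if "xs @ us = ys @ vs" "length xs = length ys"
    for xs ys us vs :: "rat list"
    using that by simp
  note eq = eq[unfolded instance_entries_def]
  have 1: "length (list_of_vec (vec_a I)) = length (list_of_vec (vec_a J))"
      "length (list_of_vec (vec_b I)) = length (list_of_vec (vec_b J))"
    using vecs by simp_all
  have 2: "length (concat (mat_to_list (mat_A I))) = length (concat (mat_to_list (mat_A J)))"
      "length (concat (mat_to_list (mat_B I))) = length (concat (mat_to_list (mat_B J)))"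
    using D by simp_all
  note p1 = app[OF eq 1(1)]
  note p2 = app[OF conjunct2[OF p1] 1(2)]
  note p3 = app[OF conjunct2[OF p2] 2(1)]
  note p4 = app[OF conjunct2[OF p3] 2(2)]
  note parts = conjunct1[OF p1] conjunct1[OF p2] conjunct1[OF p3] conjunct1[OF p4]
    conjunct2[OF p4]
  have "mats_H I = mats_H J"
    using concat_mats_inj[OF parts(5) D(5) mats] .
  moreover have "mat_A I = mat_A J" "mat_B I = mat_B J"
    using concat_mat_to_list_inj[OF parts(3) D(1,2)] concat_mat_to_list_inj[OF parts(4) D(3,4)] .
  moreover have "vec_a I = vec_a J" "vec_b I = vec_b J"
    using list_of_vec_inj[OF parts(1)] list_of_vec_inj[OF parts(2)] .
  ultimately show ?thesis by simp
qed

end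

theory Submission
  imports Defs "Jordan_Normal_Form.Determinant"
begin

text \<open>
  \<^emph>\<open>Small witnesses.\<close> Homogenising a polyhedron and writing one of its integer points as a conic
  combination of small integer generators shows that the point is a small integer point plus a
  nonnegative integer combination of small integer recession directions. The bound depends only on
  the dimension and on the size of the entries, not on the number of constraints. Applied to
  \<open>\<U>\<^sub>d\<close>, it replaces ``for all \<open>u \<in> \<U>\<^sub>d\<close>'' by linear constraints on \<open>x\<close> with small coefficients, one
  for each small point and each small recession direction; hence a solution \<open>x\<close> can be taken small.
  Applied to \<open>\<U>\<^sub>d\<close> with the additional constraint \<open>u\<^sup>T H\<^sub>l x \<ge> 1\<close>, it yields small counterexamples.

  \<^emph>\<open>Verification in polynomial time.\<close> The verifier is a while program on stacks of bits, one stack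
  per tape, whose continuations serve as the states of a Turing machine. As its running time is
  polynomial in the largest number of iterations of a single loop, only the lengths of the stacks
  have to be bounded. A sum of rational numbers is accumulated as \<open>(p - n) / d\<close> with natural numbers
  \<open>p, n, d\<close>, so that neither signs nor reduced fractions occur.
\<close>


section \<open>A while language for Turing machines\<close>

text \<open>Both quantifiers range over possibly infinite sets, and short witnesses are immediate
  for neither. For fixed \<open>u\<close> the condition is linear in \<open>x\<close>; even after
  reduction to small \<open>u\<close> these conditions are exponentially many, so a size bound that
  grew with their number would be useless. Only the tight rows that determine an extreme ray count,
  and fewer rows than variables suffice for that. Siegel's lemma then gives a small integer ray by
  counting alone, without determinants. Integrality survives because integer multiples of integer
  directions are subtracted from an integer point. If the form were positive on a recession
  direction, a large multiple of that direction would violate the condition; this is how directions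
  turn into homogeneous constraints on \<open>x\<close>. Rational data are cleared by one common
  denominator, which stays short because code lengths add when denominators multiply. Conversely,
  the verifier faces every word \<open>X\<close> of the permitted length and not only small
  solutions, so the bound on counterexamples starts from the length of \<open>X\<close>.\<close>

type_synonym state = "nat \<Rightarrow> bool list"

fun peek :: "bool list \<Rightarrow> bool option" where
  "peek [] = None"
| "peek (b # bs) = Some b"

abbreviation peeks :: "state \<Rightarrow> nat \<Rightarrow> bool option" where
  "peeks s \<equiv> \<lambda>i. peek (s i)"

text \<open>Guards and pushed bits are arbitrary functions of the tops of all stacks, since exactly
  these symbols lie under the heads and one transition may depend on all of them.
  \<open>HALT\<close> leaves any nesting of loops with a verdict.\<close>

datatype com =
    SKIP
  | PUT nat "(nat \<Rightarrow> bool option) \<Rightarrow> bool"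
  | PUSH nat "(nat \<Rightarrow> bool option) \<Rightarrow> bool"
  | POP nat
  | HALT bool
  | SEQ com com (infixr ";;" 60)
  | IF "(nat \<Rightarrow> bool option) \<Rightarrow> bool" com com
  | WHILE "(nat \<Rightarrow> bool option) \<Rightarrow> bool" com

datatype outcome = Normal state | Halted bool | Timeout

text \<open>The guard is tested even with fuel 0: a loop of exactly \<open>n\<close> iterations ends
  normally with fuel \<open>n\<close>, and \<open>Timeout\<close> means that another iteration would
  be due.\<close>

fun loop :: "((nat \<Rightarrow> bool option) \<Rightarrow> bool) \<Rightarrow> (state \<Rightarrow> outcome) \<Rightarrow> nat \<Rightarrow> state \<Rightarrow> outcome" where
  "loop g f 0 s = (if g (peeks s) then Timeout else Normal s)"
| "loop g f (Suc n) s =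
     (if g (peeks s) then (case f s of Normal s' \<Rightarrow> loop g f n s' | r \<Rightarrow> r) else Normal s)"

text \<open>The number \<open>N\<close> bounds the number of iterations of every single loop execution.\<close>

primrec exec :: "nat \<Rightarrow> com \<Rightarrow> state \<Rightarrow> outcome" where
  "exec N SKIP s = Normal s"
| "exec N (PUT r f) s = Normal (s(r := f (peeks s) # tl (s r)))"
| "exec N (PUSH r f) s = Normal (s(r := f (peeks s) # s r))"
| "exec N (POP r) s = Normal (s(r := tl (s r)))"
| "exec N (HALT b) s = Halted b"
| "exec N (a ;; b) s = (case exec N a s of Normal s' \<Rightarrow> exec N b s' | r \<Rightarrow> r)"
| "exec N (IF g a b) s = (if g (peeks s) then exec N a s else exec N b s)"
| "exec N (WHILE g c) s = loop g (exec N c) N s"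

text \<open>A polynomial in the iteration bound \<open>N\<close>, whose degree is the nesting depth
  of loops. \<open>PUSH\<close> costs two because a cell is written before the head moves, never
  after. In the \<open>WHILE\<close> case the factor \<open>N + 1\<close> makes room for the final
  test of the guard.\<close>

primrec time_poly :: "com \<Rightarrow> nat poly" where
  "time_poly SKIP = 1"
| "time_poly (PUT r f) = 1"
| "time_poly (PUSH r f) = [:2:]"
| "time_poly (POP r) = 1"
| "time_poly (HALT b) = 0"
| "time_poly (a ;; b) = time_poly a + time_poly b + 1"
| "time_poly (IF g a b) = time_poly a + time_poly b + 1"
| "time_poly (WHILE g c) = [:1, 1:] * (time_poly c + 1)"

primrec regs :: "com \<Rightarrow> nat set" where
  "regs SKIP = {}"
| "regs (PUT r f) = {r}"
| "regs (PUSH r f) = {r}"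
| "regs (POP r) = {r}"
| "regs (HALT b) = {}"
| "regs (a ;; b) = regs a \<union> regs b"
| "regs (IF g a b) = regs a \<union> regs b"
| "regs (WHILE g c) = regs c"


subsection \<open>Continuations as states of a machine\<close>

definition sym :: "bool \<Rightarrow> nat" where
  "sym b = (if b then 2 else 1)"

definition read_tops :: "nat list \<Rightarrow> nat \<Rightarrow> bool option" where
  "read_tops ss = (\<lambda>i. if i < length ss \<and> ss ! i \<noteq> 0 then Some (ss ! i = 2) else None)"

definition stays :: "nat list \<Rightarrow> (nat \<times> move) list" where
  "stays ss = map (\<lambda>s. (s, Stay)) ss"

text \<open>\<open>PUSH\<close> first moves to the blank cell on the left and writes in a second
  step. The bit is computed in the first step, while the tops are still the old ones, and is
  remembered as a \<open>PUT\<close> of a constant function; just two such functions occur, which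
  keeps the set of continuations finite. \<open>POP\<close> blanks the cell that it leaves, so that
  everything to the left of a head stays blank. \<open>HALT\<close> is a fixed point.\<close>

fun delta :: "com list \<Rightarrow> nat list \<Rightarrow> com list \<times> (nat \<times> move) list" where
  "delta [] ss = ([], stays ss)"
| "delta (SKIP # k) ss = (k, stays ss)"
| "delta (PUT r f # k) ss = (k, (stays ss)[r := (sym (f (read_tops ss)), Stay)])"
| "delta (PUSH r f # k) ss = (PUT r (if f (read_tops ss) then (\<lambda>_. True) else (\<lambda>_. False)) # k, (stays ss)[r := (ss ! r, Move_Left)])"
| "delta (POP r # k) ss = (k, (stays ss)[r := (0, Move_Right)])"
| "delta (HALT b # k) ss = (HALT b # k, stays ss)"
| "delta ((a ;; b) # k) ss = (a # b # k, stays ss)"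
| "delta (IF g a b # k) ss = ((if g (read_tops ss) then a else b) # k, stays ss)"
| "delta (WHILE g c # k) ss = (if g (read_tops ss) then c # WHILE g c # k else k, stays ss)"

definition act_all :: "(nat \<times> move) list \<Rightarrow> tape list \<Rightarrow> tape list" where
  "act_all acts ts = map2 tape_act acts ts"

fun cstep :: "com list \<times> tape list \<Rightarrow> com list \<times> tape list" where
  "cstep (k, ts) = (case delta k (map tape_read ts) of (k', acts) \<Rightarrow> (k', act_all acts ts))"

text \<open>These will be the states of the machine. The set is finite although loops run
  arbitrarily long, because a loop body always returns to the same continuation
  \<open>WHILE g c # k\<close>.\<close>

primrec conts :: "com \<Rightarrow> com list \<Rightarrow> com list set" where
  "conts SKIP k = {SKIP # k}"
| "conts (PUT r f) k = {PUT r f # k}"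
| "conts (PUSH r f) k = {PUSH r f # k, PUT r (\<lambda>_. True) # k, PUT r (\<lambda>_. False) # k}"
| "conts (POP r) k = {POP r # k}"
| "conts (HALT b) k = {HALT b # k}"
| "conts (a ;; b) k = {(a ;; b) # k} \<union> conts a (b # k) \<union> conts b k"
| "conts (IF g a b) k = {IF g a b # k} \<union> conts a k \<union> conts b k"
| "conts (WHILE g c) k = {WHILE g c # k} \<union> conts c (WHILE g c # k)"

lemma finite_conts: "finite (conts c k)"
  by (induction c arbitrary: k) auto

lemma conts_self: "c # k \<in> conts c k"
  by (cases c) auto

lemma conts_closed: "k' \<in> conts c k \<Longrightarrow> fst (delta k' ss) \<in> insert k (conts c k)"
proof (induction c arbitrary: k)
  case (SEQ a b)
  from SEQ.prems consider "k' = (a ;; b) # k" | "k' \<in> conts a (b # k)" | "k' \<in> conts b k" by auto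
  thus ?case
    using SEQ.IH(1)[of "b # k"] SEQ.IH(2)[of k] conts_self[of a "b # k"] conts_self[of b k]
    by cases auto
next
  case (IF g a b)
  from IF.prems consider "k' = IF g a b # k" | "k' \<in> conts a k" | "k' \<in> conts b k" by auto
  thus ?case
    using IF.IH(1)[of k] IF.IH(2)[of k] conts_self[of a k] conts_self[of b k]
    by cases auto
next
  case (WHILE g c)
  from WHILE.prems consider "k' = WHILE g c # k" | "k' \<in> conts c (WHILE g c # k)" by auto
  thus ?case
    using WHILE.IH[of "WHILE g c # k"] conts_self[of c "WHILE g c # k"]
    by cases auto
qed auto

text \<open>Tapes are compared with stacks only up to surrounding blanks.\<close>

definition rep :: "tape \<Rightarrow> bool list \<Rightarrow> bool" where
  "rep t xs \<longleftrightarrow> (\<exists>n. snd t = map sym xs @ replicate n 0) \<and> set (fst t) \<subseteq> {0}"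

definition reps :: "state \<Rightarrow> tape list \<Rightarrow> bool" where
  "reps s ts \<longleftrightarrow> (\<forall>i < length ts. rep (ts ! i) (s i)) \<and> (\<forall>i \<ge> length ts. s i = [])"

lemma tl_replicate_0: "\<exists>m. tl (replicate n (0::nat)) = replicate m 0"
  by (cases n) auto

lemma head_replicate_0 [simp]: "head_symbol (replicate n 0) = 0"
  by (cases n) auto

lemma rep_read: "rep t xs \<Longrightarrow> tape_read t = (case peek xs of None \<Rightarrow> 0 | Some b \<Rightarrow> sym b)"
  unfolding rep_def tape_read_def by (cases xs) auto

lemma reps_read_tops:
  assumes "reps s ts"
  shows "read_tops (map tape_read ts) = peeks s"
proof
  fix i
  show "read_tops (map tape_read ts) i = peek (s i)"
  proof (cases "i < length ts")
    case True
    hence "tape_read (ts ! i) = (case peek (s i) of None \<Rightarrow> 0 | Some b \<Rightarrow> sym b)"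
      using assms by (intro rep_read) (auto simp: reps_def)
    thus ?thesis using True by (auto simp: read_tops_def sym_def split: option.splits)
  qed (use assms in \<open>auto simp: reps_def read_tops_def\<close>)
qed

text \<open>Writing back the symbol just read may change the tape: when the tape list is exhausted,
  an explicit blank is appended. This is why \<open>rep\<close> allows any number of trailing
  zeros.\<close>

lemma rep_stay: "rep t xs \<Longrightarrow> rep (tape_act (tape_read t, Stay) t) xs"
proof -
  assume a: "rep t xs"
  obtain l r where t: "t = (l, r)" by force
  obtain n where r: "r = map sym xs @ replicate n 0" and l: "set l \<subseteq> {0}"
    using a t unfolding rep_def by auto
  show ?thesis
  proof (cases xs)
    case Nil
    obtain m where "tl (replicate n (0::nat)) = replicate m 0" using tl_replicate_0 by blast
    hence "0 # tl r = replicate (Suc m) 0" using r Nil by simp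
    hence "\<exists>n. 0 # tl r = replicate n 0" by blast
    thus ?thesis using t Nil l r by (simp add: rep_def tape_read_def)
  next
    case (Cons b ys)
    thus ?thesis using t l r by (auto simp: rep_def tape_read_def)
  qed
qed

lemma rep_put: "rep t xs \<Longrightarrow> rep (tape_act (sym b, Stay) t) (b # tl xs)"
proof -
  assume a: "rep t xs"
  obtain l r where t: "t = (l, r)" by force
  obtain n where r: "r = map sym xs @ replicate n 0" and l: "set l \<subseteq> {0}"
    using a t unfolding rep_def by auto
  obtain m where "tl (replicate n (0::nat)) = replicate m 0" using tl_replicate_0 by blast
  thus ?thesis using t l r by (cases xs) (auto simp: rep_def)
qed

lemma rep_pop: "rep t xs \<Longrightarrow> rep (tape_act (0, Move_Right) t) (tl xs)"
proof -
  assume a: "rep t xs"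
  obtain l r where t: "t = (l, r)" by force
  obtain n where r: "r = map sym xs @ replicate n 0" and l: "set l \<subseteq> {0}"
    using a t unfolding rep_def by auto
  obtain m where "tl (replicate n (0::nat)) = replicate m 0" using tl_replicate_0 by blast
  thus ?thesis using t l r by (cases xs) (auto simp: rep_def)
qed

lemma rep_push:
  assumes "rep t xs"
  shows "rep (tape_act (sym b, Stay) (tape_act (tape_read t, Move_Left) t)) (b # xs)"
proof -
  obtain l r where t: "t = (l, r)" by force
  obtain m where m: "tape_read t # tl r = map sym xs @ replicate m 0"
    using rep_stay[OF assms] t by (auto simp: rep_def)
  have l: "set l \<subseteq> {0}" using assms t unfolding rep_def by auto
  have "set (tl l) \<subseteq> {0}" using l by (cases l) auto
  thus ?thesis using t m by (auto simp: rep_def)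
qed

lemma length_stays [simp]: "length (stays ss) = length ss"
  by (simp add: stays_def)

lemma length_act_all [simp]: "length acts = length ts \<Longrightarrow> length (act_all acts ts) = length ts"
  by (simp add: act_all_def)

lemma nth_stays_act:
  assumes "i < length ts"
  shows "act_all (stays (map tape_read ts)) ts ! i = tape_act (tape_read (ts ! i), Stay) (ts ! i)"
  using assms by (simp add: act_all_def stays_def)

lemma nth_update_act:
  assumes "i < length ts"
  shows "act_all ((stays (map tape_read ts))[r := x]) ts ! i =
    (if i = r then tape_act x (ts ! i) else tape_act (tape_read (ts ! i), Stay) (ts ! i))"
  using assms by (simp add: act_all_def stays_def nth_list_update)

lemma reps_stays: "reps s ts \<Longrightarrow> reps s (act_all (stays (map tape_read ts)) ts)"
  unfolding reps_def by (auto simp: nth_stays_act rep_stay)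

lemma reps_update:
  assumes "reps s ts" "r < length ts" "rep (tape_act x (ts ! r)) xs"
  shows "reps (s(r := xs)) (act_all ((stays (map tape_read ts))[r := x]) ts)"
  using assms unfolding reps_def
  by (auto simp: nth_update_act rep_stay)

lemma reps_push:
  assumes "reps s ts" "r < length ts"
  shows "\<exists>ts'. (cstep ^^ 2) (PUSH r f # k, ts) = (k, ts') \<and> reps (s(r := f (peeks s) # s r)) ts'
    \<and> length ts' = length ts"
proof -
  define ts1 where "ts1 = act_all ((stays (map tape_read ts))[r := (tape_read (ts ! r), Move_Left)]) ts"
  define b where "b = f (peeks s)"
  define ts2 where "ts2 = act_all ((stays (map tape_read ts1))[r := (sym b, Stay)]) ts1"
  have len: "length ts1 = length ts" "length ts2 = length ts"
    unfolding ts1_def ts2_def by (simp_all add: stays_def)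
  have s1: "cstep (PUSH r f # k, ts) = (PUT r (if b then (\<lambda>_. True) else (\<lambda>_. False)) # k, ts1)"
    using reps_read_tops[OF assms(1)] assms(2) by (simp add: ts1_def b_def)
  have s2: "cstep (PUT r (if b then (\<lambda>_. True) else (\<lambda>_. False)) # k, ts1) = (k, ts2)"
    by (auto simp: ts2_def)
  have "reps (s(r := b # s r)) ts2"
    unfolding reps_def
  proof (intro conjI allI impI)
    fix i assume i: "i < length ts2"
    hence i': "i < length ts1" "i < length ts" using len by auto
    have t2: "ts2 ! i = (if i = r then tape_act (sym b, Stay) (ts1 ! i) else tape_act (tape_read (ts1 ! i), Stay) (ts1 ! i))"
      unfolding ts2_def using i'(1) by (rule nth_update_act)
    have t1: "ts1 ! i = (if i = r then tape_act (tape_read (ts ! r), Move_Left) (ts ! i) else tape_act (tape_read (ts ! i), Stay) (ts ! i))"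
      unfolding ts1_def using i'(2) by (rule nth_update_act)
    have "rep (ts ! i) (s i)" using assms(1) i' by (auto simp: reps_def)
    thus "rep (ts2 ! i) ((s(r := b # s r)) i)"
      unfolding t2 t1 by (auto intro: rep_push rep_stay)
  next
    fix i assume "i \<ge> length ts2"
    thus "(s(r := b # s r)) i = []" using assms len by (auto simp: reps_def)
  qed
  thus ?thesis using s1 s2 len by (auto simp: numeral_2_eq_2 b_def simp del: cstep.simps)
qed

section \<open>Step-counted runs and the simulation of programs\<close>

definition reaches :: "com list \<times> tape list \<Rightarrow> nat \<Rightarrow> com list \<times> tape list \<Rightarrow> bool" where
  "reaches x t y \<longleftrightarrow> (\<exists>m \<le> t. (cstep ^^ m) x = y)"

lemma reaches_refl: "reaches x t x"
  unfolding reaches_def by (rule exI[of _ 0]) simp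

lemma reaches_trans: "reaches x t y \<Longrightarrow> reaches y u z \<Longrightarrow> t + u \<le> v \<Longrightarrow> reaches x v z"
  unfolding reaches_def
proof (elim exE conjE)
  fix m n assume a: "m \<le> t" "(cstep ^^ m) x = y" "n \<le> u" "(cstep ^^ n) y = z" "t + u \<le> v"
  have "(cstep ^^ (n + m)) x = z" using a by (simp add: funpow_add)
  thus "\<exists>m \<le> v. (cstep ^^ m) x = z" using a by (intro exI[of _ "n + m"]) simp
qed

lemma reaches_mono: "reaches x t y \<Longrightarrow> t \<le> u \<Longrightarrow> reaches x u y"
  using reaches_trans[OF _ reaches_refl[of y 0]] by simp

lemma reaches_step: "cstep x = y \<Longrightarrow> reaches x 1 y"
  unfolding reaches_def by (intro exI[of _ 1]) simp

text \<open>A halted run is only traced to some continuation with \<open>HALT\<close> on top,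
  whatever the tapes then contain. A timeout carries no obligation, since a compiled program is
  assumed to halt within the bound.\<close>

definition reaches_outcome ::
    "com list \<Rightarrow> com list \<times> tape list \<Rightarrow> nat \<Rightarrow> outcome \<Rightarrow> bool" where
  "reaches_outcome k x t res = (case res of
     Normal s \<Rightarrow> \<exists>ts. reaches x t (k, ts) \<and> reps s ts \<and> length ts = length (snd x)
   | Halted b \<Rightarrow> \<exists>ts k'. reaches x t (HALT b # k', ts)
   | Timeout \<Rightarrow> True)"

lemma reaches_outcome_trans:
  assumes "reaches x t y" "reaches_outcome k y u res" "t + u \<le> v" "length (snd x) = length (snd y)"
  shows "reaches_outcome k x v res"
proof (cases res)
  case (Normal s)
  then obtain ts where "reaches y u (k, ts)" "reps s ts" "length ts = length (snd y)"
    using assms(2) by (auto simp: reaches_outcome_def)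
  thus ?thesis using Normal assms(4) reaches_trans[OF assms(1) _ assms(3)]
    by (auto simp: reaches_outcome_def)
next
  case (Halted b)
  then obtain ts k' where "reaches y u (HALT b # k', ts)"
    using assms(2) by (auto simp: reaches_outcome_def)
  thus ?thesis using Halted reaches_trans[OF assms(1) _ assms(3)]
    by (auto simp: reaches_outcome_def)
qed (simp add: reaches_outcome_def)

lemma reaches_outcome_step:
  assumes "fst (delta k' (map tape_read ts)) = k''" "snd (delta k' (map tape_read ts)) = stays (map tape_read ts)"
    and "\<And>ts'. reps s ts' \<Longrightarrow> length ts' = length ts \<Longrightarrow> reaches_outcome k (k'', ts') t res"
    and "reps s ts"
  shows "reaches_outcome k (k', ts) (t + 1) res"
proof -
  let ?ts = "act_all (stays (map tape_read ts)) ts"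
  have "cstep (k', ts) = (k'', ?ts)" using assms(1,2) by (auto split: prod.splits)
  hence "reaches (k', ts) 1 (k'', ?ts)" by (rule reaches_step)
  moreover have "reaches_outcome k (k'', ?ts) t res"
    by (rule assms(3)) (auto intro: reps_stays assms(4))
  ultimately show ?thesis by (rule reaches_outcome_trans) auto
qed

lemma reaches_outcome_NormalI:
  "reaches x t (k, ts) \<Longrightarrow> reps s ts \<Longrightarrow> length ts = length (snd x) \<Longrightarrow> reaches_outcome k x t (Normal s)"
  unfolding reaches_outcome_def by auto

lemma reaches_outcome_refl: "reps s ts \<Longrightarrow> reaches_outcome k (k, ts) t (Normal s)"
  by (rule reaches_outcome_NormalI[OF reaches_refl]) auto

text \<open>Induction on the program for all continuations \<open>k\<close> at once: the body of a
  loop runs with \<open>WHILE g c # k\<close> behind it, so its hypothesis is needed for a longer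
  continuation.\<close>

lemma cstep_exec:
  assumes "reps s ts" "regs c \<subseteq> {..<length ts}"
  shows "reaches_outcome k (c # k, ts) (poly (time_poly c) N) (exec N c s)"
  using assms
proof (induction c arbitrary: s ts k)
  case SKIP
  have "reaches_outcome k (SKIP # k, ts) (0 + 1) (Normal s)"
    by (rule reaches_outcome_step[where s = s and k'' = k])
      (simp_all add: SKIP reaches_outcome_refl)
  thus ?case by simp
next
  case (PUT r f)
  let ?ts = "act_all ((stays (map tape_read ts))[r := (sym (f (peeks s)), Stay)]) ts"
  have 1: "cstep (PUT r f # k, ts) = (k, ?ts)" using reps_read_tops[OF PUT(1)] by simp
  have 2: "reps (s(r := f (peeks s) # tl (s r))) ?ts"
    using PUT by (intro reps_update rep_put) (auto simp: reps_def)
  have "reaches_outcome k (PUT r f # k, ts) 1 (Normal (s(r := f (peeks s) # tl (s r))))"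
    by (rule reaches_outcome_NormalI[OF reaches_step[OF 1] 2]) simp
  thus ?case by simp
next
  case (PUSH r f)
  obtain ts' where 1: "(cstep ^^ 2) (PUSH r f # k, ts) = (k, ts')" "reps (s(r := f (peeks s) # s r)) ts'"
    "length ts' = length ts" using reps_push[of s ts r f k] PUSH by auto
  have "reaches (PUSH r f # k, ts) 2 (k, ts')" unfolding reaches_def using 1(1) by blast
  hence "reaches_outcome k (PUSH r f # k, ts) 2 (Normal (s(r := f (peeks s) # s r)))"
    by (rule reaches_outcome_NormalI) (simp_all add: 1)
  thus ?case by simp
next
  case (POP r)
  let ?ts = "act_all ((stays (map tape_read ts))[r := (0, Move_Right)]) ts"
  have 1: "cstep (POP r # k, ts) = (k, ?ts)" by simp
  have 2: "reps (s(r := tl (s r))) ?ts"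
    using POP by (intro reps_update rep_pop) (auto simp: reps_def)
  have "reaches_outcome k (POP r # k, ts) 1 (Normal (s(r := tl (s r))))"
    by (rule reaches_outcome_NormalI[OF reaches_step[OF 1] 2]) simp
  thus ?case by simp
next
  case (HALT b)
  show ?case by (auto simp: reaches_outcome_def intro: reaches_refl)
next
  case (SEQ a b)
  have *: "reaches_outcome k (a # b # k, ts') (poly (time_poly a) N + poly (time_poly b) N) (exec N (a ;; b) s)"
    if ts': "reps s ts'" "length ts' = length ts" for ts'
  proof -
    have a: "reaches_outcome (b # k) (a # b # k, ts') (poly (time_poly a) N) (exec N a s)"
      using SEQ.prems ts' by (intro SEQ.IH(1)) auto
    show ?thesis
    proof (cases "exec N a s")
      case (Normal s')
      then obtain ts'' where r: "reaches (a # b # k, ts') (poly (time_poly a) N) (b # k, ts'')"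
          "reps s' ts''" "length ts'' = length ts'"
        using a by (auto simp: reaches_outcome_def)
      have b: "reaches_outcome k (b # k, ts'') (poly (time_poly b) N) (exec N b s')"
        using SEQ.prems ts' r by (intro SEQ.IH(2)) auto
      show ?thesis using reaches_outcome_trans[OF r(1) b order_refl] r Normal by simp
    next
      case (Halted x)
      hence "\<exists>ts k'. reaches (a # b # k, ts') (poly (time_poly a) N) (HALT x # k', ts)"
        using a by (auto simp: reaches_outcome_def)
      hence "\<exists>ts k'. reaches (a # b # k, ts') (poly (time_poly a) N + poly (time_poly b) N) (HALT x # k', ts)"
        by (meson reaches_mono le_add1)
      thus ?thesis using Halted by (simp add: reaches_outcome_def)
    qed (simp add: reaches_outcome_def)
  qed
  have "reaches_outcome k ((a ;; b) # k, ts) (poly (time_poly a) N + poly (time_poly b) N + 1) (exec N (a ;; b) s)"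
    by (rule reaches_outcome_step[OF _ _ * SEQ.prems(1)]) simp_all
  thus ?case by (simp only: time_poly.simps poly_add poly_1)
next
  case (IF g a b)
  have *: "reaches_outcome k ((if g (peeks s) then a else b) # k, ts') (poly (time_poly a) N + poly (time_poly b) N)
      (exec N (IF g a b) s)"
    if ts': "reps s ts'" "length ts' = length ts" for ts'
  proof -
    have a: "reaches_outcome k (a # k, ts') (poly (time_poly a) N) (exec N a s)"
      using IF.prems ts' by (intro IF.IH(1)) auto
    have b: "reaches_outcome k (b # k, ts') (poly (time_poly b) N) (exec N b s)"
      using IF.prems ts' by (intro IF.IH(2)) auto
    show ?thesis
      using reaches_outcome_trans[OF reaches_refl[of _ 0] a] reaches_outcome_trans[OF reaches_refl[of _ 0] b]
      by simp
  qed
  have "reaches_outcome k (IF g a b # k, ts) (poly (time_poly a) N + poly (time_poly b) N + 1) (exec N (IF g a b) s)"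
    by (rule reaches_outcome_step[OF _ _ * IF.prems(1)]) (simp_all add: reps_read_tops[OF IF.prems(1)])
  thus ?case by (simp only: time_poly.simps poly_add poly_1)
next
  case (WHILE g c)
  let ?w = "WHILE g c"
  let ?T = "poly (time_poly c) N"
  \<comment> \<open>A second induction, on the fuel: every iteration costs one test and one run of
    the body, and the last summand pays for the failing test.\<close>
  have "reaches_outcome k (?w # k, ts) (n * (?T + 1) + 1) (loop g (exec N c) n s)"
    if "reps s ts" "regs c \<subseteq> {..<length ts}" for n s ts
    using that
  proof (induction n arbitrary: s ts)
    case 0
    show ?case
    proof (cases "g (peeks s)")
      case False
      have "reaches_outcome k (?w # k, ts) (0 + 1) (Normal s)"
        by (rule reaches_outcome_step[where s = s and k'' = k])
          (simp_all add: 0 False reps_read_tops[OF 0(1)] reaches_outcome_refl)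
      thus ?thesis using False by simp
    qed (simp add: reaches_outcome_def)
  next
    case (Suc n)
    show ?case
    proof (cases "g (peeks s)")
      case False
      have "reaches_outcome k (?w # k, ts) (Suc n * (?T + 1) + 1) (Normal s)"
        by (rule reaches_outcome_step[where s = s and k'' = k])
          (simp_all add: Suc.prems False reps_read_tops[OF Suc.prems(1)] reaches_outcome_refl)
      thus ?thesis using False by simp
    next
      case True
      have *: "reaches_outcome k (c # ?w # k, ts') (?T + (n * (?T + 1) + 1)) (loop g (exec N c) (Suc n) s)"
        if ts': "reps s ts'" "length ts' = length ts" for ts'
      proof -
        have a: "reaches_outcome (?w # k) (c # ?w # k, ts') ?T (exec N c s)"
          using Suc.prems ts' by (intro WHILE.IH) auto
        show ?thesis
        proof (cases "exec N c s")
          case (Normal s')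
          then obtain ts'' where r: "reaches (c # ?w # k, ts') ?T (?w # k, ts'')"
              "reps s' ts''" "length ts'' = length ts'"
            using a by (auto simp: reaches_outcome_def)
          have b: "reaches_outcome k (?w # k, ts'') (n * (?T + 1) + 1) (loop g (exec N c) n s')"
            using Suc.prems ts' r by (intro Suc.IH) auto
          show ?thesis using reaches_outcome_trans[OF r(1) b order_refl] r Normal True by simp
        next
          case (Halted x)
          hence "\<exists>ts k'. reaches (c # ?w # k, ts') ?T (HALT x # k', ts)"
            using a by (auto simp: reaches_outcome_def)
          hence "\<exists>ts k'. reaches (c # ?w # k, ts') (?T + (n * (?T + 1) + 1)) (HALT x # k', ts)"
            by (meson reaches_mono le_add1)
          thus ?thesis using Halted True by (simp add: reaches_outcome_def)
        qed (use True in \<open>simp add: reaches_outcome_def\<close>)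
      qed
      have "reaches_outcome k (?w # k, ts) (?T + (n * (?T + 1) + 1) + 1) (loop g (exec N c) (Suc n) s)"
        by (rule reaches_outcome_step[OF _ _ * Suc.prems(1)]) (simp_all add: True reps_read_tops[OF Suc.prems(1)])
      thus ?thesis by (simp add: algebra_simps)
    qed
  qed
  from this[of s ts N] have "reaches_outcome k (?w # k, ts) (N * (?T + 1) + 1) (exec N ?w s)"
    using WHILE.prems by simp
  from reaches_outcome_trans[OF reaches_refl[of _ 0] this] show ?case
    by (auto simp: algebra_simps)
qed


subsection \<open>The compiled Turing machine\<close>

definition input_state :: "bool list list \<Rightarrow> state" where
  "input_state ws = (\<lambda>i. if i < length ws then ws ! i else [])"

text \<open>Acceptance within time \<open>t\<close> looks at the configuration after exactly
  \<open>t\<close> steps, so an earlier halting configuration has to persist.\<close>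

lemma funpow_absorb:
  assumes "f y = y" "(f ^^ m) x = y" "m \<le> t"
  shows "(f ^^ t) x = y"
proof -
  have "(f ^^ j) y = y" for j by (induction j) (auto simp: assms(1))
  moreover have "(f ^^ t) x = (f ^^ (t - m)) ((f ^^ m) x)"
    using assms(3) by (metis add.commute add_diff_inverse_nat funpow_add comp_apply not_le)
  ultimately show ?thesis using assms(2) by simp
qed

theorem program_poly_time_decidable:
  fixes P :: "bool list list \<Rightarrow> bool" and p :: "nat poly"
  assumes K: "regs c \<subseteq> {..<K}" "n \<le> K"
    and run: "\<And>ws. length ws = n \<Longrightarrow>
      exec (poly p (sum_list (map length ws))) c (input_state ws) = Halted (P ws)"
  shows "poly_time_decidable n P"
proof -
  define Q where "Q = insert [] (conts c [])"
  have finQ: "finite Q" unfolding Q_def by (simp add: finite_conts)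
  obtain h where h: "bij_betw h Q {0..<card Q}" using ex_bij_betw_finite_nat[OF finQ] by blast
  \<comment> \<open>The start state has to be 0, while \<open>h\<close> may number
    \<open>[c]\<close> differently. So all continuations are shifted by one, and 0 becomes a second
    name of \<open>[c]\<close>.\<close>
  define enc where "enc k = Suc (h k)" for k
  define dec where "dec q = (case q of 0 \<Rightarrow> [c] | Suc j \<Rightarrow> inv_into Q h j)" for q
  define acc where "acc = Suc (card Q)"
  define rej where "rej = Suc (Suc (card Q))"
  \<comment> \<open>Under \<open>delta\<close> a continuation with \<open>HALT b\<close> on top
    loops forever; the machine instead spends one step on entering \<open>acc\<close> or
    \<open>rej\<close>.\<close>
  define tr where "tr q ss = (if acc \<le> q then (q, stays ss) else case dec q of HALT b # k \<Rightarrow> (if b then acc else rej, stays ss)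
      | k \<Rightarrow> (enc (fst (delta k ss)), snd (delta k ss)))" for q ss
  define M where "M = \<lparr>num_tapes = K, num_symbols = 3, num_states = card Q + 3,
     accept_state = acc, reject_state = rej, trans_fun = tr\<rparr>"
  have dec_enc: "dec (enc k) = k" if "k \<in> Q" for k
    using h that by (auto simp: dec_def enc_def bij_betw_def)
  have enc_less: "enc k < acc" if "k \<in> Q" for k
    using h that by (auto simp: enc_def acc_def bij_betw_def)
  have dec_Q: "dec q \<in> Q" if "q < acc" for q
  proof (cases q)
    case 0
    thus ?thesis using conts_self[of c "[]"] by (simp add: dec_def Q_def)
  next
    case (Suc j)
    hence "j \<in> h ` Q" using that h by (auto simp: acc_def bij_betw_def)
    thus ?thesis using Suc by (simp add: dec_def inv_into_into)
  qed
  have closed: "fst (delta k ss) \<in> Q" if "k \<in> Q" for k ss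
    using conts_closed[of k c "[]" ss] that by (auto simp: Q_def)
  have tr_Q: "tr q ss = (enc (fst (delta (dec q) ss)), snd (delta (dec q) ss))"
    if "\<nexists>b k. dec q = HALT b # k" "q < acc" for q ss
    using that unfolding tr_def by (auto split: list.splits com.splits)
  have tr_H: "tr q ss = (if b then acc else rej, stays ss)" if "dec q = HALT b # k" "q < acc" for q ss b k
    using that unfolding tr_def by simp
  have acts: "length (snd (delta k ss)) = length ss \<and> (\<forall>(s, d) \<in> set (snd (delta k ss)). s < 3)"
    if "set ss \<subseteq> {..<3}" for k ss
  proof -
    have st: "length (stays ss) = length ss" "\<forall>(s, d) \<in> set (stays ss). s < 3"
      using that(1) by (auto simp: stays_def)
    have up: "y < 3" if "(y, d) \<in> set ((stays ss)[r := (x, m)])" "r < length ss \<Longrightarrow> x < 3" for r x m y d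
    proof (cases "r < length ss")
      case True
      thus ?thesis using set_update_subset_insert[of "stays ss" r "(x, m)"] st(2) that by fastforce
    qed (use st that in \<open>auto simp: list_update_beyond\<close>)
    have "ss ! r < 3" if "r < length ss" for r using \<open>set ss \<subseteq> {..<3}\<close> that by (meson lessThan_iff nth_mem subsetD)
    thus ?thesis using st up
      by (cases "(k, ss)" rule: delta.cases) (auto simp: sym_def dest!: up)
  qed
  have wf: "wf_tm M"
    unfolding wf_tm_def
  proof (intro conjI allI impI)
    fix q ss assume q: "q < num_states M" and ss: "length ss = num_tapes M \<and> set ss \<subseteq> {..<num_symbols M}"
    show "case trans_fun M q ss of (q', acts) \<Rightarrow> q' < num_states M \<and> length acts = num_tapes M \<and>
        (\<forall>(s, d) \<in> set acts. s < num_symbols M)"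
    proof (cases "q < acc")
      case False
      thus ?thesis using q ss by (auto simp: M_def tr_def stays_def)
    next
      case True
      have ss': "set ss \<subseteq> {..<3}" "length ss = K" using ss by (auto simp: M_def)
      show ?thesis
      proof (cases "\<exists>b k. dec q = HALT b # k")
        case True
        then obtain b k where "dec q = HALT b # k" by blast
        thus ?thesis using tr_H[OF _ \<open>q < acc\<close>] ss' by (auto simp: M_def stays_def acc_def rej_def)
      next
        case False
        have "enc (fst (delta (dec q) ss)) < acc" using closed[OF dec_Q[OF True]] enc_less by blast
        thus ?thesis using tr_Q[OF False True] acts[OF ss'(1), of "dec q"] ss' by (auto simp: M_def acc_def)
      qed
    qed
  qed (auto simp: M_def acc_def rej_def)
  have step: "\<exists>q'. tm_step M (q, ts) = (q', snd (cstep (k, ts))) \<and> q' < acc \<and> dec q' = fst (cstep (k, ts))"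
    if "q < acc" "dec q = k" "\<nexists>b k'. k = HALT b # k'" for q k ts
  proof -
    have "trans_fun M q (map tape_read ts) =
        (enc (fst (delta k (map tape_read ts))), snd (delta k (map tape_read ts)))"
      using tr_Q[of q] that by (auto simp: M_def)
    moreover have "q \<noteq> accept_state M" "q \<noteq> reject_state M" using that(1) by (auto simp: M_def acc_def rej_def)
    moreover have "fst (delta k (map tape_read ts)) \<in> Q" using closed dec_Q that by blast
    ultimately show ?thesis
      by (intro exI[of _ "enc (fst (delta k (map tape_read ts)))"])
        (auto simp: enc_less dec_enc act_all_def split: prod.splits)
  qed
  have halt_step: "fst (cstep (HALT b # k, ts)) = HALT b # k" for b k ts by simp
  have halt_fix: "fst ((cstep ^^ m) (HALT b # k, ts)) = HALT b # k" for m b k ts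
  proof (induction m)
    case (Suc m)
    thus ?case using halt_step by (metis funpow_simps_right(2) comp_apply funpow.simps(2) prod.collapse)
  qed simp
  \<comment> \<open>The run of \<open>cstep\<close> may idle in a halting continuation, whereas the
    machine leaves it. Hence the first visit is located, possibly earlier than
    \<open>m\<close>.\<close>
  have steps: "\<exists>m' \<le> m. \<exists>q' ts''. (tm_step M ^^ m') (q, ts) = (q', ts'') \<and> q' < acc \<and> dec q' = HALT b # k'"
    if "q < acc" "(cstep ^^ m) (dec q, ts) = (HALT b # k', ts')" for q m b k' ts ts'
    using that
  proof (induction m arbitrary: q ts)
    case 0
    thus ?case by auto
  next
    case (Suc m)
    show ?case
    proof (cases "\<exists>b k. dec q = HALT b # k")
      case True
      then obtain b' k'' where d: "dec q = HALT b' # k''" by blast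
      hence "HALT b # k' = HALT b' # k''" using halt_fix[of "Suc m" b' k'' ts] Suc.prems(2) by (metis fst_conv)
      thus ?thesis using Suc.prems(1) d by (intro exI[of _ 0]) auto
    next
      case False
      obtain q1 where q1: "tm_step M (q, ts) = (q1, snd (cstep (dec q, ts)))" "q1 < acc"
          "dec q1 = fst (cstep (dec q, ts))"
        using step[OF Suc.prems(1) refl False] by blast
      have "(cstep ^^ m) (dec q1, snd (cstep (dec q, ts))) = (HALT b # k', ts')"
        using Suc.prems(2) unfolding q1(3) funpow_Suc_right by simp
      from Suc.IH[OF q1(2) this] obtain m' q' ts'' where
        "m' \<le> m" "(tm_step M ^^ m') (q1, snd (cstep (dec q, ts))) = (q', ts'')" "q' < acc" "dec q' = HALT b # k'"
        by blast
      thus ?thesis using q1(1)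
        by (intro exI[of _ "Suc m'"]) (auto simp: funpow_Suc_right simp del: funpow.simps tm_step.simps)
    qed
  qed
  \<comment> \<open>The additional step leads from the halting continuation to \<open>acc\<close> or
    \<open>rej\<close>.\<close>
  define tp where "tp = pcompose (time_poly c) p + 1"
  have "if P ws then tm_accepts_within M ws (poly tp (sum_list (map length ws)))
      else tm_rejects_within M ws (poly tp (sum_list (map length ws)))" if ws: "length ws = n" for ws
  proof -
    define len where "len = sum_list (map length ws)"
    define ts where "ts = map word_tape ws @ replicate (K - length ws) ([], [])"
    have lts: "length ts = K" using ws K by (simp add: ts_def)
    have word: "rep (word_tape w) w" for w
      by (auto simp: rep_def word_tape_def sym_def intro!: exI[of _ 0])
    have "reps (input_state ws) ts"
      unfolding reps_def lts
    proof (intro conjI allI impI)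
      fix i assume "i < K"
      thus "rep (ts ! i) (input_state ws i)"
        using word ws K by (auto simp: ts_def input_state_def nth_append rep_def)
    qed (use ws K in \<open>auto simp: input_state_def\<close>)
    from cstep_exec[OF this, of c "[]" "poly p len"] K lts run[OF ws]
    obtain ts' k' where "reaches ([c], ts) (poly (time_poly c) (poly p len)) (HALT (P ws) # k', ts')"
      by (auto simp: reaches_outcome_def len_def)
    then obtain m where m: "m \<le> poly (time_poly c) (poly p len)" "(cstep ^^ m) ([c], ts) = (HALT (P ws) # k', ts')"
      unfolding reaches_def by blast
    have "0 < acc" "dec 0 = [c]" by (auto simp: acc_def dec_def)
    from steps[OF this(1), of m ts] m(2) this obtain m' q' ts'' where
      m': "m' \<le> m" "(tm_step M ^^ m') (0, ts) = (q', ts'')" "q' < acc" "dec q' = HALT (P ws) # k'"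
      by metis
    define qf where "qf = (if P ws then acc else rej)"
    have "\<exists>ts3. tm_step M (q', ts'') = (qf, ts3)"
      using tr_H[OF m'(4,3)] m'(3) by (auto simp: M_def acc_def rej_def qf_def)
    then obtain ts3 where "(tm_step M ^^ Suc m') (0, ts) = (qf, ts3)" using m' by auto
    moreover have "tm_step M (qf, ts3) = (qf, ts3)" by (simp add: qf_def M_def)
    moreover have "Suc m' \<le> poly tp len" using m(1) m'(1) by (simp add: tp_def poly_pcompose)
    ultimately have "(tm_step M ^^ poly tp len) (0, ts) = (qf, ts3)" using funpow_absorb by metis
    moreover have "tm_init M ws = (0, ts)" by (simp add: tm_init_def ts_def M_def)
    ultimately show ?thesis
      unfolding tm_accepts_within_def tm_rejects_within_def len_def[symmetric]
      by (simp add: qf_def M_def)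
  qed
  moreover have "n \<le> num_tapes M" using K by (simp add: M_def)
  ultimately show ?thesis unfolding poly_time_decidable_def Let_def using wf
    by (intro exI[of _ M] exI[of _ tp]) simp
qed


section \<open>A verifier in polynomial time\<close>

subsection \<open>Weakest preconditions\<close>


text \<open>Here \<open>a\<close> is the correct verdict: halting with \<open>a\<close> at any point
  counts as success and need not establish \<open>Q\<close>, whereas a timeout is a failure.
  Correctness of a complete program is thus \<open>wp\<close> with a postcondition that never
  holds.\<close>

definition wp :: "nat \<Rightarrow> bool \<Rightarrow> com \<Rightarrow> (state \<Rightarrow> bool) \<Rightarrow> state \<Rightarrow> bool" where
  "wp N a c Q s = (case exec N c s of Normal s' \<Rightarrow> Q s' | Halted b \<Rightarrow> b = a | Timeout \<Rightarrow> False)"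

lemma wp_simps [simp]:
  "wp N a SKIP Q s = Q s"
  "wp N a (PUT r f) Q s = Q (s(r := f (peeks s) # tl (s r)))"
  "wp N a (PUSH r f) Q s = Q (s(r := f (peeks s) # s r))"
  "wp N a (POP r) Q s = Q (s(r := tl (s r)))"
  "wp N a (HALT b) Q s = (b = a)"
  "wp N a (c ;; d) Q = wp N a c (wp N a d Q)"
  "wp N a (IF g c d) Q s = (if g (peeks s) then wp N a c Q s else wp N a d Q s)"
  by (auto simp: wp_def fun_eq_iff split: outcome.splits)

lemma wp_mono: "wp N a c Q s \<Longrightarrow> (\<And>s. Q s \<Longrightarrow> Q' s) \<Longrightarrow> wp N a c Q' s"
  by (auto simp: wp_def split: outcome.splits)

text \<open>The index of the invariant \<open>J\<close> bounds the number of remaining iterations,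
  so it is a variant and at the same time shows that the fuel \<open>N\<close> suffices.\<close>

lemma wp_while:
  assumes "J n s" "n \<le> N"
    and step: "\<And>k s. J k s \<Longrightarrow> g (peeks s) \<Longrightarrow> k \<noteq> 0 \<and> wp N a c (J (k - 1)) s"
    and exit: "\<And>k s. J k s \<Longrightarrow> \<not> g (peeks s) \<Longrightarrow> Q s"
  shows "wp N a (WHILE g c) Q s"
proof -
  have "case loop g (exec N c) m s of Normal s' \<Rightarrow> Q s' | Halted b \<Rightarrow> b = a | Timeout \<Rightarrow> False"
    if "J k s" "k \<le> m" for k m s
    using that
  proof (induction m arbitrary: k s)
    case 0
    thus ?case using step[of 0 s] exit[of 0 s] by auto
  next
    case (Suc m)
    show ?case
    proof (cases "g (peeks s)")
      case True
      have *: "k \<noteq> 0" "wp N a c (J (k - 1)) s" using step[OF Suc.prems(1) True] by auto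
      show ?thesis
      proof (cases "exec N c s")
        case (Normal s')
        hence "J (k - 1) s'" using * by (simp add: wp_def)
        hence "case loop g (exec N c) m s' of Normal s' \<Rightarrow> Q s' | Halted b \<Rightarrow> b = a | Timeout \<Rightarrow> False"
          using Suc.prems * by (intro Suc.IH) auto
        thus ?thesis using True Normal by simp
      qed (use * True in \<open>auto simp: wp_def\<close>)
    qed (use exit[OF Suc.prems(1)] in auto)
  qed
  from this[OF assms(1,2)] show ?thesis by (simp add: wp_def)
qed

lemma wp_loop:
  assumes "loop g (exec N c) N s = Normal s'" "Q s'"
  shows "wp N a (WHILE g c) Q s"
  using assms by (simp add: wp_def)

abbreviation isT :: "bool option \<Rightarrow> bool" where
  "isT x \<equiv> x = Some True"

definition nonempty :: "bool option \<Rightarrow> bool" where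
  "nonempty x \<longleftrightarrow> x \<noteq> None"

lemma nonempty_simps [simp]: "\<not> nonempty None" "nonempty (Some b)"
  by (simp_all add: nonempty_def)

lemma nonempty_peek [simp]: "nonempty (peek xs) \<longleftrightarrow> xs \<noteq> []"
  by (cases xs) (auto simp: nonempty_def)

text \<open>
  Registers: 0 is the unread part of the instance, 1 and 2 are the codes of \<open>x\<close> and \<open>u\<close>, 3 to 7
  the dimensions in unary, 8 and 9 cursors at the next entry of \<open>a\<close> and of \<open>b\<close>. Register 10 is
  nonempty once \<open>u\<close> has violated a constraint. The accumulator is in 11, 12, 13, the next
  term in 14, a fraction in 20 (sign), 15, 16, and weights in 17, 21. Loops count in 22, 23, 24,
  arithmetic uses 25 to 30 as scratch space, and 32, 33 are cursors in copies of the codes.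
\<close>

definition move_reg :: "nat \<Rightarrow> nat \<Rightarrow> com" where
  "move_reg r t = WHILE (\<lambda>p. nonempty (p r)) (PUSH t (\<lambda>p. isT (p r)) ;; POP r)"

lemma wp_move:
  assumes "r \<noteq> t" "length (s r) \<le> N" "Q (s(r := [], t := rev (s r) @ s t))"
  shows "wp N a (move_reg r t) Q s"
proof -
  define f where "f = exec N (PUSH t (\<lambda>p. isT (p r)) ;; POP r)"
  have f: "f s = Normal (s(t := isT (peek (s r)) # s t, r := tl (s r)))" for s
    using assms(1) by (simp add: f_def)
  have "loop (\<lambda>p. nonempty (p r)) f n s = Normal (s(r := [], t := rev (s r) @ s t))"
    if "length (s r) \<le> n" for s n
    using that
  proof (induction n arbitrary: s)
    case (Suc n)
    show ?case using Suc.prems assms(1)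
      by (cases "s r") (auto simp: f[of s] Suc.IH fun_eq_iff)
  qed (auto simp: fun_eq_iff)
  from this[of s] show ?thesis using assms unfolding move_reg_def f_def by (intro wp_loop) auto
qed

definition clear_reg :: "nat \<Rightarrow> com" where
  "clear_reg r = WHILE (\<lambda>p. nonempty (p r)) (POP r)"

lemma wp_clear:
  assumes "length (s r) \<le> N" "Q (s(r := []))"
  shows "wp N a (clear_reg r) Q s"
proof -
  define f where "f = exec N (POP r)"
  have f: "f s = Normal (s(r := tl (s r)))" for s
    by (simp add: f_def)
  have "loop (\<lambda>p. nonempty (p r)) f n s = Normal (s(r := []))" if "length (s r) \<le> n" for s n
    using that
  proof (induction n arbitrary: s)
    case (Suc n)
    show ?case using Suc.prems by (cases "s r") (auto simp: f[of s] Suc.IH fun_eq_iff)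
  qed (auto simp: fun_eq_iff)
  from this[of s] show ?thesis using assms unfolding clear_reg_def f_def by (intro wp_loop) auto
qed

text \<open>Popping and pushing reverses a stack; the detour over register 25 restores the order in
  \<open>r\<close> and produces it in \<open>t\<close>. What \<open>t\<close> contained stays below
  the copy.\<close>

definition copy_reg :: "nat \<Rightarrow> nat \<Rightarrow> com" where
  "copy_reg r t = move_reg r 25 ;;
     WHILE (\<lambda>p. nonempty (p 25)) (PUSH r (\<lambda>p. isT (p 25)) ;; PUSH t (\<lambda>p. isT (p 25)) ;; POP 25)"

lemma wp_copy:
  assumes "r \<noteq> t" "r \<noteq> 25" "t \<noteq> 25" "s 25 = []" "length (s r) \<le> N" "Q (s(t := s r @ s t))"
  shows "wp N a (copy_reg r t) Q s"
proof -
  define f where "f = exec N (PUSH r (\<lambda>p. isT (p 25)) ;; PUSH t (\<lambda>p. isT (p 25)) ;; POP 25)"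
  have f: "f s = Normal (s(r := isT (peek (s 25)) # s r, t := isT (peek (s 25)) # s t, 25 := tl (s 25)))" for s
    using assms(1-3) by (simp add: f_def)
  have *: "loop (\<lambda>p. nonempty (p 25)) f n s =
      Normal (s(25 := [], r := rev (s 25) @ s r, t := rev (s 25) @ s t))"
    if "length (s 25) \<le> n" for s n
    using that
  proof (induction n arbitrary: s)
    case (Suc n)
    show ?case using Suc.prems assms(1-3)
      by (cases "s 25") (auto simp: f[of s] Suc.IH fun_eq_iff)
  qed (auto simp: fun_eq_iff)
  let ?s = "s(r := [], 25 := rev (s r) @ s 25)"
  have "wp N a (WHILE (\<lambda>p. nonempty (p 25)) (PUSH r (\<lambda>p. isT (p 25)) ;; PUSH t (\<lambda>p. isT (p 25)) ;; POP 25)) Q ?s"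
  proof (rule wp_loop[OF *[unfolded f_def]])
    have "?s(25 := [], r := rev (?s 25) @ ?s r, t := rev (?s 25) @ ?s t) = s(t := s r @ s t)"
      using assms by (auto simp: fun_eq_iff)
    thus "Q (?s(25 := [], r := rev (?s 25) @ ?s r, t := rev (?s 25) @ ?s t))" using assms(6) by simp
  qed (use assms in simp)
  thus ?thesis using assms by (auto simp: copy_reg_def intro!: wp_move)
qed


subsection \<open>Binary arithmetic\<close>

fun bits_val :: "bool list \<Rightarrow> nat" where
  "bits_val [] = 0"
| "bits_val (b # bs) = of_bool b + 2 * bits_val bs"

lemma bits_val_append: "bits_val (xs @ ys) = bits_val xs + 2 ^ length xs * bits_val ys"
  by (induction xs) (auto simp: algebra_simps)

text \<open>Formulated with \<open>peek\<close> and \<open>tl\<close> so that one unfolding matches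
  one iteration of \<open>add_reg\<close>, and the shorter number is padded with zeros by
  itself.\<close>

function bits_add :: "bool list \<Rightarrow> bool list \<Rightarrow> bool \<Rightarrow> bool list" where
  "bits_add xs ys c = (if xs = [] \<and> ys = [] then (if c then [True] else [])
     else (isT (peek xs) \<noteq> (isT (peek ys) \<noteq> c)) #
       bits_add (tl xs) (tl ys) (if isT (peek xs) then isT (peek ys) \<or> c else isT (peek ys) \<and> c))"
  by auto
termination by (relation "measure (\<lambda>(xs, ys, c). length xs + length ys)") (auto simp: length_greater_0_conv[symmetric] simp del: length_greater_0_conv)

declare bits_add.simps [simp del]

lemma bits_val_peek_tl: "bits_val xs = of_bool (isT (peek xs)) + 2 * bits_val (tl xs)"
  by (cases xs) auto

lemma bits_add_Nil [simp]: "bits_add [] [] c = (if c then [True] else [])"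
  by (subst bits_add.simps) simp

lemma bits_add_rec: "\<not> (xs = [] \<and> ys = []) \<Longrightarrow> bits_add xs ys c = (isT (peek xs) \<noteq> (isT (peek ys) \<noteq> c)) #
     bits_add (tl xs) (tl ys) (if isT (peek xs) then isT (peek ys) \<or> c else isT (peek ys) \<and> c)"
  by (subst bits_add.simps) (simp only: if_False)

lemma bits_val_bits_add: "bits_val (bits_add xs ys c) = bits_val xs + bits_val ys + of_bool c"
proof (induction xs ys c rule: bits_add.induct)
  case (1 xs ys c)
  show ?case
  proof (cases "xs = [] \<and> ys = []")
    case False
    show ?thesis
      using 1[OF False] bits_val_peek_tl[of xs] bits_val_peek_tl[of ys] by (auto simp: bits_add_rec[OF False])
  qed simp
qed

lemma length_bits_add: "length (bits_add xs ys c) \<le> max (length xs) (length ys) + 1"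
proof (induction xs ys c rule: bits_add.induct)
  case (1 xs ys c)
  show ?case
  proof (cases "xs = [] \<and> ys = []")
    case False
    hence "max (length (tl xs)) (length (tl ys)) + 1 = max (length xs) (length ys)"
      by (cases xs; cases ys) auto
    thus ?thesis using 1[OF False] by (simp add: bits_add_rec[OF False])
  qed simp
qed

text \<open>Register 30 holds the carry, an empty stack meaning none, and 29 collects the sum in
  reverse. Register \<open>t\<close> is consumed.\<close>

definition add_reg :: "nat \<Rightarrow> nat \<Rightarrow> com" where
  "add_reg r t =
     WHILE (\<lambda>p. nonempty (p r) \<or> nonempty (p t))
       (PUSH 29 (\<lambda>p. isT (p r) \<noteq> (isT (p t) \<noteq> isT (p 30))) ;;
        PUT 30 (\<lambda>p. if isT (p r) then isT (p t) \<or> isT (p 30) else isT (p t) \<and> isT (p 30)) ;;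
        POP r ;; POP t) ;;
     IF (\<lambda>p. isT (p 30)) (PUSH 29 (\<lambda>_. True)) SKIP ;; POP 30 ;; move_reg 29 r"

lemma wp_add:
  assumes "r \<noteq> t" "r \<notin> {29, 30}" "t \<notin> {29, 30}" "s 29 = []" "s 30 = []"
    and "length (s r) < N" "length (s t) < N" "Q (s(r := bits_add (s r) (s t) False, t := []))"
  shows "wp N a (add_reg r t) Q s"
proof -
  let ?g = "\<lambda>p. nonempty (p r) \<or> nonempty (p t)"
  let ?c = "PUSH 29 (\<lambda>p. isT (p r) \<noteq> (isT (p t) \<noteq> isT (p 30))) ;;
        PUT 30 (\<lambda>p. if isT (p r) then isT (p t) \<or> isT (p 30) else isT (p t) \<and> isT (p 30)) ;;
        POP r ;; POP t"
  \<comment> \<open>Invariant: the digits produced so far, followed by the sum of the remaining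
    digits with the current carry, form the whole sum.\<close>
  define J where "J k s' \<longleftrightarrow> (\<exists>xs ys zs c. s' = s(r := xs, t := ys, 29 := zs, 30 := c) \<and> length c \<le> 1 \<and>
     rev zs @ bits_add xs ys (isT (peek c)) = bits_add (s r) (s t) False \<and> k = max (length xs) (length ys))" for k s'
  let ?n = "max (length (s r)) (length (s t))"
  have lb: "length (bits_add (s r) (s t) False) \<le> N" using length_bits_add[of "s r" "s t" False] assms by simp
  have "wp N a (WHILE ?g ?c) (wp N a (IF (\<lambda>p. isT (p 30)) (PUSH 29 (\<lambda>_. True)) SKIP ;; POP 30 ;; move_reg 29 r) Q) s"
  proof (rule wp_while[where J = J and n = ?n])
    show "J ?n s" unfolding J_def
      by (intro exI[of _ "s r"] exI[of _ "s t"] exI[of _ "s 29"] exI[of _ "s 30"]) (auto simp: assms)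
    show "?n \<le> N" using assms by simp
  next
    fix k s' assume "J k s'" and g: "?g (peeks s')"
    then obtain xs ys zs c where s': "s' = s(r := xs, t := ys, 29 := zs, 30 := c)" "length c \<le> 1"
      "rev zs @ bits_add xs ys (isT (peek c)) = bits_add (s r) (s t) False" "k = max (length xs) (length ys)"
      unfolding J_def by blast
    have ne: "\<not> (xs = [] \<and> ys = [])" using g s' assms(1-3) by auto
    define b where "b = (isT (peek xs) \<noteq> (isT (peek ys) \<noteq> isT (peek c)))"
    define c' where "c' = (if isT (peek xs) then isT (peek ys) \<or> isT (peek c) else isT (peek ys) \<and> isT (peek c))"
    have eq: "bits_add xs ys (isT (peek c)) = b # bits_add (tl xs) (tl ys) c'"
      by (simp only: bits_add_rec[OF ne] b_def c'_def)
    have tlc: "tl c = []" using s'(2) by (cases c) auto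
    have "J (k - 1) (s(r := tl xs, t := tl ys, 29 := b # zs, 30 := [c']))"
      unfolding J_def
      by (intro exI[of _ "tl xs"] exI[of _ "tl ys"] exI[of _ "b # zs"] exI[of _ "[c']"])
        (use s' eq ne in auto)
    moreover have "s(29 := b # zs, 30 := [c'], r := tl xs, t := tl ys) =
       s(r := tl xs, t := tl ys, 29 := b # zs, 30 := [c'])"
      using assms(1-3) by (auto simp: fun_eq_iff)
    moreover have "k \<noteq> 0" using ne s' by auto
    ultimately show "k \<noteq> 0 \<and> wp N a ?c (J (k - 1)) s'"
      using assms(1-3) s'(1) tlc by (simp add: b_def c'_def split del: if_split cong: if_cong)
  next
    fix k s' assume "J k s'" and g: "\<not> ?g (peeks s')"
    then obtain xs ys zs c where s': "s' = s(r := xs, t := ys, 29 := zs, 30 := c)" "length c \<le> 1"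
      "rev zs @ bits_add xs ys (isT (peek c)) = bits_add (s r) (s t) False" "k = max (length xs) (length ys)"
      unfolding J_def by blast
    have ne: "xs = []" "ys = []" using g s' assms(1-3) by auto
    define zs' where "zs' = (if isT (peek c) then True # zs else zs)"
    have zs': "rev zs' = bits_add (s r) (s t) False" using s'(3) ne by (simp add: zs'_def split: if_splits)
    hence lz: "length zs' \<le> N" using lb by (metis length_rev)
    have tlc: "tl c = []" using s'(2) by (cases c) auto
    let ?s = "s(r := [], t := [], 29 := zs', 30 := [])"
    have "s(r := bits_add (s r) (s t) False, t := []) = ?s(29 := [], r := rev (?s 29) @ ?s r)"
      using assms(1-5) zs' by (auto simp: fun_eq_iff)
    hence 1: "wp N a (move_reg 29 r) Q ?s"
      using assms(1-3,8) lz by (intro wp_move) auto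
    have "s' = s(r := [], t := [], 29 := zs, 30 := c)" using s'(1) ne by simp
    moreover have "s(r := [], t := [], 29 := zs, 30 := c, 29 := True # zs, 30 := []) =
        s(r := [], t := [], 29 := True # zs, 30 := [])" by (auto simp: fun_eq_iff)
    ultimately show "wp N a (IF (\<lambda>p. isT (p 30)) (PUSH 29 (\<lambda>_. True)) SKIP ;; POP 30 ;; move_reg 29 r) Q s'"
      using 1 tlc by (simp add: zs'_def split: if_splits)
  qed
  thus ?thesis by (simp add: add_reg_def)
qed

text \<open>Horner's scheme: the multiplier is read from its most significant bit, and the
  accumulator is doubled by a zero in front before the multiplicand is added.\<close>

fun bits_mul_acc :: "bool list \<Rightarrow> bool list \<Rightarrow> bool list \<Rightarrow> bool list" where
  "bits_mul_acc xs bs [] = bs"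
| "bits_mul_acc xs bs (m # ms) = bits_mul_acc xs (if m then bits_add (False # bs) xs False else False # bs) ms"

lemma bits_val_bits_mul_acc: "bits_val (bits_mul_acc xs bs ms) = bits_val bs * 2 ^ length ms + bits_val xs * bits_val (rev ms)"
  by (induction ms arbitrary: bs) (auto simp: bits_val_bits_add bits_val_append algebra_simps)

text \<open>Each bit of the multiplier lengthens the accumulator by at most two, one for the
  doubling and one for the carry. Growth is additive, hence a sequence of products keeps polynomial
  length.\<close>

lemma length_bits_mul_acc: "length (bits_mul_acc xs bs ms) \<le> max (length bs) (length xs) + 2 * length ms"
proof (induction ms arbitrary: bs)
  case (Cons m ms)
  show ?case using Cons[of "if m then bits_add (False # bs) xs False else False # bs"]
      length_bits_add[of "False # bs" xs False] by (auto split: if_splits)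
qed simp

definition bits_mul :: "bool list \<Rightarrow> bool list \<Rightarrow> bool list" where
  "bits_mul xs ms = bits_mul_acc xs [] ms"

lemma bits_val_bits_mul: "bits_val (bits_mul xs ms) = bits_val xs * bits_val (rev ms)"
  by (simp add: bits_mul_def bits_val_bits_mul_acc)

lemma length_bits_mul: "length (bits_mul xs ms) \<le> length xs + 2 * length ms"
  using length_bits_mul_acc[of xs "[]" ms] by (simp add: bits_mul_def)

text \<open>Multipliers are stored with the most significant bit on top, multiplicands with the least
  significant one on top.\<close>

definition mul_reg :: "nat \<Rightarrow> nat \<Rightarrow> com" where
  "mul_reg r t =
     WHILE (\<lambda>p. nonempty (p t))
       (PUSH 26 (\<lambda>_. False) ;;
        IF (\<lambda>p. isT (p t)) (copy_reg r 27 ;; add_reg 26 27) SKIP ;;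
        PUSH 28 (\<lambda>p. isT (p t)) ;; POP t) ;;
     move_reg 28 t ;; clear_reg r ;; move_reg 26 25 ;; move_reg 25 r"

lemma wp_mul:
  assumes "r \<noteq> t" "r \<notin> {25..30}" "t \<notin> {25..30}" "\<forall>i \<in> {25..30}. s i = []"
    and "length (s r) + 2 * length (s t) + 2 < N" "Q (s(r := bits_mul (s r) (s t)))"
  shows "wp N a (mul_reg r t) Q s"
proof -
  have neq: "r \<noteq> 25" "r \<noteq> 26" "r \<noteq> 27" "r \<noteq> 28" "r \<noteq> 29" "r \<noteq> 30"
     "t \<noteq> 25" "t \<noteq> 26" "t \<noteq> 27" "t \<noteq> 28" "t \<noteq> 29" "t \<noteq> 30" "t \<noteq> r"
    using assms(1-3) by auto
  have emp: "s 25 = []" "s 26 = []" "s 27 = []" "s 28 = []" "s 29 = []" "s 30 = []"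
    using assms(4) by auto
  let ?c = "PUSH 26 (\<lambda>_. False) ;;
        IF (\<lambda>p. isT (p t)) (copy_reg r 27 ;; add_reg 26 27) SKIP ;;
        PUSH 28 (\<lambda>p. isT (p t)) ;; POP t"
  \<comment> \<open>Register 28 keeps the multiplier bits already used, from which \<open>t\<close>
    is restored at the end; a factor such as a denominator serves several products.\<close>
  define J where "J k s' \<longleftrightarrow> (\<exists>bs ms ms'. s' = s(26 := bs, t := ms, 28 := ms') \<and>
     rev ms' @ ms = s t \<and> bits_mul_acc (s r) bs ms = bits_mul (s r) (s t) \<and>
     length bs \<le> length (s r) + 2 * length ms' \<and> k = length ms)" for k s'
  have "wp N a (WHILE (\<lambda>p. nonempty (p t)) ?c)
      (wp N a (move_reg 28 t ;; clear_reg r ;; move_reg 26 25 ;; move_reg 25 r) Q) s"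
  proof (rule wp_while[where J = J and n = "length (s t)"])
    show "J (length (s t)) s" unfolding J_def
      by (intro exI[of _ "[]"] exI[of _ "s t"]) (auto simp: bits_mul_def emp fun_eq_iff)
    show "length (s t) \<le> N" using assms by simp
  next
    fix k s' assume "J k s'" and g: "nonempty (peeks s' t)"
    then obtain bs ms ms' where s': "s' = s(26 := bs, t := ms, 28 := ms')" and ms: "rev ms' @ ms = s t"
      and acc: "bits_mul_acc (s r) bs ms = bits_mul (s r) (s t)" and len: "length bs \<le> length (s r) + 2 * length ms'"
      and k: "k = length ms"
      unfolding J_def by blast
    obtain m ns where m: "ms = m # ns" using g s' neq by (cases ms) auto
    have lens: "length ms' + length ms = length (s t)" using arg_cong[OF ms, of length] by simp
    define bs' where "bs' = (if m then bits_add (False # bs) (s r) False else False # bs)"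
    have "length bs' \<le> length (s r) + 2 * length ms' + 2"
      using length_bits_add[of "False # bs" "s r" False] len by (auto simp: bs'_def)
    hence J': "J (k - 1) (s(26 := bs', t := ns, 28 := m # ms'))"
      unfolding J_def
      by (intro exI[of _ bs'] exI[of _ ns] exI[of _ "m # ms'"]) (use ms acc k m in \<open>auto simp: bs'_def\<close>)
    have lb: "Suc (length bs) < N" "length (s r) < N" "length (s r) \<le> N"
      using len lens assms(5) by linarith+
    have fin: "wp N a (PUSH 28 (\<lambda>p. isT (p t)) ;; POP t) (J (k - 1)) (s(26 := bs', t := ms, 28 := ms'))"
      using J' neq by (auto simp: m fun_upd_twist)
    have "wp N a (IF (\<lambda>p. isT (p t)) (copy_reg r 27 ;; add_reg 26 27) SKIP)
       (wp N a (PUSH 28 (\<lambda>p. isT (p t)) ;; POP t) (J (k - 1))) (s(26 := False # bs, t := ms, 28 := ms'))"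
    proof (cases m)
      case True
      have eq: "s(26 := bs', t := ms, 28 := ms') =
         s(26 := False # bs, t := ms, 28 := ms', 27 := s r @ [], 26 := bs', 27 := [])"
        using neq emp by (auto simp: fun_eq_iff)
      have "wp N a (add_reg 26 27) (wp N a (PUSH 28 (\<lambda>p. isT (p t)) ;; POP t) (J (k - 1)))
         (s(26 := False # bs, t := ms, 28 := ms', 27 := s r @ []))"
        using fin[unfolded eq] True lb neq emp
        by (intro wp_add) (auto simp: bs'_def)
      thus ?thesis using neq emp lb True m by (auto intro!: wp_copy)
    next
      case False
      thus ?thesis using fin neq m by (simp add: bs'_def)
    qed
    hence "wp N a ?c (J (k - 1)) s'" using s' neq by (simp add: fun_upd_twist)
    thus "k \<noteq> 0 \<and> wp N a ?c (J (k - 1)) s'" using k m by simp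
  next
    fix k s' assume "J k s'" and g: "\<not> nonempty (peeks s' t)"
    then obtain bs ms ms' where s': "s' = s(26 := bs, t := ms, 28 := ms')" and ms: "rev ms' @ ms = s t"
      and acc: "bits_mul_acc (s r) bs ms = bits_mul (s r) (s t)" and len: "length bs \<le> length (s r) + 2 * length ms'"
      and k: "k = length ms"
      unfolding J_def by blast
    have m: "ms = []" using g s' neq by auto
    have lens: "length ms' = length (s t)" using arg_cong[OF ms, of length] m by simp
    have bs: "bs = bits_mul (s r) (s t)" using acc m by simp
    have Q: "Q (s(r := bits_mul (s r) (s t)))" by (rule assms(6))
    have eq: "s(r := bits_mul (s r) (s t)) = s(26 := [], t := rev ms', 28 := [], r := rev (rev bs), 25 := [])"
      using neq emp ms m bs by (auto simp: fun_eq_iff)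
    have 4: "wp N a (move_reg 25 r) Q (s(26 := [], t := rev ms', 28 := [], r := [], 25 := rev bs))"
      by (rule wp_move) (use neq emp lens len assms(5) Q[unfolded eq] in \<open>auto simp: fun_upd_twist\<close>)
    have 3: "wp N a (move_reg 26 25) (wp N a (move_reg 25 r) Q) (s(26 := bs, t := rev ms', 28 := [], r := []))"
      by (rule wp_move) (use neq emp lens len assms(5) 4 in \<open>auto simp: fun_upd_twist\<close>)
    have 2: "wp N a (clear_reg r) (wp N a (move_reg 26 25) (wp N a (move_reg 25 r) Q)) (s(26 := bs, t := rev ms', 28 := []))"
      by (rule wp_clear) (use neq emp lens len assms(5) 3 in \<open>auto simp: fun_upd_twist\<close>)
    have 1: "wp N a (move_reg 28 t) (wp N a (clear_reg r) (wp N a (move_reg 26 25) (wp N a (move_reg 25 r) Q))) (s(26 := bs, t := [], 28 := ms'))"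
      by (rule wp_move) (use neq emp lens len assms(5) 2 in \<open>auto simp: fun_upd_twist\<close>)
    show "wp N a (move_reg 28 t ;; clear_reg r ;; move_reg 26 25 ;; move_reg 25 r) Q s'"
      using 1 unfolding s' m by simp
  qed
  thus ?thesis by (simp add: mul_reg_def)
qed

text \<open>The least significant digits come first, so the last position where the numbers differ
  decides, and \<open>c\<close> is the verdict on the digits already passed.\<close>

fun bits_le :: "bool list \<Rightarrow> bool list \<Rightarrow> bool \<Rightarrow> bool" where
  "bits_le [] [] c = c"
| "bits_le (x # xs) [] c = bits_le xs [] (if x then False else c)"
| "bits_le [] (y # ys) c = bits_le [] ys (if y then True else c)"
| "bits_le (x # xs) (y # ys) c = bits_le xs ys (if x \<noteq> y then y else c)"

lemma bits_le_bits_val: "bits_le xs ys c \<longleftrightarrow> bits_val xs < bits_val ys \<or> (bits_val xs = bits_val ys \<and> c)"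
  by (induction xs ys c rule: bits_le.induct) auto

lemma bits_le_rec: "xs \<noteq> [] \<or> ys \<noteq> [] \<Longrightarrow>
   bits_le xs ys c = bits_le (tl xs) (tl ys) (if isT (peek xs) \<noteq> isT (peek ys) then isT (peek ys) else c)"
  by (cases xs; cases ys) auto

definition le_reg :: "nat \<Rightarrow> nat \<Rightarrow> com" where
  "le_reg r t = PUSH 30 (\<lambda>_. True) ;;
     WHILE (\<lambda>p. nonempty (p r) \<or> nonempty (p t))
       (IF (\<lambda>p. isT (p r) \<noteq> isT (p t)) (PUT 30 (\<lambda>p. isT (p t))) SKIP ;; POP r ;; POP t)"

lemma wp_le:
  assumes "r \<noteq> t" "r \<noteq> 30" "t \<noteq> 30" "s 30 = []"
    and "length (s r) \<le> N" "length (s t) \<le> N" "Q (s(r := [], t := [], 30 := [bits_val (s r) \<le> bits_val (s t)]))"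
  shows "wp N a (le_reg r t) Q s"
proof -
  let ?g = "\<lambda>p. nonempty (p r) \<or> nonempty (p t)"
  let ?c = "IF (\<lambda>p. isT (p r) \<noteq> isT (p t)) (PUT 30 (\<lambda>p. isT (p t))) SKIP ;; POP r ;; POP t"
  define J where "J k s' \<longleftrightarrow> (\<exists>xs ys c. s' = s(r := xs, t := ys, 30 := [c]) \<and>
     bits_le xs ys c = bits_le (s r) (s t) True \<and> k = max (length xs) (length ys))" for k s'
  let ?n = "max (length (s r)) (length (s t))"
  have "wp N a (WHILE ?g ?c) Q (s(30 := [True]))"
  proof (rule wp_while[where J = J and n = ?n])
    show "J ?n (s(30 := [True]))" unfolding J_def
      by (intro exI[of _ "s r"] exI[of _ "s t"] exI[of _ True]) (auto simp: assms fun_eq_iff)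
    show "?n \<le> N" using assms by simp
  next
    fix k s' assume "J k s'" and g: "?g (peeks s')"
    then obtain xs ys c where s': "s' = s(r := xs, t := ys, 30 := [c])"
      "bits_le xs ys c = bits_le (s r) (s t) True" "k = max (length xs) (length ys)"
      unfolding J_def by blast
    have ne: "xs \<noteq> [] \<or> ys \<noteq> []" using g s' assms(1-3) by auto
    define c' where "c' = (if isT (peek xs) \<noteq> isT (peek ys) then isT (peek ys) else c)"
    have "J (k - 1) (s(r := tl xs, t := tl ys, 30 := [c']))"
      unfolding J_def
      by (intro exI[of _ "tl xs"] exI[of _ "tl ys"] exI[of _ c'])
        (use s' ne bits_le_rec[OF ne, of c] in \<open>auto simp: c'_def\<close>)
    moreover have "k \<noteq> 0" using ne s' by auto
    ultimately show "k \<noteq> 0 \<and> wp N a ?c (J (k - 1)) s'"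
      using assms(1-3) s'(1) by (auto simp: c'_def fun_upd_twist split: if_splits)
  next
    fix k s' assume "J k s'" and g: "\<not> ?g (peeks s')"
    then obtain xs ys c where s': "s' = s(r := xs, t := ys, 30 := [c])"
      "bits_le xs ys c = bits_le (s r) (s t) True" "k = max (length xs) (length ys)"
      unfolding J_def by blast
    have ne: "xs = []" "ys = []" using g s' assms(1-3) by auto
    hence "c = (bits_val (s r) \<le> bits_val (s t))" using s'(2) bits_le_bits_val[of "s r" "s t" True] by auto
    thus "Q s'" using s' ne assms(7) by simp
  qed
  thus ?thesis using assms(4) by (simp add: le_reg_def)
qed


subsection \<open>Reading numbers\<close>

text \<open>Total decoding that mirrors \<open>read_bits\<close> also on malformed words: behind a
  final \<open>True\<close> the empty stack reads as the digit \<open>False\<close>. A missing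
  terminator shows only in \<open>code_rest\<close> being empty.\<close>

fun code_bits :: "bool list \<Rightarrow> bool list" where
  "code_bits (True # b # w) = b # code_bits w"
| "code_bits [True] = [False]"
| "code_bits (False # w) = []"
| "code_bits [] = []"

fun code_rest :: "bool list \<Rightarrow> bool list" where
  "code_rest (True # b # w) = code_rest w"
| "code_rest [True] = []"
| "code_rest (False # w) = False # w"
| "code_rest [] = []"

lemma length_code_bits: "length (code_bits w) \<le> length w"
  by (induction w rule: code_bits.induct) auto

lemma length_code_rest: "length (code_rest w) \<le> length w"
  by (induction w rule: code_rest.induct) auto

lemma hd_code_rest: "code_rest w \<noteq> [] \<Longrightarrow> code_rest w = False # tl (code_rest w)"
  by (induction w rule: code_rest.induct) auto

lemma code_rest_code:
  "code_rest w \<noteq> [] \<Longrightarrow> w = concat (map (\<lambda>b. [True, b]) (code_bits w)) @ code_rest w"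
  by (induction w rule: code_rest.induct) auto

lemma code_bits_code [simp]:
  "code_bits (concat (map (\<lambda>b. [True, b]) bs) @ False # w) = bs"
  "code_rest (concat (map (\<lambda>b. [True, b]) bs) @ False # w) = False # w"
  by (induction bs) auto

definition read_bits :: "nat \<Rightarrow> nat \<Rightarrow> com" where
  "read_bits r t = WHILE (\<lambda>p. isT (p r)) (POP r ;; PUSH t (\<lambda>p. isT (p r)) ;; POP r)"

lemma wp_read_bits:
  assumes "r \<noteq> t" "length (s r) \<le> N" "Q (s(r := code_rest (s r), t := rev (code_bits (s r)) @ s t))"
  shows "wp N a (read_bits r t) Q s"
proof -
  define f where "f = exec N (POP r ;; PUSH t (\<lambda>p. isT (p r)) ;; POP r)"
  have f: "f s = Normal (s(t := isT (peek (tl (s r))) # s t, r := tl (tl (s r))))" for s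
    using assms(1) by (simp add: f_def fun_upd_twist)
  have "loop (\<lambda>p. isT (p r)) f n s = Normal (s(r := code_rest (s r), t := rev (code_bits (s r)) @ s t))"
    if "length (s r) \<le> n" for s n
    using that
  proof (induction n arbitrary: s)
    case (Suc n)
    show ?case using Suc.prems assms(1)
      by (cases "s r" rule: code_bits.cases) (auto simp: f[of s] Suc.IH fun_eq_iff)
  qed (auto simp: fun_eq_iff)
  from this[of s] show ?thesis using assms unfolding read_bits_def f_def by (intro wp_loop) auto
qed

lemma bits_val_nat_bits [simp]: "bits_val (nat_bits n) = n"
proof (induction n rule: less_induct)
  case (less n)
  show ?case
  proof (cases "n = 0")
    case False
    thus ?thesis using less[of "n div 2"] by (simp add: nat_bits_pos)
  qed simp
qed

lemma last_nat_bits: "n > 0 \<Longrightarrow> nat_bits n \<noteq> [] \<and> last (nat_bits n)"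
proof (induction n rule: less_induct)
  case (less n)
  show ?case
  proof (cases "n div 2 = 0")
    case True
    hence "n = 1" using less.prems by simp
    thus ?thesis by (simp add: nat_bits_pos)
  next
    case False
    thus ?thesis using less.IH[of "n div 2"] less.prems by (simp add: nat_bits_pos)
  qed
qed

lemma bits_val_pos: "bs \<noteq> [] \<Longrightarrow> last bs \<Longrightarrow> bits_val bs > 0"
  by (induction bs) (auto split: if_splits)

lemma nat_bits_bits_val: "bs \<noteq> [] \<longrightarrow> last bs \<Longrightarrow> nat_bits (bits_val bs) = bs"
proof (induction bs)
  case (Cons b bs)
  have "bits_val (b # bs) > 0" using bits_val_pos[of "b # bs"] Cons.prems by auto
  moreover have "bs \<noteq> [] \<longrightarrow> last bs" using Cons.prems by auto
  ultimately show ?case using Cons.IH by (auto simp: nat_bits_pos)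
qed simp

text \<open>Only digit lists without leading zeros are codes, and the most significant digit is the
  last one. Malformed instances have to be detected because they do not belong to
  \<open>Static\<close>.\<close>

definition parse_nat :: "bool list \<Rightarrow> (nat \<times> bool list) option" where
  "parse_nat w = (if code_rest w \<noteq> [] \<and> (code_bits w \<noteq> [] \<longrightarrow> last (code_bits w))
     then Some (bits_val (code_bits w), tl (code_rest w)) else None)"

lemma parse_nat_nat_code [simp]: "parse_nat (nat_code n @ w) = Some (n, w)"
  using last_nat_bits[of n] by (cases "n = 0") (auto simp: parse_nat_def nat_code_def)

lemma parse_nat_SomeD:
  assumes "parse_nat w = Some (n, r)"
  shows "w = nat_code n @ r" "nat_bits n = code_bits w"
proof -
  have p: "code_rest w \<noteq> []" "code_bits w \<noteq> [] \<longrightarrow> last (code_bits w)" "n = bits_val (code_bits w)" "r = tl (code_rest w)"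
    using assms by (auto simp: parse_nat_def split: if_splits)
  show nb: "nat_bits n = code_bits w" using nat_bits_bits_val p by simp
  show "w = nat_code n @ r"
    using code_rest_code[OF p(1)] hd_code_rest[OF p(1)] by (simp add: nat_code_def nb p(4))
qed

lemma length_parse_nat: "parse_nat w = Some (n, r) \<Longrightarrow> length w = 2 * length (nat_bits n) + 1 + length r"
  by (drule parse_nat_SomeD(1)) (simp add: nat_code_def length_concat comp_def sum_list_triv)

text \<open>Reading reverses the digits, so the test for a leading zero is a look at the top of
  \<open>t\<close>, and \<open>t\<close> ends up in the form required of a multiplier.\<close>

definition read_nat :: "nat \<Rightarrow> nat \<Rightarrow> com" where
  "read_nat r t = read_bits r t ;; IF (\<lambda>p. nonempty (p r)) SKIP (HALT False) ;; POP r ;;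
     IF (\<lambda>p. p t = Some False) (HALT False) SKIP"

lemma peek_rev: "peek (rev xs) = (if xs = [] then None else Some (last xs))"
  by (cases xs rule: rev_cases) auto

lemma wp_read_nat:
  assumes "r \<noteq> t" "length (s r) \<le> N" "s t = []"
    and "\<And>n w. parse_nat (s r) = Some (n, w) \<Longrightarrow> Q (s(r := w, t := rev (nat_bits n)))"
    and "parse_nat (s r) = None \<Longrightarrow> \<not> a"
  shows "wp N a (read_nat r t) Q s"
proof -
  let ?s = "s(r := code_rest (s r), t := rev (code_bits (s r)) @ s t)"
  have "wp N a (IF (\<lambda>p. nonempty (p r)) SKIP (HALT False) ;; POP r ;; IF (\<lambda>p. p t = Some False) (HALT False) SKIP) Q ?s"
  proof (cases "parse_nat (s r)")
    case None
    thus ?thesis using assms(1,3,5) by (auto simp: parse_nat_def peek_rev split: if_splits)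
  next
    case (Some x)
    obtain n w where x: "x = (n, w)" by force
    have p: "code_rest (s r) \<noteq> []" "code_bits (s r) \<noteq> [] \<longrightarrow> last (code_bits (s r))" "w = tl (code_rest (s r))"
      using Some x by (auto simp: parse_nat_def split: if_splits)
    have "Q (s(r := w, t := rev (nat_bits n)))" using assms(4) Some x by simp
    thus ?thesis using assms(1,3) p parse_nat_SomeD(2)[OF Some[unfolded x]]
      by (auto simp: peek_rev fun_upd_twist)
  qed
  thus ?thesis unfolding read_nat_def using assms by (auto intro!: wp_read_bits simp del: fun_upd_apply)
qed

text \<open>A negative zero and a zero denominator are excluded because no code contains them;
  fractions that are not in lowest terms pass.\<close>

definition parse_frac :: "bool list \<Rightarrow> (bool \<times> nat \<times> nat \<times> bool list) option" where
  "parse_frac w = (case w of [] \<Rightarrow> None | sg # w1 \<Rightarrow>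
     (case parse_nat w1 of None \<Rightarrow> None | Some (m, w2) \<Rightarrow>
       if sg \<and> m = 0 then None else
       (case parse_nat w2 of None \<Rightarrow> None | Some (d, r) \<Rightarrow>
         if d = 0 then None else Some (sg, m, d, r))))"

definition frac_val :: "bool \<Rightarrow> nat \<Rightarrow> nat \<Rightarrow> rat" where
  "frac_val sg m d = (if sg then - of_nat m else of_nat m) / of_nat d"

definition parse_rat :: "bool list \<Rightarrow> (rat \<times> bool list) option" where
  "parse_rat w = map_option (\<lambda>(sg, m, d, r). (frac_val sg m d, r)) (parse_frac w)"

lemma parse_frac_SomeD:
  assumes "parse_frac w = Some (sg, m, d, r)"
  shows "w = sg # nat_code m @ nat_code d @ r" "0 < d" "sg \<longrightarrow> 0 < m"
  using assms by (auto simp: parse_frac_def split: list.splits option.splits if_splits dest!: parse_nat_SomeD(1))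

lemma parse_rat_iff: "parse_rat w = Some (q, r) \<longleftrightarrow> (\<exists>c \<in> rat_codes q. w = c @ r)"
proof
  assume "parse_rat w = Some (q, r)"
  then obtain sg m d where p: "parse_frac w = Some (sg, m, d, r)" "q = frac_val sg m d"
    by (auto simp: parse_rat_def)
  define z :: int where "z = (if sg then - int m else int m)"
  have "int_code z = sg # nat_code m" using parse_frac_SomeD(3)[OF p(1)] by (auto simp: int_code_def z_def)
  hence "w = (int_code z @ nat_code d) @ r" using parse_frac_SomeD(1)[OF p(1)] by simp
  moreover have "q = of_int z / of_nat d" using p(2) by (simp add: frac_val_def z_def)
  ultimately show "\<exists>c \<in> rat_codes q. w = c @ r"
    using parse_frac_SomeD(2)[OF p(1)] unfolding rat_codes_def by blast
next
  assume "\<exists>c \<in> rat_codes q. w = c @ r"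
  then obtain z d where w: "w = (int_code z @ nat_code d) @ r" "0 < d" "q = of_int z / of_nat d"
    unfolding rat_codes_def by blast
  have "parse_frac w = Some (z < 0, nat \<bar>z\<bar>, d, r)"
    using w(2) by (simp add: w(1) int_code_def parse_frac_def)
  moreover have "frac_val (z < 0) (nat \<bar>z\<bar>) d = q" using w(3) by (auto simp: frac_val_def)
  ultimately show "parse_rat w = Some (q, r)" by (simp add: parse_rat_def)
qed

lemma length_parse_frac: "parse_frac w = Some (sg, m, d, r) \<Longrightarrow>
    length (nat_bits m) \<le> length w \<and> length (nat_bits d) \<le> length w \<and> length r \<le> length w"
  by (drule parse_frac_SomeD(1)) (simp add: nat_code_def length_concat comp_def sum_list_triv)

lemma length_parse_rat: "parse_rat w = Some (q, r) \<Longrightarrow> length r \<le> length w"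
  using length_parse_frac by (auto simp: parse_rat_def)

definition read_rat :: "nat \<Rightarrow> com" where
  "read_rat r = IF (\<lambda>p. nonempty (p r)) SKIP (HALT False) ;; PUSH 20 (\<lambda>p. isT (p r)) ;; POP r ;;
     read_nat r 15 ;; IF (\<lambda>p. isT (p 20) \<and> \<not> nonempty (p 15)) (HALT False) SKIP ;;
     read_nat r 16 ;; IF (\<lambda>p. nonempty (p 16)) SKIP (HALT False)"

lemma nat_bits_Nil_iff [simp]: "nat_bits n = [] \<longleftrightarrow> n = 0"
  using last_nat_bits[of n] by auto

lemma wp_read_rat:
  assumes "r \<notin> {15, 16, 20}" "length (s r) \<le> N" "s 15 = []" "s 16 = []" "s 20 = []"
    and ok: "\<And>sg m d w. parse_frac (s r) = Some (sg, m, d, w) \<Longrightarrow>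
        Q (s(r := w, 20 := [sg], 15 := rev (nat_bits m), 16 := rev (nat_bits d)))"
    and fail: "parse_frac (s r) = None \<Longrightarrow> \<not> a"
  shows "wp N a (read_rat r) Q s"
proof (cases "s r")
  case Nil
  thus ?thesis using fail by (simp add: read_rat_def parse_frac_def)
next
  case (Cons sg w1)
  have neq: "r \<noteq> 15" "r \<noteq> 16" "r \<noteq> 20" "15 \<noteq> r" "16 \<noteq> r" "20 \<noteq> r" using assms(1) by auto
  let ?s1 = "s(r := w1, 20 := [sg])"
  have s1: "s(20 := sg # s 20, r := w1) = ?s1" using neq assms(5) by (simp add: fun_upd_twist)
  have "wp N a (read_nat r 15) (wp N a (IF (\<lambda>p. isT (p 20) \<and> \<not> nonempty (p 15)) (HALT False) SKIP)
      (wp N a (read_nat r 16) (wp N a (IF (\<lambda>p. nonempty (p 16)) SKIP (HALT False)) Q))) ?s1"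
  proof (rule wp_read_nat)
    fix m w2 assume "parse_nat (?s1 r) = Some (m, w2)"
    hence m: "parse_nat w1 = Some (m, w2)" using neq by simp
    show "wp N a (IF (\<lambda>p. isT (p 20) \<and> \<not> nonempty (p 15)) (HALT False) SKIP)
      (wp N a (read_nat r 16) (wp N a (IF (\<lambda>p. nonempty (p 16)) SKIP (HALT False)) Q))
      (?s1(r := w2, 15 := rev (nat_bits m)))"
    proof (cases "sg \<and> m = 0")
      case True
      thus ?thesis using fail Cons m neq by (simp add: parse_frac_def)
    next
      case False
      let ?s2 = "s(r := w2, 20 := [sg], 15 := rev (nat_bits m))"
      have s2: "?s1(r := w2, 15 := rev (nat_bits m)) = ?s2" using neq by (auto simp: fun_eq_iff)
      have "wp N a (read_nat r 16) (wp N a (IF (\<lambda>p. nonempty (p 16)) SKIP (HALT False)) Q) ?s2"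
      proof (rule wp_read_nat)
        fix d w3 assume "parse_nat (?s2 r) = Some (d, w3)"
        hence d: "parse_nat w2 = Some (d, w3)" using neq by simp
        show "wp N a (IF (\<lambda>p. nonempty (p 16)) SKIP (HALT False)) Q (?s2(r := w3, 16 := rev (nat_bits d)))"
        proof (cases "d = 0")
          case True
          thus ?thesis using fail Cons m d False neq by (auto simp: parse_frac_def)
        next
          case d0: False
          have "?s2(r := w3, 16 := rev (nat_bits d)) = s(r := w3, 20 := [sg], 15 := rev (nat_bits m), 16 := rev (nat_bits d))"
            using neq by (auto simp: fun_eq_iff)
          moreover have "parse_frac (s r) = Some (sg, m, d, w3)"
            using Cons m d False d0 by (auto simp: parse_frac_def)
          ultimately show ?thesis using ok d0 by simp
        qed
      qed (use neq assms Cons m length_parse_nat[OF m] fail False in \<open>auto simp: parse_frac_def\<close>)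
      thus ?thesis unfolding s2 using False neq by auto
    qed
  qed (use neq assms Cons fail in \<open>auto simp: parse_frac_def\<close>)
  thus ?thesis using Cons neq assms(5) s1 by (simp add: read_rat_def)
qed

definition skip_rat :: "nat \<Rightarrow> com" where
  "skip_rat r = read_rat r ;; clear_reg 15 ;; clear_reg 16 ;; POP 20"

lemma wp_skip_rat:
  assumes "r \<notin> {15, 16, 20}" "length (s r) \<le> N" "s 15 = []" "s 16 = []" "s 20 = []"
    and ok: "\<And>q w. parse_rat (s r) = Some (q, w) \<Longrightarrow> Q (s(r := w))"
    and fail: "parse_rat (s r) = None \<Longrightarrow> \<not> a"
  shows "wp N a (skip_rat r) Q s"
  unfolding skip_rat_def wp_simps(6)
proof (rule wp_read_rat)
  fix sg m d w assume p: "parse_frac (s r) = Some (sg, m, d, w)"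
  let ?s = "s(r := w, 20 := [sg], 15 := rev (nat_bits m), 16 := rev (nat_bits d))"
  have "s(r := w) = ?s(15 := [], 16 := [], 20 := tl ((?s(15 := [], 16 := [])) 20))"
    using assms(1,3-5) by (auto simp: fun_eq_iff)
  moreover have "Q (s(r := w))" using ok p by (simp add: parse_rat_def)
  ultimately show "wp N a (clear_reg 15) (wp N a (clear_reg 16) (wp N a (POP 20) Q)) ?s"
    using length_parse_frac[OF p] assms(2) by (intro wp_clear) auto
qed (use assms in \<open>auto simp: parse_rat_def\<close>)


subsection \<open>Accumulating a weighted sum of rational numbers\<close>

text \<open>The bound \<open>l\<close> belongs to the specification because the lengths of the
  operands are what bounds the loops of the arithmetic.\<close>

definition acc :: "bool list \<Rightarrow> bool list \<Rightarrow> bool list \<Rightarrow> rat \<Rightarrow> nat \<Rightarrow> bool" where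
  "acc p n d q l \<longleftrightarrow> 0 < bits_val d \<and> (of_nat (bits_val p) - of_nat (bits_val n)) / of_nat (bits_val d) = q \<and>
     length p \<le> l \<and> length n \<le> l \<and> length d \<le> l"

text \<open>No validity test here: witnesses are decoded by total functions, so every word denotes a
  vector and malformed witnesses need no special treatment.\<close>

definition first_nat :: "bool list \<Rightarrow> nat" where
  "first_nat w = bits_val (code_bits w)"

definition after_nat :: "bool list \<Rightarrow> bool list" where
  "after_nat w = tl (code_rest w)"

lemma length_after_nat: "length (after_nat w) \<le> length w"
  using length_code_rest[of w] by (simp add: after_nat_def)

text \<open>With an entry of absolute value m / d and weights x and w, the update is (p - n) / D +-
  m * x * w / d = (p * d - n * d +- D * m * x * w) / (D * d). The flag \<open>f\<close> tells
  whether the entry is added or subtracted; the product goes to the negative part exactly if the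
  sign bit of the entry equals \<open>f\<close>.\<close>

definition entry :: "nat \<Rightarrow> nat \<Rightarrow> bool \<Rightarrow> com" where
  "entry r v f = read_rat r ;; read_bits v 21 ;; POP v ;; copy_reg 13 14 ;;
     mul_reg 14 15 ;; mul_reg 14 21 ;; mul_reg 14 17 ;;
     mul_reg 11 16 ;; mul_reg 12 16 ;; mul_reg 13 16 ;;
     IF (\<lambda>p. p 20 = Some f) (add_reg 12 14) (add_reg 11 14) ;;
     clear_reg 15 ;; clear_reg 16 ;; clear_reg 21 ;; POP 20"

definition clean :: "state \<Rightarrow> bool" where
  "clean s \<longleftrightarrow> (\<forall>i \<in> {14, 15, 16, 20, 21, 25, 26, 27, 28, 29, 30}. s i = [])"

lemma wp_mul_low:
  assumes "r \<noteq> t" "r < 25" "t < 25" "s 25 = []" "s 26 = []" "s 27 = []" "s 28 = []" "s 29 = []" "s 30 = []"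
    and "length (s r) + 2 * length (s t) + 2 < N" "Q (s(r := bits_mul (s r) (s t)))"
  shows "wp N a (mul_reg r t) Q s"
proof (rule wp_mul)
  have "{25..30::nat} = {25, 26, 27, 28, 29, 30}" by auto
  thus "\<forall>i \<in> {25..30}. s i = []" using assms by simp
qed (use assms in auto)

text \<open>Three successive factors of length at most \<open>n\<close> lengthen the new summand by
  \<open>2 * n\<close> each, and the addition may carry once; this is the growth
  \<open>6 * n + 1\<close>.\<close>

lemma wp_entry:
  assumes rv: "r < 11" "30 < v"
    and clean: "clean s"
    and len: "length (s r) \<le> n" "length (s v) \<le> n" "length (s 17) \<le> n" "l + 8 * n + 10 < N"
    and acc: "acc (s 11) (s 12) (s 13) q l"
    and ok: "\<And>q' w p' n' d'. parse_rat (s r) = Some (q', w) \<Longrightarrow>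
       acc p' n' d' (q + (if f then q' else - q') * of_nat (first_nat (s v)) * of_nat (bits_val (rev (s 17)))) (l + 6 * n + 1) \<Longrightarrow>
       Q (s(r := w, v := after_nat (s v), 11 := p', 12 := n', 13 := d'))"
    and fail: "parse_rat (s r) = None \<Longrightarrow> \<not> a"
  shows "wp N a (entry r v f) Q s"
  unfolding entry_def wp_simps(6)
proof (rule wp_read_rat)
  have neq: "r \<noteq> 11" "r \<noteq> 12" "r \<noteq> 13" "r \<noteq> 14" "r \<noteq> 15" "r \<noteq> 16" "r \<noteq> 17" "r \<noteq> 20" "r \<noteq> 21"
    "r \<noteq> 25" "r \<noteq> 26" "r \<noteq> 27" "r \<noteq> 28" "r \<noteq> 29" "r \<noteq> 30"
    "v \<noteq> 11" "v \<noteq> 12" "v \<noteq> 13" "v \<noteq> 14" "v \<noteq> 15" "v \<noteq> 16" "v \<noteq> 17" "v \<noteq> 20" "v \<noteq> 21"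
    "v \<noteq> 25" "v \<noteq> 26" "v \<noteq> 27" "v \<noteq> 28" "v \<noteq> 29" "v \<noteq> 30" "v \<noteq> r"
    using rv by auto
  note neq = neq neq[symmetric]
  have emp: "s 14 = []" "s 15 = []" "s 16 = []" "s 20 = []" "s 21 = []" "s 25 = []" "s 26 = []"
    "s 27 = []" "s 28 = []" "s 29 = []" "s 30 = []"
    using clean by (simp_all add: clean_def)
  show "r \<notin> {15, 16, 20}" "length (s r) \<le> N" "s 15 = []" "s 16 = []" "s 20 = []"
    using neq emp len by auto
  show "parse_frac (s r) = None \<Longrightarrow> \<not> a" using fail by (simp add: parse_rat_def)
  fix sg m d w assume p: "parse_frac (s r) = Some (sg, m, d, w)"
  define M where "M = rev (nat_bits m)"
  define D where "D = rev (nat_bits d)"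
  define X where "X = rev (code_bits (s v))"
  define t1 where "t1 = bits_mul (s 13) M"
  define t2 where "t2 = bits_mul t1 X"
  define t3 where "t3 = bits_mul t2 (s 17)"
  define p1 where "p1 = bits_mul (s 11) D"
  define n1 where "n1 = bits_mul (s 12) D"
  define d1 where "d1 = bits_mul (s 13) D"
  define p2 where "p2 = (if sg = f then p1 else bits_add p1 t3 False)"
  define n2 where "n2 = (if sg = f then bits_add n1 t3 False else n1)"
  have lM: "length M \<le> n" "length D \<le> n" "length X \<le> n"
    using length_parse_frac[OF p] len length_code_bits[of "s v"] by (simp_all add: M_def D_def X_def)
  have lMN: "length M \<le> N" "length D \<le> N" "length X \<le> N" using lM len(4) by linarith+
  have l0: "length (s 11) \<le> l" "length (s 12) \<le> l" "length (s 13) \<le> l" using acc by (simp_all add: acc_def)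
  have lt: "length t1 \<le> l + 2 * n" "length t2 \<le> l + 4 * n" "length t3 \<le> l + 6 * n"
    using length_bits_mul[of "s 13" M] length_bits_mul[of t1 X] length_bits_mul[of t2 "s 17"] lM l0 len(3)
    by (simp_all add: t1_def[symmetric] t2_def[symmetric] t3_def[symmetric])
  have lp: "length p1 \<le> l + 2 * n" "length n1 \<le> l + 2 * n" "length d1 \<le> l + 2 * n"
    using length_bits_mul[of "s 11" D] length_bits_mul[of "s 12" D] length_bits_mul[of "s 13" D] lM l0
    by (simp_all add: p1_def[symmetric] n1_def[symmetric] d1_def[symmetric])
  have v3: "bits_val t3 = bits_val (s 13) * m * first_nat (s v) * bits_val (rev (s 17))"
    by (simp add: t1_def t2_def t3_def bits_val_bits_mul M_def X_def first_nat_def)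
  have v1: "bits_val p1 = bits_val (s 11) * d" "bits_val n1 = bits_val (s 12) * d" "bits_val d1 = bits_val (s 13) * d"
    by (simp_all add: p1_def n1_def d1_def bits_val_bits_mul D_def)
  have dpos: "0 < d" using parse_frac_SomeD(2)[OF p] .
  have "acc p2 n2 d1 (q + (if f then frac_val sg m d else - frac_val sg m d) * of_nat (first_nat (s v)) * of_nat (bits_val (rev (s 17)))) (l + 6 * n + 1)"
    unfolding acc_def
  proof (intro conjI)
    show "0 < bits_val d1" using v1 acc dpos by (simp add: acc_def)
    show "length p2 \<le> l + 6 * n + 1" "length n2 \<le> l + 6 * n + 1" "length d1 \<le> l + 6 * n + 1"
      using lp lt length_bits_add[of p1 t3 False] length_bits_add[of n1 t3 False] by (auto simp: p2_def n2_def)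
    have d0: "(of_nat (bits_val (s 13)) :: rat) > 0" "(of_nat d :: rat) > 0" using acc dpos by (simp_all add: acc_def)
    have q: "q = (of_nat (bits_val (s 11)) - of_nat (bits_val (s 12))) / of_nat (bits_val (s 13))"
      using acc by (simp add: acc_def)
    show "(of_nat (bits_val p2) - of_nat (bits_val n2)) / of_nat (bits_val d1) =
       q + (if f then frac_val sg m d else - frac_val sg m d) * of_nat (first_nat (s v)) * of_nat (bits_val (rev (s 17)))"
      unfolding q p2_def n2_def using d0
      by (cases sg; cases f) (simp_all add: bits_val_bits_add v1 v3 frac_val_def field_simps)
  qed
  moreover have "parse_rat (s r) = Some (frac_val sg m d, w)" using p by (simp add: parse_rat_def)
  ultimately have Q: "Q (s(r := w, v := after_nat (s v), 11 := p2, 12 := n2, 13 := d1))" using ok by blast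
  let ?A = "add_reg 12 14"
  let ?B = "add_reg 11 14"
  define R where "R = wp N a (clear_reg 15) (wp N a (clear_reg 16) (wp N a (clear_reg 21) (wp N a (POP 20) Q)))"
  let ?s = "s(r := w, 20 := [sg], 15 := M, 16 := D, v := after_nat (s v), 21 := X)"
  have R: "R (?s(14 := [], 11 := p2, 12 := n2, 13 := d1))"
  proof -
    have "s(r := w, v := after_nat (s v), 11 := p2, 12 := n2, 13 := d1) =
       ?s(14 := [], 11 := p2, 12 := n2, 13 := d1, 15 := [], 16 := [], 21 := [], 20 := [])"
      using neq emp by (auto simp: fun_eq_iff)
    thus ?thesis unfolding R_def using Q lMN neq by (intro wp_clear) auto
  qed
  have add: "wp N a (IF (\<lambda>p. p 20 = Some f) ?A ?B) R (?s(14 := t3, 11 := p1, 12 := n1, 13 := d1))"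
  proof (cases "sg = f")
    case True
    have "?s(14 := [], 11 := p2, 12 := n2, 13 := d1) =
        ?s(14 := t3, 11 := p1, 12 := n1, 13 := d1, 12 := bits_add n1 t3 False, 14 := [])"
      using True by (auto simp: fun_eq_iff p2_def n2_def)
    hence "wp N a ?A R (?s(14 := t3, 11 := p1, 12 := n1, 13 := d1))"
      using R neq emp lp lt len by (intro wp_add) auto
    thus ?thesis using True neq by simp
  next
    case False
    have "?s(14 := [], 11 := p2, 12 := n2, 13 := d1) =
        ?s(14 := t3, 11 := p1, 12 := n1, 13 := d1, 11 := bits_add p1 t3 False, 14 := [])"
      using False by (auto simp: fun_eq_iff p2_def n2_def)
    hence "wp N a ?B R (?s(14 := t3, 11 := p1, 12 := n1, 13 := d1))"
      using R neq emp lp lt len by (intro wp_add) auto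
    thus ?thesis using False neq by simp
  qed
  define R1 where "R1 = wp N a (IF (\<lambda>p. p 20 = Some f) ?A ?B) R"
  have m1: "wp N a (mul_reg 13 16) R1 (?s(14 := t3, 11 := p1, 12 := n1))"
    by (rule wp_mul_low) (use add neq emp l0 lM len in \<open>simp_all add: R1_def d1_def[symmetric]\<close>)
  have m2: "wp N a (mul_reg 12 16) (wp N a (mul_reg 13 16) R1) (?s(14 := t3, 11 := p1))"
    by (rule wp_mul_low) (use m1 neq emp l0 lM len in \<open>simp_all add: n1_def[symmetric]\<close>)
  have m3: "wp N a (mul_reg 11 16) (wp N a (mul_reg 12 16) (wp N a (mul_reg 13 16) R1)) (?s(14 := t3))"
    by (rule wp_mul_low) (use m2 neq emp l0 lM len in \<open>simp_all add: p1_def[symmetric]\<close>)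
  define R2 where "R2 = wp N a (mul_reg 11 16) (wp N a (mul_reg 12 16) (wp N a (mul_reg 13 16) R1))"
  have m4: "wp N a (mul_reg 14 17) R2 (?s(14 := t2))"
    by (rule wp_mul_low) (use m3 neq emp lt lM len in \<open>simp_all add: R2_def t3_def[symmetric]\<close>)
  have m5: "wp N a (mul_reg 14 21) (wp N a (mul_reg 14 17) R2) (?s(14 := t1))"
    by (rule wp_mul_low) (use m4 neq emp lt lM len in \<open>simp_all add: t2_def[symmetric]\<close>)
  have m6: "wp N a (mul_reg 14 15) (wp N a (mul_reg 14 21) (wp N a (mul_reg 14 17) R2)) (?s(14 := s 13))"
    by (rule wp_mul_low) (use m5 neq emp l0 lM len in \<open>simp_all add: t1_def[symmetric]\<close>)
  define R3 where "R3 = wp N a (mul_reg 14 15) (wp N a (mul_reg 14 21) (wp N a (mul_reg 14 17) R2))"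
  have c: "wp N a (copy_reg 13 14) R3 ?s"
    by (rule wp_copy) (use m6 neq emp l0 len in \<open>simp_all add: R3_def\<close>)
  let ?base = "s(r := w, 20 := [sg], 15 := M, 16 := D)"
  have eq: "?base(v := code_rest (?base v), 21 := rev (code_bits (?base v)) @ ?base 21) = ?base(v := code_rest (s v), 21 := X)"
    using neq emp by (simp add: X_def)
  have "?s = ?base(v := code_rest (s v), 21 := X, v := tl ((?base(v := code_rest (s v), 21 := X)) v))"
    using neq by (auto simp: fun_eq_iff after_nat_def)
  hence "wp N a (POP v) (wp N a (copy_reg 13 14) R3) (?base(v := code_rest (s v), 21 := X))"
    using c by (simp only: wp_simps(4))
  hence "wp N a (read_bits v 21) (wp N a (POP v) (wp N a (copy_reg 13 14) R3)) ?base"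
    using neq len by (intro wp_read_bits) (simp_all only: eq, auto)
  thus "wp N a (read_bits v 21) (wp N a (POP v) (wp N a (copy_reg 13 14)
     (wp N a (mul_reg 14 15) (wp N a (mul_reg 14 21) (wp N a (mul_reg 14 17)
     (wp N a (mul_reg 11 16) (wp N a (mul_reg 12 16) (wp N a (mul_reg 13 16)
     (wp N a (IF (\<lambda>p. p 20 = Some f) ?A ?B)
     (wp N a (clear_reg 15) (wp N a (clear_reg 16) (wp N a (clear_reg 21) (wp N a (POP 20) Q)))))))))))))
     (s(r := w, 20 := [sg], 15 := rev (nat_bits m), 16 := rev (nat_bits d)))"
    unfolding R3_def R2_def R1_def R_def M_def D_def .
qed


subsection \<open>Streams of numbers\<close>

text \<open>The recursion is at the far end, since a loop that has read \<open>i\<close> numbers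
  goes on by reading one more.\<close>

fun drop_rats :: "bool list \<Rightarrow> nat \<Rightarrow> bool list option" where
  "drop_rats W 0 = Some W"
| "drop_rats W (Suc i) = (case drop_rats W i of None \<Rightarrow> None | Some S \<Rightarrow> map_option snd (parse_rat S))"

definition rat_at :: "bool list \<Rightarrow> nat \<Rightarrow> rat" where
  "rat_at W i = fst (the (parse_rat (the (drop_rats W i))))"

definition nat_at :: "bool list \<Rightarrow> nat \<Rightarrow> nat" where
  "nat_at w j = first_nat ((after_nat ^^ j) w)"

lemma drop_rats_None_mono: "drop_rats W i = None \<Longrightarrow> i \<le> j \<Longrightarrow> drop_rats W j = None"
  by (induction j) (auto simp: le_Suc_eq)

lemma length_drop_rats: "drop_rats W i = Some S \<Longrightarrow> length S \<le> length W"
proof (induction i arbitrary: S)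
  case (Suc i)
  then obtain T q where "drop_rats W i = Some T" "parse_rat T = Some (q, S)" by (auto split: option.splits)
  thus ?case using Suc.IH length_parse_rat by fastforce
qed simp

lemma drop_rats_step: "drop_rats W i = Some S \<Longrightarrow> parse_rat S = Some (q, T) \<Longrightarrow> drop_rats W (Suc i) = Some T \<and> rat_at W i = q"
  by (simp add: rat_at_def)

lemma length_after_nat_pow: "length ((after_nat ^^ j) w) \<le> length w"
  by (induction j) (auto intro: order_trans[OF length_after_nat])

definition row_sum :: "(nat \<Rightarrow> rat) \<Rightarrow> nat \<Rightarrow> nat \<Rightarrow> (nat \<Rightarrow> nat) \<Rightarrow> rat" where
  "row_sum e i k x = (\<Sum>j<k. e (i + j) * of_nat (x j))"


subsection \<open>The verifier\<close>

text \<open>The dimension is copied as a unary loop counter and the vector as a cursor, because both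
  originals are needed again for the next row.\<close>

definition row :: "nat \<Rightarrow> nat \<Rightarrow> com" where
  "row n v = copy_reg n 24 ;; copy_reg v 32 ;;
     WHILE (\<lambda>p. nonempty (p 24)) (POP 24 ;; entry 0 32 True) ;; clear_reg 32"

lemma wp_row:
  assumes nv: "0 < n" "n < 11" "0 < v" "v < 11"
    and clean: "clean s" "s 24 = []" "s 32 = []"
    and W: "drop_rats W i = Some (s 0)"
    and len: "length W \<le> m" "length (s n) \<le> m" "length (s v) \<le> m" "length (s 17) \<le> m"
      "l + length (s n) * (6 * m + 1) + 8 * m + 10 < N"
    and acc: "acc (s 11) (s 12) (s 13) q l"
    and ok: "\<And>S p' n' d'. drop_rats W (i + length (s n)) = Some S \<Longrightarrow>
       acc p' n' d' (q + row_sum (rat_at W) i (length (s n)) (nat_at (s v)) * of_nat (bits_val (rev (s 17))))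
         (l + length (s n) * (6 * m + 1)) \<Longrightarrow>
       Q (s(0 := S, 11 := p', 12 := n', 13 := d'))"
    and fail: "drop_rats W (i + length (s n)) = None \<Longrightarrow> \<not> a"
  shows "wp N a (row n v) Q s"
proof -
  define k where "k = length (s n)"
  have neq: "n \<noteq> 24" "n \<noteq> 25" "n \<noteq> 32" "v \<noteq> 24" "v \<noteq> 25" "v \<noteq> 32" using nv by auto
  \<comment> \<open>With \<open>rem\<close> counter symbols left, \<open>k - rem\<close> entries
    have been read, the cursor 32 has advanced by as many numbers, and the length bound has grown by
    \<open>6 * m + 1\<close> for each of them.\<close>
  define J where "J rem s' \<longleftrightarrow> (\<exists>cs S p' n' d'. rem = length cs \<and> rem \<le> k \<and>
      s' = s(0 := S, 11 := p', 12 := n', 13 := d', 24 := cs, 32 := (after_nat ^^ (k - rem)) (s v)) \<and>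
      drop_rats W (i + (k - rem)) = Some S \<and>
      acc p' n' d' (q + row_sum (rat_at W) i (k - rem) (nat_at (s v)) * of_nat (bits_val (rev (s 17))))
         (l + (k - rem) * (6 * m + 1)))" for rem s'
  have "wp N a (WHILE (\<lambda>p. nonempty (p 24)) (POP 24 ;; entry 0 32 True)) (wp N a (clear_reg 32) Q)
      (s(24 := s n, 32 := s v))"
  proof (rule wp_while[where J = J and n = k])
    show "J k (s(24 := s n, 32 := s v))" unfolding J_def
      by (intro exI[of _ "s n"] exI[of _ "s 0"] exI[of _ "s 11"] exI[of _ "s 12"] exI[of _ "s 13"])
        (use W acc in \<open>auto simp: k_def row_sum_def\<close>)
    show "k \<le> N" using len by (simp add: k_def)
  next
    fix rem s' assume "J rem s'" and g: "nonempty (peeks s' 24)"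
    then obtain cs S p' n' d' where J: "rem = length cs" "rem \<le> k"
      "s' = s(0 := S, 11 := p', 12 := n', 13 := d', 24 := cs, 32 := (after_nat ^^ (k - rem)) (s v))"
      "drop_rats W (i + (k - rem)) = Some S"
      "acc p' n' d' (q + row_sum (rat_at W) i (k - rem) (nat_at (s v)) * of_nat (bits_val (rev (s 17))))
         (l + (k - rem) * (6 * m + 1))"
      unfolding J_def by blast
    have ne: "rem \<noteq> 0" using g J by auto
    hence eq: "k - (rem - 1) = Suc (k - rem)" using J(2) by simp
    let ?t = "s(0 := S, 11 := p', 12 := n', 13 := d', 24 := tl cs, 32 := (after_nat ^^ (k - rem)) (s v))"
    have mult: "Suc (k - rem) * (6 * m + 1) \<le> k * (6 * m + 1)"
      using J(2) ne by (intro mult_right_mono) auto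
    have "wp N a (entry 0 32 True) (J (rem - 1)) ?t"
    proof (rule wp_entry[where n = m])
      show "clean ?t" using clean by (simp add: clean_def)
      show "length (?t 0) \<le> m" using length_drop_rats[OF J(4)] len by simp
      show "length (?t 32) \<le> m" using length_after_nat_pow[of "k - rem" "s v"] len by simp
      show "length (?t 17) \<le> m" using len by simp
      show "acc (?t 11) (?t 12) (?t 13) (q + row_sum (rat_at W) i (k - rem) (nat_at (s v)) * of_nat (bits_val (rev (s 17))))
         (l + (k - rem) * (6 * m + 1))" using J(5) by simp
      show "l + (k - rem) * (6 * m + 1) + 8 * m + 10 < N" using mult len(5) by (simp add: k_def)
    next
      fix q' w p2 n2 d2
      assume p: "parse_rat (?t 0) = Some (q', w)"
        and a: "acc p2 n2 d2 (q + row_sum (rat_at W) i (k - rem) (nat_at (s v)) * of_nat (bits_val (rev (s 17))) +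
          (if True then q' else - q') * of_nat (first_nat (?t 32)) * of_nat (bits_val (rev (?t 17)))) (l + (k - rem) * (6 * m + 1) + 6 * m + 1)"
      have st: "drop_rats W (Suc (i + (k - rem))) = Some w" "rat_at W (i + (k - rem)) = q'"
        using drop_rats_step[OF J(4)] p by auto
      have 1: "?t(0 := w, 32 := after_nat (?t 32), 11 := p2, 12 := n2, 13 := d2) =
          s(0 := w, 11 := p2, 12 := n2, 13 := d2, 24 := tl cs, 32 := (after_nat ^^ Suc (k - rem)) (s v))"
        by (rule ext) simp
      have 2: "q + row_sum (rat_at W) i (k - rem) (nat_at (s v)) * of_nat (bits_val (rev (s 17))) +
          (if True then q' else - q') * of_nat (first_nat (?t 32)) * of_nat (bits_val (rev (?t 17))) =
          q + row_sum (rat_at W) i (Suc (k - rem)) (nat_at (s v)) * of_nat (bits_val (rev (s 17)))"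
        by (simp add: row_sum_def nat_at_def st(2) distrib_right)
      have 3: "l + (k - rem) * (6 * m + 1) + 6 * m + 1 = l + Suc (k - rem) * (6 * m + 1)" by simp
      show "J (rem - 1) (?t(0 := w, 32 := after_nat (?t 32), 11 := p2, 12 := n2, 13 := d2))"
        unfolding J_def eq
      proof (intro exI conjI)
        show "rem - 1 = length (tl cs)" using J(1) by simp
        show "rem - 1 \<le> k" using J(2) by simp
        show "drop_rats W (i + Suc (k - rem)) = Some w" using st(1) by simp
      qed (rule 1, rule a[unfolded 2 3])
    next
      assume "parse_rat (?t 0) = None"
      hence "drop_rats W (Suc (i + (k - rem))) = None" using J(4) by simp
      moreover have "Suc (i + (k - rem)) \<le> i + k" using ne J(2) by simp
      ultimately have "drop_rats W (i + k) = None" by (rule drop_rats_None_mono)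
      thus "\<not> a" using fail by (simp add: k_def)
    qed auto
    moreover have "?t = s'(24 := tl (s' 24))" by (auto simp: J(3) fun_eq_iff)
    ultimately show "rem \<noteq> 0 \<and> wp N a (POP 24 ;; entry 0 32 True) (J (rem - 1)) s'"
      using ne by (simp only: wp_simps(4,6)) simp
  next
    fix rem s' assume "J rem s'" and g: "\<not> nonempty (peeks s' 24)"
    then obtain cs S p' n' d' where J: "rem = length cs" "rem \<le> k"
      "s' = s(0 := S, 11 := p', 12 := n', 13 := d', 24 := cs, 32 := (after_nat ^^ (k - rem)) (s v))"
      "drop_rats W (i + (k - rem)) = Some S"
      "acc p' n' d' (q + row_sum (rat_at W) i (k - rem) (nat_at (s v)) * of_nat (bits_val (rev (s 17))))
         (l + (k - rem) * (6 * m + 1))"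
      unfolding J_def by blast
    have cs: "cs = []" using g J by auto
    show "wp N a (clear_reg 32) Q s'"
    proof (rule wp_clear)
      show "length (s' 32) \<le> N" using length_after_nat_pow[of "k - rem" "s v"] len J(3) by simp
      have "Q (s(0 := S, 11 := p', 12 := n', 13 := d'))"
        using ok[of S p' n' d'] J cs by (simp add: k_def)
      moreover have "s'(32 := []) = s(0 := S, 11 := p', 12 := n', 13 := d')"
        using J(3) cs clean by (auto simp: fun_eq_iff)
      ultimately show "Q (s'(32 := []))" by simp
    qed
  qed
  moreover have "length (s n) \<le> N" "length (s v) \<le> N" using len by simp_all
  ultimately show ?thesis
    unfolding row_def wp_simps(6) using neq clean
    by (intro wp_copy) (auto simp: clean_def)
qed

definition skip_many :: "nat \<Rightarrow> com" where
  "skip_many n = copy_reg n 22 ;; WHILE (\<lambda>p. nonempty (p 22)) (POP 22 ;; skip_rat 0)"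

lemma wp_skip_many:
  assumes n: "0 < n" "n < 11" and emp: "clean s" "s 22 = []"
    and W: "drop_rats W i = Some (s 0)" "length W \<le> N" "length (s n) \<le> N"
    and ok: "\<And>S. drop_rats W (i + length (s n)) = Some S \<Longrightarrow> Q (s(0 := S))"
    and fail: "drop_rats W (i + length (s n)) = None \<Longrightarrow> \<not> a"
  shows "wp N a (skip_many n) Q s"
proof -
  define k where "k = length (s n)"
  define J where "J rem s' \<longleftrightarrow> (\<exists>cs S. rem = length cs \<and> rem \<le> k \<and> s' = s(0 := S, 22 := cs) \<and>
      drop_rats W (i + (k - rem)) = Some S)" for rem s'
  have "wp N a (WHILE (\<lambda>p. nonempty (p 22)) (POP 22 ;; skip_rat 0)) Q (s(22 := s n))"
  proof (rule wp_while[where J = J and n = k])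
    show "J k (s(22 := s n))" unfolding J_def
      by (intro exI[of _ "s n"] exI[of _ "s 0"]) (use W in \<open>auto simp: k_def\<close>)
    show "k \<le> N" using W by (simp add: k_def)
  next
    fix rem s' assume "J rem s'" and g: "nonempty (peeks s' 22)"
    then obtain cs S where J: "rem = length cs" "rem \<le> k" "s' = s(0 := S, 22 := cs)"
      "drop_rats W (i + (k - rem)) = Some S" unfolding J_def by blast
    have ne: "rem \<noteq> 0" using g J by auto
    hence eq: "k - (rem - 1) = Suc (k - rem)" using J(2) by simp
    let ?t = "s(0 := S, 22 := tl cs)"
    have "wp N a (skip_rat 0) (J (rem - 1)) ?t"
    proof (rule wp_skip_rat)
      show "length (?t 0) \<le> N" using length_drop_rats[OF J(4)] W by simp
    next
      fix q w assume p: "parse_rat (?t 0) = Some (q, w)"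
      have st: "drop_rats W (Suc (i + (k - rem))) = Some w" using drop_rats_step[OF J(4)] p by auto
      show "J (rem - 1) (?t(0 := w))" unfolding J_def eq
        by (intro exI[of _ "tl cs"] exI[of _ w]) (use st J(1,2) ne in \<open>auto simp: fun_eq_iff\<close>)
    next
      assume "parse_rat (?t 0) = None"
      hence "drop_rats W (Suc (i + (k - rem))) = None" using J(4) by simp
      moreover have "Suc (i + (k - rem)) \<le> i + k" using ne J(2) by simp
      ultimately have "drop_rats W (i + k) = None" by (rule drop_rats_None_mono)
      thus "\<not> a" using fail by (simp add: k_def)
    qed (use emp in \<open>auto simp: clean_def\<close>)
    moreover have "?t = s'(22 := tl (s' 22))" by (auto simp: J(3) fun_eq_iff)
    ultimately show "rem \<noteq> 0 \<and> wp N a (POP 22 ;; skip_rat 0) (J (rem - 1)) s'"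
      using ne by (simp only: wp_simps(4,6)) simp
  next
    fix rem s' assume "J rem s'" and g: "\<not> nonempty (peeks s' 22)"
    then obtain cs S where J: "rem = length cs" "rem \<le> k" "s' = s(0 := S, 22 := cs)"
      "drop_rats W (i + (k - rem)) = Some S" unfolding J_def by blast
    have cs: "cs = []" using g J by auto
    have "s' = s(0 := S)" using J(3) cs emp by (auto simp: fun_eq_iff)
    moreover have "drop_rats W (i + length (s n)) = Some S" using J cs by (simp add: k_def)
    ultimately show "Q s'" using ok by simp
  qed
  thus ?thesis unfolding skip_many_def wp_simps(6) using n emp W
    by (intro wp_copy) (auto simp: clean_def)
qed

text \<open>The accumulator starts as 0 / 1 and the weight 17 as 1. The three symbols pushed on 33
  form the code of the number 1, so that \<open>entry c 33 False\<close> subtracts the right-hand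
  side with coefficient 1. Then the row is added and the difference is compared with zero.\<close>

definition bound_row :: "nat \<Rightarrow> nat \<Rightarrow> nat \<Rightarrow> com" where
  "bound_row c n v = PUSH 13 (\<lambda>_. True) ;; PUSH 17 (\<lambda>_. True) ;;
     PUSH 33 (\<lambda>_. False) ;; PUSH 33 (\<lambda>_. True) ;; PUSH 33 (\<lambda>_. True) ;;
     entry c 33 False ;; row n v ;; POP 17 ;; le_reg 11 12 ;; clear_reg 13"

definition idle :: "state \<Rightarrow> bool" where
  "idle s \<longleftrightarrow> clean s \<and> s 11 = [] \<and> s 12 = [] \<and> s 13 = [] \<and> s 17 = [] \<and> s 24 = [] \<and> s 32 = [] \<and> s 33 = []"

lemma acc_le_0: "acc p n d q l \<Longrightarrow> bits_val p \<le> bits_val n \<longleftrightarrow> q \<le> 0"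
proof -
  assume a: "acc p n d q l"
  have "q = (of_nat (bits_val p) - of_nat (bits_val n)) / of_nat (bits_val d)" "(of_nat (bits_val d) :: rat) > 0"
    using a by (auto simp: acc_def)
  thus ?thesis by (simp add: divide_le_0_iff)
qed

lemma wp_bound_row:
  assumes nv: "0 < c" "c < 11" "0 < n" "n < 11" "0 < v" "v < 11" "c \<noteq> n" "c \<noteq> v"
    and idle: "idle s"
    and W: "drop_rats W i = Some (s 0)" "drop_rats W j = Some (s c)"
    and len: "length W \<le> m" "length (s n) \<le> m" "length (s v) \<le> m" "3 \<le> m"
      "(length (s n) + 1) * (6 * m + 1) + 8 * m + 20 < N"
    and ok: "\<And>S S'. drop_rats W (i + length (s n)) = Some S \<Longrightarrow> drop_rats W (Suc j) = Some S' \<Longrightarrow>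
       Q (s(0 := S, c := S', 30 := [row_sum (rat_at W) i (length (s n)) (nat_at (s v)) \<le> rat_at W j]))"
    and fail: "drop_rats W (i + length (s n)) = None \<or> drop_rats W (Suc j) = None \<Longrightarrow> \<not> a"
  shows "wp N a (bound_row c n v) Q s"
proof -
  have emp: "s 11 = []" "s 12 = []" "s 13 = []" "s 17 = []" "s 24 = []" "s 32 = []" "s 33 = []" "s 30 = []" "s 25 = []"
    using idle by (auto simp: idle_def clean_def)
  let ?s1 = "s(13 := [True], 17 := [True], 33 := [True, True, False])"
  let ?R = "wp N a (POP 17 ;; le_reg 11 12 ;; clear_reg 13) Q"
  have "wp N a (entry c 33 False) (wp N a (row n v) ?R) ?s1"
  proof (rule wp_entry[where n = m and q = 0 and l = 1])
    show "clean ?s1" using idle by (simp add: idle_def clean_def)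
    show "length (?s1 c) \<le> m" using length_drop_rats[OF W(2)] len nv by simp
    show "length (?s1 33) \<le> m" "length (?s1 17) \<le> m" using len by simp_all
    show "acc (?s1 11) (?s1 12) (?s1 13) 0 1" by (simp add: acc_def emp)
    show "1 + 8 * m + 10 < N" using len(5) by simp
  next
    fix q w p' n' d'
    assume p: "parse_rat (?s1 c) = Some (q, w)" and acc: "acc p' n' d'
       (0 + (if False then q else - q) * of_nat (first_nat (?s1 33)) * of_nat (bits_val (rev (?s1 17)))) (1 + 6 * m + 1)"
    have st: "drop_rats W (Suc j) = Some w" "rat_at W j = q"
      using drop_rats_step[OF W(2)] p nv by auto
    have acc: "acc p' n' d' (- q) (1 + 6 * m + 1)" using acc by (simp add: first_nat_def)
    let ?s2 = "s(13 := d', 17 := [True], c := w, 11 := p', 12 := n')"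
    have s2: "?s1(c := w, 33 := after_nat (?s1 33), 11 := p', 12 := n', 13 := d') = ?s2"
      using nv emp by (auto simp: fun_eq_iff after_nat_def)
    have "wp N a (row n v) ?R ?s2"
    proof (rule wp_row[where W = W and i = i and m = m and q = "- q" and l = "1 + 6 * m + 1"])
      show "clean ?s2" using idle nv by (simp add: idle_def clean_def)
      show "?s2 24 = []" "?s2 32 = []" using emp nv by auto
      show "drop_rats W i = Some (?s2 0)" using W nv by simp
      show "length (?s2 n) \<le> m" "length (?s2 v) \<le> m" "length (?s2 17) \<le> m" using len nv by simp_all
      have "length (?s2 n) = length (s n)" using nv by simp
      thus "1 + 6 * m + 1 + length (?s2 n) * (6 * m + 1) + 8 * m + 10 < N" using len(5) by (simp add: algebra_simps)
      show "acc (?s2 11) (?s2 12) (?s2 13) (- q) (1 + 6 * m + 1)" using acc nv by simp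
      show "drop_rats W (i + length (?s2 n)) = None \<Longrightarrow> \<not> a" using fail nv by simp
    next
      fix S p2 n2 d2 assume S: "drop_rats W (i + length (?s2 n)) = Some S"
        and acc2: "acc p2 n2 d2 (- q + row_sum (rat_at W) i (length (?s2 n)) (nat_at (?s2 v)) * of_nat (bits_val (rev (?s2 17))))
          (1 + 6 * m + 1 + length (?s2 n) * (6 * m + 1))"
      let ?b = "row_sum (rat_at W) i (length (s n)) (nat_at (s v)) \<le> rat_at W j"
      have acc3: "acc p2 n2 d2 (- q + row_sum (rat_at W) i (length (s n)) (nat_at (s v))) (1 + 6 * m + 1 + length (s n) * (6 * m + 1))"
        using acc2 nv by simp
      have b: "(bits_val p2 \<le> bits_val n2) = ?b" using acc_le_0[OF acc3] st by auto
      have l: "length p2 \<le> N" "length n2 \<le> N" "length d2 \<le> N"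
        using acc3 len(5) by (simp_all add: acc_def algebra_simps)
      let ?s3 = "s(0 := S, c := w, 11 := p2, 12 := n2, 13 := d2)"
      have "?s3(11 := [], 12 := [], 30 := [bits_val p2 \<le> bits_val n2], 13 := []) = s(0 := S, c := w, 30 := [?b])"
        using nv emp by (auto simp: fun_eq_iff b)
      hence "Q (?s3(11 := [], 12 := [], 30 := [bits_val p2 \<le> bits_val n2], 13 := []))"
        using ok[of S w] S st nv by simp
      hence "wp N a (clear_reg 13) Q (?s3(11 := [], 12 := [], 30 := [bits_val p2 \<le> bits_val n2]))"
        using l by (intro wp_clear) auto
      hence 1: "wp N a (le_reg 11 12) (wp N a (clear_reg 13) Q) ?s3"
        using l nv emp by (intro wp_le) auto
      have eq: "?s2(0 := S, 11 := p2, 12 := n2, 13 := d2, 17 := tl ((?s2(0 := S, 11 := p2, 12 := n2, 13 := d2)) 17)) = ?s3"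
        using nv emp by (auto simp: fun_eq_iff)
      show "?R (?s2(0 := S, 11 := p2, 12 := n2, 13 := d2))"
        using 1 by (simp only: wp_simps(4,6) eq)
    qed (use nv len in auto)
    thus "wp N a (row n v) ?R (?s1(c := w, 33 := after_nat (?s1 33), 11 := p', 12 := n', 13 := d'))"
      unfolding s2 .
  next
    assume "parse_rat (?s1 c) = None"
    hence "drop_rats W (Suc j) = None" using W nv by simp
    thus "\<not> a" using fail by blast
  qed (use nv in auto)
  moreover have "s(13 := True # s 13, 17 := True # s 17, 33 := [True, True, False]) = ?s1" using emp by simp
  ultimately show ?thesis unfolding bound_row_def using emp by (simp add: fun_upd_twist)
qed

text \<open>The product of a row of H with \<open>x\<close> is never stored: the matching coordinate
  of \<open>u\<close> is put into the weight register 17 and multiplies each entry of the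
  row.\<close>

definition form_row :: com where
  "form_row = PUSH 13 (\<lambda>_. True) ;; copy_reg 2 33 ;; copy_reg 6 23 ;;
     WHILE (\<lambda>p. nonempty (p 23)) (POP 23 ;; read_bits 33 17 ;; POP 33 ;; row 4 1 ;; clear_reg 17) ;;
     clear_reg 33 ;; le_reg 11 12 ;; clear_reg 13"

text \<open>The bilinear form \<open>u^T H x\<close>, where H is stored row by row from position
  \<open>i\<close> on.\<close>

definition form_sum :: "(nat \<Rightarrow> rat) \<Rightarrow> nat \<Rightarrow> nat \<Rightarrow> nat \<Rightarrow> (nat \<Rightarrow> nat) \<Rightarrow> (nat \<Rightarrow> nat) \<Rightarrow> rat" where
  "form_sum e i n k x u = (\<Sum>j<n. row_sum e (i + j * k) k x * of_nat (u j))"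

lemma wp_form_row:
  assumes idle: "idle s" "s 23 = []"
    and W: "drop_rats W i = Some (s 0)"
    and len: "length W \<le> m" "length (s 1) \<le> m" "length (s 2) \<le> m" "length (s 4) \<le> m" "length (s 6) \<le> m"
      "(m * m + 1) * (6 * m + 1) + 8 * m + 20 < N"
    and ok: "\<And>S. drop_rats W (i + length (s 6) * length (s 4)) = Some S \<Longrightarrow>
       Q (s(0 := S, 30 := [form_sum (rat_at W) i (length (s 6)) (length (s 4)) (nat_at (s 1)) (nat_at (s 2)) \<le> 0]))"
    and fail: "drop_rats W (i + length (s 6) * length (s 4)) = None \<Longrightarrow> \<not> a"
  shows "wp N a form_row Q s"
proof -
  have emp: "s 11 = []" "s 12 = []" "s 13 = []" "s 17 = []" "s 24 = []" "s 32 = []" "s 33 = []" "s 30 = []" "s 25 = []" "s 21 = []"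
    using idle by (auto simp: idle_def clean_def)
  define k where "k = length (s 6)"
  define n where "n = length (s 4)"
  define f where "f r = form_sum (rat_at W) i r n (nat_at (s 1)) (nat_at (s 2))" for r
  \<comment> \<open>Length of the accumulator after \<open>r\<close> rows. With at most
    \<open>m\<close> rows and columns it is at most \<open>1 + m * m * (6 * m + 1)\<close>, which is
    where the lower bound on \<open>N\<close> comes from.\<close>
  define B where "B r = 1 + r * (n * (6 * m + 1))" for r
  have Bmono: "B r \<le> 1 + m * m * (6 * m + 1)" if "r \<le> k" for r
  proof -
    have "r * n \<le> m * m" using that len by (intro mult_mono) (auto simp: k_def n_def)
    hence "r * n * (6 * m + 1) \<le> m * m * (6 * m + 1)" by (rule mult_right_mono) simp
    thus ?thesis unfolding B_def by (simp only: mult.assoc add_le_cancel_left)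
  qed
  have lenN: "length W \<le> N" "length (s 1) \<le> N" "length (s 2) \<le> N" "length (s 4) \<le> N" "length (s 6) \<le> N" "m \<le> N"
    using len by simp_all
  define J where "J rem s' \<longleftrightarrow> (\<exists>cs S p' n' d'. rem = length cs \<and> rem \<le> k \<and>
      s' = s(0 := S, 11 := p', 12 := n', 13 := d', 23 := cs, 33 := (after_nat ^^ (k - rem)) (s 2)) \<and>
      drop_rats W (i + (k - rem) * n) = Some S \<and> acc p' n' d' (f (k - rem)) (B (k - rem)))" for rem s'
  let ?R = "wp N a (clear_reg 33 ;; le_reg 11 12 ;; clear_reg 13) Q"
  have "wp N a (WHILE (\<lambda>p. nonempty (p 23)) (POP 23 ;; read_bits 33 17 ;; POP 33 ;; row 4 1 ;; clear_reg 17)) ?R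
      (s(13 := [True], 33 := s 2, 23 := s 6))"
  proof (rule wp_while[where J = J and n = k])
    show "J k (s(13 := [True], 33 := s 2, 23 := s 6))" unfolding J_def
      by (intro exI[of _ "s 6"] exI[of _ "s 0"] exI[of _ "[]"] exI[of _ "[]"] exI[of _ "[True]"])
        (use W emp in \<open>auto simp: k_def f_def form_sum_def acc_def B_def fun_eq_iff\<close>)
    show "k \<le> N" using lenN by (simp add: k_def)
  next
    fix rem s' assume "J rem s'" and g: "nonempty (peeks s' 23)"
    then obtain cs S p' n' d' where J: "rem = length cs" "rem \<le> k"
      "s' = s(0 := S, 11 := p', 12 := n', 13 := d', 23 := cs, 33 := (after_nat ^^ (k - rem)) (s 2))"
      "drop_rats W (i + (k - rem) * n) = Some S" "acc p' n' d' (f (k - rem)) (B (k - rem))"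
      unfolding J_def by blast
    have ne: "rem \<noteq> 0" using g J by auto
    hence eq: "k - (rem - 1) = Suc (k - rem)" using J(2) by simp
    define V where "V = (after_nat ^^ (k - rem)) (s 2)"
    have lV: "length V \<le> m" using length_after_nat_pow[of "k - rem" "s 2"] len by (simp add: V_def)
    let ?t1 = "s(0 := S, 11 := p', 12 := n', 13 := d', 23 := tl cs, 33 := V)"
    let ?t2 = "s(0 := S, 11 := p', 12 := n', 13 := d', 23 := tl cs, 33 := after_nat V, 17 := rev (code_bits V))"
    have "wp N a (row 4 1) (wp N a (clear_reg 17) (J (rem - 1))) ?t2"
    proof (rule wp_row[where W = W and i = "i + (k - rem) * n" and m = m and q = "f (k - rem)" and l = "B (k - rem)"])
      show "clean ?t2" using idle by (simp add: idle_def clean_def)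
      show "?t2 24 = []" "?t2 32 = []" using emp by auto
      show "drop_rats W (i + (k - rem) * n) = Some (?t2 0)" using J by simp
      show "length (?t2 4) \<le> m" "length (?t2 1) \<le> m" using len by simp_all
      show "length (?t2 17) \<le> m" using length_code_bits[of V] lV by simp
      have "B (Suc (k - rem)) \<le> 1 + m * m * (6 * m + 1)" using J(2) ne by (intro Bmono) auto
      moreover have "B (k - rem) + length (?t2 4) * (6 * m + 1) = B (Suc (k - rem))"
        by (simp add: B_def n_def)
      ultimately show "B (k - rem) + length (?t2 4) * (6 * m + 1) + 8 * m + 10 < N"
        using len(6) by (simp add: algebra_simps)
      show "acc (?t2 11) (?t2 12) (?t2 13) (f (k - rem)) (B (k - rem))" using J by simp
      have "i + (k - rem) * n + n \<le> i + k * n"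
      proof -
        have "Suc (k - rem) * n \<le> k * n" using J(2) ne by (intro mult_right_mono) auto
        thus ?thesis by simp
      qed
      thus "drop_rats W (i + (k - rem) * n + length (?t2 4)) = None \<Longrightarrow> \<not> a"
        using fail drop_rats_None_mono by (simp add: n_def k_def)
    next
      fix S2 p2 n2 d2 assume S2: "drop_rats W (i + (k - rem) * n + length (?t2 4)) = Some S2"
        and acc2: "acc p2 n2 d2 (f (k - rem) + row_sum (rat_at W) (i + (k - rem) * n) (length (?t2 4)) (nat_at (?t2 1)) *
            of_nat (bits_val (rev (?t2 17)))) (B (k - rem) + length (?t2 4) * (6 * m + 1))"
      have "f (Suc (k - rem)) = f (k - rem) + row_sum (rat_at W) (i + (k - rem) * n) n (nat_at (s 1)) * of_nat (bits_val (code_bits V))"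
        by (simp add: f_def form_sum_def nat_at_def V_def first_nat_def)
      hence acc3: "acc p2 n2 d2 (f (Suc (k - rem))) (B (Suc (k - rem)))"
        using acc2 by (simp add: n_def B_def algebra_simps)
      have J': "J (rem - 1) (s(0 := S2, 11 := p2, 12 := n2, 13 := d2, 23 := tl cs, 33 := after_nat V))"
        unfolding J_def eq
      proof (intro exI conjI)
        show "rem - 1 = length (tl cs)" using J(1) by simp
        show "rem - 1 \<le> k" using J(2) by simp
        show "drop_rats W (i + Suc (k - rem) * n) = Some S2" using S2 by (simp add: n_def ac_simps)
        show "s(0 := S2, 11 := p2, 12 := n2, 13 := d2, 23 := tl cs, 33 := after_nat V) =
          s(0 := S2, 11 := p2, 12 := n2, 13 := d2, 23 := tl cs, 33 := (after_nat ^^ Suc (k - rem)) (s 2))"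
          by (simp add: V_def)
      qed (rule acc3)
      show "wp N a (clear_reg 17) (J (rem - 1)) (?t2(0 := S2, 11 := p2, 12 := n2, 13 := d2))"
      proof (rule wp_clear)
        have "?t2(0 := S2, 11 := p2, 12 := n2, 13 := d2, 17 := []) = s(0 := S2, 11 := p2, 12 := n2, 13 := d2, 23 := tl cs, 33 := after_nat V)"
          using emp by (auto simp: fun_eq_iff)
        thus "J (rem - 1) (?t2(0 := S2, 11 := p2, 12 := n2, 13 := d2, 17 := []))" using J' by simp
      qed (use length_code_bits[of V] lV lenN in simp)
    qed (use len in auto)
    moreover have "?t2 = ?t1(33 := code_rest (?t1 33), 17 := rev (code_bits (?t1 33)) @ ?t1 17,
        33 := tl ((?t1(33 := code_rest (?t1 33), 17 := rev (code_bits (?t1 33)) @ ?t1 17)) 33))"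
      using emp by (auto simp: fun_eq_iff after_nat_def)
    ultimately have "wp N a (POP 33) (wp N a (row 4 1) (wp N a (clear_reg 17) (J (rem - 1))))
        (?t1(33 := code_rest (?t1 33), 17 := rev (code_bits (?t1 33)) @ ?t1 17))"
      by (simp only: wp_simps(4))
    hence "wp N a (read_bits 33 17) (wp N a (POP 33) (wp N a (row 4 1) (wp N a (clear_reg 17) (J (rem - 1))))) ?t1"
      using lV lenN by (intro wp_read_bits) auto
    moreover have "?t1 = s'(23 := tl (s' 23))" by (auto simp: J(3) fun_eq_iff V_def)
    ultimately show "rem \<noteq> 0 \<and> wp N a (POP 23 ;; read_bits 33 17 ;; POP 33 ;; row 4 1 ;; clear_reg 17) (J (rem - 1)) s'"
      using ne by (simp only: wp_simps(4,6)) simp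
  next
    fix rem s' assume "J rem s'" and g: "\<not> nonempty (peeks s' 23)"
    then obtain cs S p' n' d' where J: "rem = length cs" "rem \<le> k"
      "s' = s(0 := S, 11 := p', 12 := n', 13 := d', 23 := cs, 33 := (after_nat ^^ (k - rem)) (s 2))"
      "drop_rats W (i + (k - rem) * n) = Some S" "acc p' n' d' (f (k - rem)) (B (k - rem))"
      unfolding J_def by blast
    have cs: "cs = []" using g J by auto
    have l: "length p' \<le> N" "length n' \<le> N" "length d' \<le> N"
      using J(5) Bmono[of "k - rem"] len(6) by (simp_all add: acc_def algebra_simps)
    have b: "(bits_val p' \<le> bits_val n') = (f k \<le> 0)" using acc_le_0[OF J(5)] J cs by simp
    let ?s3 = "s(0 := S, 11 := p', 12 := n', 13 := d')"
    have "?s3(11 := [], 12 := [], 30 := [bits_val p' \<le> bits_val n'], 13 := []) = s(0 := S, 30 := [f k \<le> 0])"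
      using emp by (auto simp: fun_eq_iff b)
    hence "Q (?s3(11 := [], 12 := [], 30 := [bits_val p' \<le> bits_val n'], 13 := []))"
      using ok[of S] J cs by (simp add: f_def k_def n_def)
    hence "wp N a (clear_reg 13) Q (?s3(11 := [], 12 := [], 30 := [bits_val p' \<le> bits_val n']))"
      using l by (intro wp_clear) auto
    hence 1: "wp N a (le_reg 11 12) (wp N a (clear_reg 13) Q) ?s3"
      using l emp by (intro wp_le) auto
    have "s'(33 := []) = ?s3" using J(3) cs idle emp by (auto simp: fun_eq_iff)
    hence "wp N a (clear_reg 33) (wp N a (le_reg 11 12) (wp N a (clear_reg 13) Q)) s'"
      using 1 length_after_nat_pow[of "k - rem" "s 2"] lenN J(3) by (intro wp_clear) auto
    thus "?R s'" by (simp only: wp_simps(6))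
  qed
  hence "wp N a (copy_reg 2 33) (wp N a (copy_reg 6 23) (wp N a (WHILE (\<lambda>p. nonempty (p 23))
      (POP 23 ;; read_bits 33 17 ;; POP 33 ;; row 4 1 ;; clear_reg 17)) ?R)) (s(13 := [True]))"
    using emp idle lenN by (intro wp_copy) auto
  thus ?thesis unfolding form_row_def using emp by simp
qed


section \<open>The complete check of an instance against two witnesses\<close>

declare drop_rats.simps(2) [simp del]

text \<open>The stream lists \<open>a\<close>, \<open>b\<close>, \<open>A\<close>, \<open>B\<close>
  and the matrices H in this order, which explains the offsets. An infeasible \<open>x\<close> is a
  failed guess, whereas an infeasible \<open>u\<close> is no counterexample. The stream must be used
  up exactly.\<close>

definition checks :: "nat \<Rightarrow> nat \<Rightarrow> nat \<Rightarrow> nat \<Rightarrow> nat \<Rightarrow> bool list \<Rightarrow> bool list \<Rightarrow> bool list \<Rightarrow> bool" where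
  "checks mx nx mu nu L W X Y \<longleftrightarrow>
     drop_rats W (mx + mu + mx * nx + mu * nu + L * (nu * nx)) = Some [] \<and>
     (\<forall>i < mx. row_sum (rat_at W) (mx + mu + i * nx) nx (nat_at X) \<le> rat_at W i) \<and>
     ((\<forall>i < mu. row_sum (rat_at W) (mx + mu + mx * nx + i * nu) nu (nat_at Y) \<le> rat_at W (mx + i)) \<longrightarrow>
      (\<forall>l < L. form_sum (rat_at W) (mx + mu + mx * nx + mu * nu + l * (nu * nx)) nu nx (nat_at X) (nat_at Y) \<le> 0))"

definition verifier :: "bool list \<Rightarrow> bool list \<Rightarrow> bool list \<Rightarrow> bool" where
  "verifier I X Y \<longleftrightarrow> (\<exists>mx nx mu nu L W.
     I = concat (map unary_code [mx, nx, mu, nu, L]) @ W \<and> checks mx nx mu nu L W X Y)"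

definition repeat :: "nat \<Rightarrow> com \<Rightarrow> com" where
  "repeat n c = copy_reg n 22 ;; WHILE (\<lambda>p. nonempty (p 22)) (POP 22 ;; c)"

text \<open>The invariant speaks of states whose counter 22 is empty, and the body must preserve any
  content \<open>cs\<close> of it. So the counter does not enter the invariants of the individual
  loops.\<close>

lemma wp_repeat:
  assumes n: "n < 11" and emp: "s 22 = []" "s 25 = []" and len: "length (s n) \<le> N"
    and init: "J 0 s"
    and step: "\<And>i t cs. i < length (s n) \<Longrightarrow> J i t \<Longrightarrow> t 22 = [] \<Longrightarrow>
       wp N a c (\<lambda>t'. \<exists>t''. t' = t''(22 := cs) \<and> t'' 22 = [] \<and> J (Suc i) t'') (t(22 := cs))"
    and exit: "\<And>t. J (length (s n)) t \<Longrightarrow> t 22 = [] \<Longrightarrow> Q t"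
  shows "wp N a (repeat n c) Q s"
proof -
  define k where "k = length (s n)"
  define K where "K rem s' \<longleftrightarrow> (\<exists>cs t. rem = length cs \<and> rem \<le> k \<and> s' = t(22 := cs) \<and> t 22 = [] \<and> J (k - rem) t)"
    for rem s'
  have "wp N a (WHILE (\<lambda>p. nonempty (p 22)) (POP 22 ;; c)) Q (s(22 := s n))"
  proof (rule wp_while[where J = K and n = k])
    show "K k (s(22 := s n))" unfolding K_def using emp init k_def by auto
    show "k \<le> N" using len by (simp add: k_def)
  next
    fix rem s' assume "K rem s'" and g: "nonempty (peeks s' 22)"
    then obtain cs t where K: "rem = length cs" "rem \<le> k" "s' = t(22 := cs)" "t 22 = []" "J (k - rem) t"
      unfolding K_def by blast
    have ne: "rem \<noteq> 0" using g K by auto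
    hence eq: "k - (rem - 1) = Suc (k - rem)" using K(2) by simp
    have lt: "k - rem < length (s n)" using ne K(2) by (simp add: k_def)
    have "wp N a c (K (rem - 1)) (t(22 := tl cs))"
    proof (rule wp_mono)
      show "wp N a c (\<lambda>t'. \<exists>t''. t' = t''(22 := tl cs) \<and> t'' 22 = [] \<and> J (Suc (k - rem)) t'') (t(22 := tl cs))"
        using K(4,5) lt by (intro step)
    next
      fix t' assume "\<exists>t''. t' = t''(22 := tl cs) \<and> t'' 22 = [] \<and> J (Suc (k - rem)) t''"
      thus "K (rem - 1) t'" unfolding K_def eq using K(1,2) by (intro exI[of _ "tl cs"]) auto
    qed
    thus "rem \<noteq> 0 \<and> wp N a (POP 22 ;; c) (K (rem - 1)) s'" using ne K(3) by simp
  next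
    fix rem s' assume "K rem s'" and g: "\<not> nonempty (peeks s' 22)"
    then obtain cs t where K: "rem = length cs" "rem \<le> k" "s' = t(22 := cs)" "t 22 = []" "J (k - rem) t"
      unfolding K_def by blast
    have "cs = []" using g K by auto
    moreover from this have "s' = t" using K(3,4) by (auto simp: fun_eq_iff)
    ultimately show "Q s'" using exit[of t] K by (simp add: k_def)
  qed
  thus ?thesis unfolding repeat_def wp_simps(6) using n emp len by (intro wp_copy) auto
qed

text \<open>Cursors at \<open>a\<close> and \<open>b\<close> are set aside because these entries
  precede the matrices in the stream. An infeasible \<open>u\<close> only marks register 10 and does
  not end the run, as the rest of the stream still has to be parsed.\<close>

definition decide :: com where
  "decide = copy_reg 0 8 ;; skip_many 3 ;; copy_reg 0 9 ;; skip_many 5 ;;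
     repeat 3 (bound_row 8 4 1 ;; IF (\<lambda>p. isT (p 30)) SKIP (HALT False) ;; POP 30) ;;
     repeat 5 (bound_row 9 6 2 ;; IF (\<lambda>p. isT (p 30)) SKIP (PUSH 10 (\<lambda>_. True)) ;; POP 30) ;;
     repeat 7 (form_row ;; IF (\<lambda>p. isT (p 30) \<or> nonempty (p 10)) SKIP (HALT False) ;; POP 30) ;;
     IF (\<lambda>p. nonempty (p 0)) (HALT False) (HALT True)"

lemma mult_Suc_le: "i < k \<Longrightarrow> i * n + n \<le> k * n" for i k n :: nat
  using mult_le_mono1[of "Suc i" k n] by simp

text \<open>The situation once the header has been read: \<open>m\<close> bounds all dimensions and
  lengths, and \<open>a\<close> is the verdict to be reached.\<close>

locale verifier_run =
  fixes N m mx nx mu nu L :: nat and W X Y :: "bool list" and a :: bool and s :: state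
  assumes bound: "(m * m + 1) * (6 * m + 1) + 8 * m + 20 < N" "3 \<le> m"
    and len: "mx \<le> m" "nx \<le> m" "mu \<le> m" "nu \<le> m" "L \<le> m" "length W \<le> m" "length X \<le> m" "length Y \<le> m"
    and a: "a = checks mx nx mu nu L W X Y"
    and s: "s 1 = X" "s 2 = Y" "length (s 3) = mx" "length (s 4) = nx" "length (s 5) = mu"
      "length (s 6) = nu" "length (s 7) = L" "\<And>i. 10 \<le> i \<Longrightarrow> s i = []"
begin

abbreviation "oA \<equiv> mx + mu"
abbreviation "oB \<equiv> mx + mu + mx * nx"
abbreviation "oH \<equiv> mx + mu + mx * nx + mu * nu"
abbreviation "oEnd \<equiv> mx + mu + mx * nx + mu * nu + L * (nu * nx)"

lemma s1: "s (Suc 0) = X"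
  using s(1) by simp

lemma le_N: "m \<le> N" "nx \<le> N" "length W \<le> N" "mx \<le> N" "mu \<le> N" "nu \<le> N" "L \<le> N"
  using bound len by simp_all

lemma row_bound: "k \<le> m \<Longrightarrow> (k + 1) * (6 * m + 1) + 8 * m + 20 < N"
proof -
  assume "k \<le> m"
  also have "m \<le> m * m" by simp
  finally have "(k + 1) * (6 * m + 1) \<le> (m * m + 1) * (6 * m + 1)" by (intro mult_right_mono) auto
  thus ?thesis using bound(1) by linarith
qed

lemma drop_rats_None: "drop_rats W i = None \<Longrightarrow> i \<le> oEnd \<Longrightarrow> \<not> a"
  using drop_rats_None_mono[of W i oEnd] by (auto simp: a checks_def)

lemma wp_rows_x:
  assumes "drop_rats W oA = Some S" "drop_rats W 0 = Some S8" "t = s(0 := S, 8 := S8, 9 := S9)"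
    and ok: "\<And>S S8. drop_rats W oB = Some S \<Longrightarrow>
       (\<forall>i < mx. row_sum (rat_at W) (oA + i * nx) nx (nat_at X) \<le> rat_at W i) \<Longrightarrow>
       Q (s(0 := S, 8 := S8, 9 := S9))"
  shows "wp N a (repeat 3 (bound_row 8 4 1 ;; IF (\<lambda>p. isT (p 30)) SKIP (HALT False) ;; POP 30)) Q t"
proof (rule wp_repeat[where J = "\<lambda>i t. \<exists>S S8. t = s(0 := S, 8 := S8, 9 := S9) \<and>
      drop_rats W (oA + i * nx) = Some S \<and> drop_rats W i = Some S8 \<and>
      (\<forall>i' < i. row_sum (rat_at W) (oA + i' * nx) nx (nat_at X) \<le> rat_at W i')"])
  show "\<exists>S S8. t = s(0 := S, 8 := S8, 9 := S9) \<and>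
      drop_rats W (oA + 0 * nx) = Some S \<and> drop_rats W 0 = Some S8 \<and>
      (\<forall>i' < 0. row_sum (rat_at W) (oA + i' * nx) nx (nat_at X) \<le> rat_at W i')"
    using assms by auto
  show "t 22 = []" "t 25 = []" "length (t 3) \<le> N" using assms s le_N by auto
next
  fix i t' cs
  assume i: "i < length (t 3)" and "\<exists>S S8. t' = s(0 := S, 8 := S8, 9 := S9) \<and>
      drop_rats W (oA + i * nx) = Some S \<and> drop_rats W i = Some S8 \<and>
      (\<forall>i' < i. row_sum (rat_at W) (oA + i' * nx) nx (nat_at X) \<le> rat_at W i')"
  then obtain S S8 where t': "t' = s(0 := S, 8 := S8, 9 := S9)" "drop_rats W (oA + i * nx) = Some S"
    "drop_rats W i = Some S8" "\<forall>i' < i. row_sum (rat_at W) (oA + i' * nx) nx (nat_at X) \<le> rat_at W i'"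
    by blast
  have imx: "i < mx" using i assms(3) s by simp
  let ?Q = "\<lambda>t'. \<exists>t''. t' = t''(22 := cs) \<and> t'' 22 = [] \<and> (\<exists>S S8. t'' = s(0 := S, 8 := S8, 9 := S9) \<and>
      drop_rats W (oA + Suc i * nx) = Some S \<and> drop_rats W (Suc i) = Some S8 \<and>
      (\<forall>i' < Suc i. row_sum (rat_at W) (oA + i' * nx) nx (nat_at X) \<le> rat_at W i'))"
  let ?t = "s(0 := S, 8 := S8, 9 := S9, 22 := cs)"
  have "wp N a (bound_row 8 4 1) (wp N a (IF (\<lambda>p. isT (p 30)) SKIP (HALT False) ;; POP 30) ?Q) ?t"
  proof (rule wp_bound_row[where m = m and W = W and i = "oA + i * nx" and j = i])
    show "idle ?t" by (simp add: idle_def clean_def s)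
    show "drop_rats W (oA + i * nx) = Some (?t 0)" "drop_rats W i = Some (?t 8)" using t' by simp_all
    show "(length (?t 4) + 1) * (6 * m + 1) + 8 * m + 20 < N" using row_bound[of nx] len by (simp add: s)
    show "\<not> a" if "drop_rats W (oA + i * nx + length (?t 4)) = None \<or> drop_rats W (Suc i) = None"
    proof -
      have "oA + i * nx + nx \<le> oEnd" "Suc i \<le> oEnd" using mult_Suc_le[OF imx, of nx] imx by linarith+
      moreover have "drop_rats W (oA + i * nx + nx) = None \<or> drop_rats W (Suc i) = None" using that by (simp add: s)
      ultimately show ?thesis using drop_rats_None by blast
    qed
  next
    fix S2 S3 assume S: "drop_rats W (oA + i * nx + length (?t 4)) = Some S2" "drop_rats W (Suc i) = Some S3"
    let ?b = "row_sum (rat_at W) (oA + i * nx) nx (nat_at X) \<le> rat_at W i"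
    have S2: "drop_rats W (oA + Suc i * nx) = Some S2" using S(1) by (simp add: s ac_simps)
    let ?u = "s(0 := S2, 8 := S3, 9 := S9)"
    have eq: "?t(0 := S2, 8 := S3, 30 := [?b]) = ?u(22 := cs, 30 := [?b])" by (rule ext) simp
    have "wp N a (IF (\<lambda>p. isT (p 30)) SKIP (HALT False) ;; POP 30) ?Q (?u(22 := cs, 30 := [?b]))"
    proof (cases ?b)
      case True
      have "?u(22 := cs, 30 := []) = ?u(22 := cs)" by (rule ext) (simp add: s)
      moreover have "?Q (?u(22 := cs))"
        using S2 S(2) t'(4) True s by (intro exI[of _ ?u] conjI refl exI[of _ S2] exI[of _ S3]) (auto simp: less_Suc_eq)
      ultimately have "?Q (?u(22 := cs, 30 := []))" by (simp only:)
      thus ?thesis using True by simp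
    next
      case False
      \<comment> \<open>A violated row refutes \<open>checks\<close>, so halting with
        \<open>False\<close> is the expected verdict.\<close>
      hence "\<not> a" using imx by (auto simp: a checks_def)
      thus ?thesis using False by simp
    qed
    moreover have l: "length (?t 4) = nx" "?t 1 = X" by (simp_all add: s s1)
    ultimately show "wp N a (IF (\<lambda>p. isT (p 30)) SKIP (HALT False) ;; POP 30) ?Q
       (?t(0 := S2, 8 := S3, 30 := [row_sum (rat_at W) (oA + i * nx) (length (?t 4)) (nat_at (?t 1)) \<le> rat_at W i]))"
      unfolding l eq by (simp only:)
  qed (use len bound s in auto)
  thus "wp N a (bound_row 8 4 1 ;; IF (\<lambda>p. isT (p 30)) SKIP (HALT False) ;; POP 30) ?Q (t'(22 := cs))"
    using t'(1) by (simp only: wp_simps(6))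
next
  fix t' assume "\<exists>S S8. t' = s(0 := S, 8 := S8, 9 := S9) \<and> drop_rats W (oA + length (t 3) * nx) = Some S \<and>
      drop_rats W (length (t 3)) = Some S8 \<and>
      (\<forall>i' < length (t 3). row_sum (rat_at W) (oA + i' * nx) nx (nat_at X) \<le> rat_at W i')"
  moreover have "length (t 3) = mx" using assms(3) s by simp
  ultimately show "Q t'" using ok by auto
qed simp

lemma wp_rows_u:
  assumes "drop_rats W oB = Some S" "drop_rats W mx = Some S9" "t = s(0 := S, 8 := S8, 9 := S9)"
    and ok: "\<And>S S9 v. drop_rats W oH = Some S \<Longrightarrow>
       (v = [] \<longleftrightarrow> (\<forall>i < mu. row_sum (rat_at W) (oB + i * nu) nu (nat_at Y) \<le> rat_at W (mx + i))) \<Longrightarrow>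
       Q (s(0 := S, 8 := S8, 9 := S9, 10 := v))"
  shows "wp N a (repeat 5 (bound_row 9 6 2 ;; IF (\<lambda>p. isT (p 30)) SKIP (PUSH 10 (\<lambda>_. True)) ;; POP 30)) Q t"
proof (rule wp_repeat[where J = "\<lambda>i t. \<exists>S S9 v. t = s(0 := S, 8 := S8, 9 := S9, 10 := v) \<and>
      drop_rats W (oB + i * nu) = Some S \<and> drop_rats W (mx + i) = Some S9 \<and>
      (v = [] \<longleftrightarrow> (\<forall>i' < i. row_sum (rat_at W) (oB + i' * nu) nu (nat_at Y) \<le> rat_at W (mx + i')))"])
  have "t = s(0 := S, 8 := S8, 9 := S9, 10 := [])" using assms(3) s by (auto simp: fun_eq_iff)
  thus "\<exists>S S9 v. t = s(0 := S, 8 := S8, 9 := S9, 10 := v) \<and>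
      drop_rats W (oB + 0 * nu) = Some S \<and> drop_rats W (mx + 0) = Some S9 \<and>
      (v = [] \<longleftrightarrow> (\<forall>i' < 0. row_sum (rat_at W) (oB + i' * nu) nu (nat_at Y) \<le> rat_at W (mx + i')))"
    using assms(1,2) by auto
  show "t 22 = []" "t 25 = []" "length (t 5) \<le> N" using assms s le_N by auto
next
  fix i t' cs
  assume i: "i < length (t 5)" and "\<exists>S S9 v. t' = s(0 := S, 8 := S8, 9 := S9, 10 := v) \<and>
      drop_rats W (oB + i * nu) = Some S \<and> drop_rats W (mx + i) = Some S9 \<and>
      (v = [] \<longleftrightarrow> (\<forall>i' < i. row_sum (rat_at W) (oB + i' * nu) nu (nat_at Y) \<le> rat_at W (mx + i')))"
  then obtain S S9 v where t': "t' = s(0 := S, 8 := S8, 9 := S9, 10 := v)" "drop_rats W (oB + i * nu) = Some S"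
    "drop_rats W (mx + i) = Some S9"
    "v = [] \<longleftrightarrow> (\<forall>i' < i. row_sum (rat_at W) (oB + i' * nu) nu (nat_at Y) \<le> rat_at W (mx + i'))"
    by blast
  have imu: "i < mu" using i assms(3) s by simp
  let ?Q = "\<lambda>t'. \<exists>t''. t' = t''(22 := cs) \<and> t'' 22 = [] \<and> (\<exists>S S9 v. t'' = s(0 := S, 8 := S8, 9 := S9, 10 := v) \<and>
      drop_rats W (oB + Suc i * nu) = Some S \<and> drop_rats W (mx + Suc i) = Some S9 \<and>
      (v = [] \<longleftrightarrow> (\<forall>i' < Suc i. row_sum (rat_at W) (oB + i' * nu) nu (nat_at Y) \<le> rat_at W (mx + i'))))"
  let ?t = "s(0 := S, 8 := S8, 9 := S9, 10 := v, 22 := cs)"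
  have "wp N a (bound_row 9 6 2) (wp N a (IF (\<lambda>p. isT (p 30)) SKIP (PUSH 10 (\<lambda>_. True)) ;; POP 30) ?Q) ?t"
  proof (rule wp_bound_row[where m = m and W = W and i = "oB + i * nu" and j = "mx + i"])
    show "idle ?t" by (simp add: idle_def clean_def s)
    show "drop_rats W (oB + i * nu) = Some (?t 0)" "drop_rats W (mx + i) = Some (?t 9)" using t' by simp_all
    show "(length (?t 6) + 1) * (6 * m + 1) + 8 * m + 20 < N" using row_bound[of nu] len by (simp add: s)
    show "\<not> a" if "drop_rats W (oB + i * nu + length (?t 6)) = None \<or> drop_rats W (Suc (mx + i)) = None"
    proof -
      have "oB + i * nu + nu \<le> oEnd" "Suc (mx + i) \<le> oEnd" using mult_Suc_le[OF imu, of nu] imu by linarith+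
      moreover have "drop_rats W (oB + i * nu + nu) = None \<or> drop_rats W (Suc (mx + i)) = None" using that by (simp add: s)
      ultimately show ?thesis using drop_rats_None by blast
    qed
  next
    fix S2 S3 assume S: "drop_rats W (oB + i * nu + length (?t 6)) = Some S2" "drop_rats W (Suc (mx + i)) = Some S3"
    let ?b = "row_sum (rat_at W) (oB + i * nu) nu (nat_at Y) \<le> rat_at W (mx + i)"
    have S2: "drop_rats W (oB + Suc i * nu) = Some S2" using S(1) by (simp add: s ac_simps)
    define v' where "v' = (if ?b then v else True # v)"
    let ?u = "s(0 := S2, 8 := S8, 9 := S3, 10 := v')"
    have v': "v' = [] \<longleftrightarrow> (\<forall>i' < Suc i. row_sum (rat_at W) (oB + i' * nu) nu (nat_at Y) \<le> rat_at W (mx + i'))"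
      using t'(4) by (auto simp: v'_def less_Suc_eq)
    have Q: "?Q (?u(22 := cs))"
      by (intro exI[of _ ?u] conjI refl exI[of _ S2] exI[of _ S3] exI[of _ v'] v' S2) (simp_all add: s S(2))
    have "wp N a (IF (\<lambda>p. isT (p 30)) SKIP (PUSH 10 (\<lambda>_. True)) ;; POP 30) ?Q (?t(0 := S2, 9 := S3, 30 := [?b]))"
    proof (cases ?b)
      case True
      have eq: "?t(0 := S2, 9 := S3, 30 := [True], 30 := tl ((?t(0 := S2, 9 := S3, 30 := [True])) 30)) = ?u(22 := cs)"
        using True by (auto simp: v'_def fun_eq_iff s)
      have "wp N a (POP 30) ?Q (?t(0 := S2, 9 := S3, 30 := [True]))"
        unfolding wp_simps(4) eq by (rule Q)
      thus ?thesis using True unfolding wp_simps(6,7) by simp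
    next
      case False
      let ?w = "?t(0 := S2, 9 := S3, 30 := [False], 10 := True # v)"
      have eq: "?w(30 := tl (?w 30)) = ?u(22 := cs)"
        using False by (auto simp: v'_def fun_eq_iff s)
      have "wp N a (POP 30) ?Q ?w"
        unfolding wp_simps(4) eq by (rule Q)
      thus ?thesis using False unfolding wp_simps(6,7) by simp
    qed
    moreover have l: "length (?t 6) = nu" "?t 2 = Y" by (simp_all add: s s1)
    ultimately show "wp N a (IF (\<lambda>p. isT (p 30)) SKIP (PUSH 10 (\<lambda>_. True)) ;; POP 30) ?Q
       (?t(0 := S2, 9 := S3, 30 := [row_sum (rat_at W) (oB + i * nu) (length (?t 6)) (nat_at (?t 2)) \<le> rat_at W (mx + i)]))"
      unfolding l by (simp only:)
  qed (use len bound s in auto)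
  thus "wp N a (bound_row 9 6 2 ;; IF (\<lambda>p. isT (p 30)) SKIP (PUSH 10 (\<lambda>_. True)) ;; POP 30) ?Q (t'(22 := cs))"
    using t'(1) by (simp only: wp_simps(6))
next
  fix t' assume "\<exists>S S9 v. t' = s(0 := S, 8 := S8, 9 := S9, 10 := v) \<and> drop_rats W (oB + length (t 5) * nu) = Some S \<and>
      drop_rats W (mx + length (t 5)) = Some S9 \<and>
      (v = [] \<longleftrightarrow> (\<forall>i' < length (t 5). row_sum (rat_at W) (oB + i' * nu) nu (nat_at Y) \<le> rat_at W (mx + i')))"
  moreover have "length (t 5) = mu" using assms(3) s by simp
  ultimately show "Q t'" using ok by auto
qed simp

lemma wp_forms:
  assumes "drop_rats W oH = Some S" "t = s(0 := S, 8 := S8, 9 := S9, 10 := v)"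
    and v: "v = [] \<longleftrightarrow> (\<forall>i < mu. row_sum (rat_at W) (oB + i * nu) nu (nat_at Y) \<le> rat_at W (mx + i))"
    and ok: "\<And>S. drop_rats W oEnd = Some S \<Longrightarrow>
       v = [] \<longrightarrow> (\<forall>l < L. form_sum (rat_at W) (oH + l * (nu * nx)) nu nx (nat_at X) (nat_at Y) \<le> 0) \<Longrightarrow>
       Q (s(0 := S, 8 := S8, 9 := S9, 10 := v))"
  shows "wp N a (repeat 7 (form_row ;; IF (\<lambda>p. isT (p 30) \<or> nonempty (p 10)) SKIP (HALT False) ;; POP 30)) Q t"
proof (rule wp_repeat[where J = "\<lambda>l t. \<exists>S. t = s(0 := S, 8 := S8, 9 := S9, 10 := v) \<and>
      drop_rats W (oH + l * (nu * nx)) = Some S \<and>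
      (v = [] \<longrightarrow> (\<forall>l' < l. form_sum (rat_at W) (oH + l' * (nu * nx)) nu nx (nat_at X) (nat_at Y) \<le> 0))"])
  show "\<exists>S. t = s(0 := S, 8 := S8, 9 := S9, 10 := v) \<and>
      drop_rats W (oH + 0 * (nu * nx)) = Some S \<and>
      (v = [] \<longrightarrow> (\<forall>l' < 0. form_sum (rat_at W) (oH + l' * (nu * nx)) nu nx (nat_at X) (nat_at Y) \<le> 0))"
    using assms(1,2) by auto
  show "t 22 = []" "t 25 = []" "length (t 7) \<le> N" using assms s le_N by auto
next
  fix l t' cs
  assume l: "l < length (t 7)" and "\<exists>S. t' = s(0 := S, 8 := S8, 9 := S9, 10 := v) \<and>
      drop_rats W (oH + l * (nu * nx)) = Some S \<and>
      (v = [] \<longrightarrow> (\<forall>l' < l. form_sum (rat_at W) (oH + l' * (nu * nx)) nu nx (nat_at X) (nat_at Y) \<le> 0))"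
  then obtain S where t': "t' = s(0 := S, 8 := S8, 9 := S9, 10 := v)" "drop_rats W (oH + l * (nu * nx)) = Some S"
      "v = [] \<longrightarrow> (\<forall>l' < l. form_sum (rat_at W) (oH + l' * (nu * nx)) nu nx (nat_at X) (nat_at Y) \<le> 0)"
    by blast
  have lL: "l < L" using l assms(2) s by simp
  let ?Q = "\<lambda>t'. \<exists>t''. t' = t''(22 := cs) \<and> t'' 22 = [] \<and> (\<exists>S. t'' = s(0 := S, 8 := S8, 9 := S9, 10 := v) \<and>
      drop_rats W (oH + Suc l * (nu * nx)) = Some S \<and>
      (v = [] \<longrightarrow> (\<forall>l' < Suc l. form_sum (rat_at W) (oH + l' * (nu * nx)) nu nx (nat_at X) (nat_at Y) \<le> 0)))"
  let ?t = "s(0 := S, 8 := S8, 9 := S9, 10 := v, 22 := cs)"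
  have "wp N a form_row (wp N a (IF (\<lambda>p. isT (p 30) \<or> nonempty (p 10)) SKIP (HALT False) ;; POP 30) ?Q) ?t"
  proof (rule wp_form_row[where m = m and W = W and i = "oH + l * (nu * nx)"])
    show "idle ?t" by (simp add: idle_def clean_def s)
    show "drop_rats W (oH + l * (nu * nx)) = Some (?t 0)" using t' by simp
    show "\<not> a" if "drop_rats W (oH + l * (nu * nx) + length (?t 6) * length (?t 4)) = None"
    proof -
      have "oH + l * (nu * nx) + nu * nx \<le> oEnd" using mult_Suc_le[OF lL, of "nu * nx"] by linarith
      moreover have "drop_rats W (oH + l * (nu * nx) + nu * nx) = None" using that by (simp add: s)
      ultimately show ?thesis using drop_rats_None by blast
    qed
  next
    fix S2 assume S: "drop_rats W (oH + l * (nu * nx) + length (?t 6) * length (?t 4)) = Some S2"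
    let ?b = "form_sum (rat_at W) (oH + l * (nu * nx)) nu nx (nat_at X) (nat_at Y) \<le> 0"
    have S2: "drop_rats W (oH + Suc l * (nu * nx)) = Some S2" using S by (simp add: s algebra_simps)
    let ?u = "s(0 := S2, 8 := S8, 9 := S9, 10 := v)"
    have "wp N a (IF (\<lambda>p. isT (p 30) \<or> nonempty (p 10)) SKIP (HALT False) ;; POP 30) ?Q (?t(0 := S2, 30 := [?b]))"
    proof (cases "?b \<or> v \<noteq> []")
      case True
      have "?t(0 := S2, 30 := [?b], 30 := []) = ?u(22 := cs)" by (auto simp: fun_eq_iff s)
      moreover have "?Q (?u(22 := cs))"
        using S2 t'(3) True s by (intro exI[of _ ?u] conjI refl exI[of _ S2]) (auto simp: less_Suc_eq)
      ultimately have "?Q (?t(0 := S2, 30 := [?b], 30 := []))" by (simp only:)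
      thus ?thesis using True unfolding wp_simps(6,7) by auto
    next
      case False
      hence "\<not> a" using lL v by (auto simp: a checks_def)
      thus ?thesis using False by simp
    qed
    moreover have l: "length (?t 6) = nu" "length (?t 4) = nx" "?t 1 = X" "?t 2 = Y" by (simp_all add: s s1)
    ultimately show "wp N a (IF (\<lambda>p. isT (p 30) \<or> nonempty (p 10)) SKIP (HALT False) ;; POP 30) ?Q
       (?t(0 := S2, 30 := [form_sum (rat_at W) (oH + l * (nu * nx)) (length (?t 6)) (length (?t 4)) (nat_at (?t 1)) (nat_at (?t 2)) \<le> 0]))"
      unfolding l by (simp only:)
  qed (use len bound s in auto)
  thus "wp N a (form_row ;; IF (\<lambda>p. isT (p 30) \<or> nonempty (p 10)) SKIP (HALT False) ;; POP 30) ?Q (t'(22 := cs))"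
    using t'(1) by (simp only: wp_simps(6))
next
  fix t' assume "\<exists>S. t' = s(0 := S, 8 := S8, 9 := S9, 10 := v) \<and> drop_rats W (oH + length (t 7) * (nu * nx)) = Some S \<and>
      (v = [] \<longrightarrow> (\<forall>l' < length (t 7). form_sum (rat_at W) (oH + l' * (nu * nx)) nu nx (nat_at X) (nat_at Y) \<le> 0))"
  moreover have "length (t 7) = L" using assms(2) s by simp
  ultimately show "Q t'" using ok by auto
qed simp

lemma wp_decide:
  assumes "s 0 = W" "s 8 = []" "s 9 = []"
  shows "wp N a decide (\<lambda>_. False) s"
proof -
  let ?H = "wp N a (repeat 7 (form_row ;; IF (\<lambda>p. isT (p 30) \<or> nonempty (p 10)) SKIP (HALT False) ;; POP 30))
     (wp N a (IF (\<lambda>p. nonempty (p 0)) (HALT False) (HALT True)) (\<lambda>_. False))"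
  let ?B = "wp N a (repeat 5 (bound_row 9 6 2 ;; IF (\<lambda>p. isT (p 30)) SKIP (PUSH 10 (\<lambda>_. True)) ;; POP 30)) ?H"
  let ?A = "wp N a (repeat 3 (bound_row 8 4 1 ;; IF (\<lambda>p. isT (p 30)) SKIP (HALT False) ;; POP 30)) ?B"
  have A: "?A (s(0 := S, 8 := W, 9 := S9))" if S: "drop_rats W oA = Some S" "drop_rats W mx = Some S9" for S S9
  proof (rule wp_rows_x[OF S(1) _ refl])
    fix S' S8 assume S': "drop_rats W oB = Some S'"
      and rows: "\<forall>i < mx. row_sum (rat_at W) (oA + i * nx) nx (nat_at X) \<le> rat_at W i"
    show "?B (s(0 := S', 8 := S8, 9 := S9))"
    proof (rule wp_rows_u[OF S' S(2) refl])
      fix S2 S92 and v :: "bool list" assume S2: "drop_rats W oH = Some S2"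
        and v: "v = [] \<longleftrightarrow> (\<forall>i < mu. row_sum (rat_at W) (oB + i * nu) nu (nat_at Y) \<le> rat_at W (mx + i))"
      show "?H (s(0 := S2, 8 := S8, 9 := S92, 10 := v))"
      proof (rule wp_forms[OF S2 refl v])
        fix S3 assume S3: "drop_rats W oEnd = Some S3"
          and f: "v = [] \<longrightarrow> (\<forall>l < L. form_sum (rat_at W) (oH + l * (nu * nx)) nu nx (nat_at X) (nat_at Y) \<le> 0)"
        have "a \<longleftrightarrow> S3 = []" unfolding a checks_def using S3 f v rows by auto
        thus "wp N a (IF (\<lambda>p. nonempty (p 0)) (HALT False) (HALT True)) (\<lambda>_. False) (s(0 := S3, 8 := S8, 9 := S92, 10 := v))"
          by simp
      qed
    qed
  qed simp
  have 3: "wp N a (skip_many 5) ?A (s(0 := S, 8 := W, 9 := S))" if S: "drop_rats W mx = Some S" for S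
  proof (rule wp_skip_many[where W = W and i = mx])
    show "clean (s(0 := S, 8 := W, 9 := S))" by (simp add: clean_def s)
    fix S' assume "drop_rats W (mx + length ((s(0 := S, 8 := W, 9 := S)) 5)) = Some S'"
    hence "drop_rats W oA = Some S'" by (simp add: s)
    moreover have "s(0 := S, 8 := W, 9 := S, 0 := S') = s(0 := S', 8 := W, 9 := S)" by (rule ext) simp
    ultimately show "?A (s(0 := S, 8 := W, 9 := S, 0 := S'))" using A[OF _ S] by (simp only:)
  next
    show "drop_rats W (mx + length ((s(0 := S, 8 := W, 9 := S)) 5)) = None \<Longrightarrow> \<not> a"
      using drop_rats_None[of oA] by (simp add: s)
  qed (use S le_N s in auto)
  have 2: "wp N a (skip_many 3) (wp N a (copy_reg 0 9) (wp N a (skip_many 5) ?A)) (s(8 := W))"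
  proof (rule wp_skip_many[where W = W and i = 0])
    show "clean (s(8 := W))" by (simp add: clean_def s)
    fix S assume "drop_rats W (0 + length ((s(8 := W)) 3)) = Some S"
    hence S: "drop_rats W mx = Some S" by (simp add: s)
    have "s(8 := W, 0 := S, 9 := S) = s(0 := S, 8 := W, 9 := S)" by (rule ext) simp
    thus "wp N a (copy_reg 0 9) (wp N a (skip_many 5) ?A) (s(8 := W, 0 := S))"
      using 3[OF S] assms s length_drop_rats[OF S] le_N by (intro wp_copy) auto
  next
    show "drop_rats W (0 + length ((s(8 := W)) 3)) = None \<Longrightarrow> \<not> a"
      using drop_rats_None[of mx] by (simp add: s)
  qed (use assms le_N s in auto)
  show ?thesis unfolding decide_def wp_simps(6)
    using 2 assms s le_N by (intro wp_copy) auto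
qed

end

section \<open>The header of an instance and the complete program\<close>

definition read_unary :: "nat \<Rightarrow> com" where
  "read_unary r = WHILE (\<lambda>p. isT (p 0)) (PUSH r (\<lambda>_. True) ;; POP 0) ;;
     IF (\<lambda>p. nonempty (p 0)) SKIP (HALT False) ;; POP 0"

lemma unary_split: "dropWhile id w \<noteq> [] \<Longrightarrow> w = unary_code (length (takeWhile id w)) @ tl (dropWhile id w)"
proof -
  assume a: "dropWhile id w \<noteq> []"
  have t: "takeWhile id w = replicate (length (takeWhile id w)) True"
    by (rule replicate_eqI[symmetric, THEN sym]) (auto dest: set_takeWhileD)
  have d: "dropWhile id w = False # tl (dropWhile id w)" using hd_dropWhile[OF a] a by (cases "dropWhile id w") simp_all
  have "replicate (length (takeWhile id w)) True @ False # tl (dropWhile id w) = w"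
    unfolding t[symmetric] d[symmetric] by (rule takeWhile_dropWhile_id)
  thus ?thesis unfolding unary_code_def append_assoc append_Cons append_Nil by (rule sym)
qed

lemma wp_read_unary:
  assumes "r \<noteq> 0" "s r = []" "length (s 0) \<le> N"
    and ok: "\<And>k w. s 0 = unary_code k @ w \<Longrightarrow> Q (s(0 := w, r := replicate k True))"
    and fail: "(\<nexists>k w. s 0 = unary_code k @ w) \<Longrightarrow> \<not> a"
  shows "wp N a (read_unary r) Q s"
proof -
  define f where "f = exec N (PUSH r (\<lambda>_. True) ;; POP 0)"
  have f: "f s = Normal (s(r := True # s r, 0 := tl (s 0)))" for s
    using assms(1) by (simp add: f_def)
  have *: "loop (\<lambda>p. isT (p 0)) f n s =
      Normal (s(0 := dropWhile id (s 0), r := replicate (length (takeWhile id (s 0))) True @ s r))"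
    if "length (s 0) \<le> n" for s n
    using that
  proof (induction n arbitrary: s)
    case (Suc n)
    show ?case using Suc.prems assms(1)
      by (cases "s 0") (auto simp: f[of s] Suc.IH fun_eq_iff replicate_app_Cons_same)
  qed (auto simp: fun_eq_iff)
  let ?k = "length (takeWhile id (s 0))"
  let ?w = "dropWhile id (s 0)"
  show ?thesis unfolding read_unary_def wp_simps(6)
  proof (rule wp_loop[OF *[of s N, OF assms(3), unfolded f_def]])
    let ?s = "s(0 := ?w, r := replicate ?k True @ s r)"
    show "wp N a (IF (\<lambda>p. nonempty (p 0)) SKIP (HALT False)) (wp N a (POP 0) Q) ?s"
    proof (cases "?w = []")
      case True
      have "\<nexists>k w. s 0 = unary_code k @ w"
      proof
        assume "\<exists>k w. s 0 = unary_code k @ w"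
        then obtain k w where "s 0 = unary_code k @ w" by blast
        hence "False \<in> set (s 0)" by (simp add: unary_code_def)
        thus False using True by (auto simp: dropWhile_eq_Nil_conv)
      qed
      hence "\<not> a" using fail by blast
      thus ?thesis unfolding True using assms(1) by simp
    next
      case False
      have "?s(0 := tl ?w) = s(0 := tl ?w, r := replicate ?k True)" using assms by (auto simp: fun_eq_iff)
      thus ?thesis using False ok[OF unary_split[OF False]] assms(1) by simp
    qed
  qed
qed

definition main :: com where
  "main = read_unary 3 ;; read_unary 4 ;; read_unary 5 ;; read_unary 6 ;; read_unary 7 ;; decide"

lemma verifier_header:
  "verifier (concat (map unary_code [mx, nx, mu, nu, L]) @ W) X Y \<longleftrightarrow> checks mx nx mu nu L W X Y"
proof
  assume "verifier (concat (map unary_code [mx, nx, mu, nu, L]) @ W) X Y"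
  then obtain mx' nx' mu' nu' L' W' where "concat (map unary_code [mx, nx, mu, nu, L]) @ W =
      concat (map unary_code [mx', nx', mu', nu', L']) @ W'" "checks mx' nx' mu' nu' L' W' X Y"
    unfolding verifier_def by blast
  thus "checks mx nx mu nu L W X Y" by (auto dest!: unary_code_prefix)
qed (unfold verifier_def, blast)

lemma length_unary_code [simp]: "length (unary_code k) = Suc k"
  by (simp add: unary_code_def)

lemma wp_main:
  assumes m: "length I + length X + length Y + 3 \<le> m" "(m * m + 1) * (6 * m + 1) + 8 * m + 20 < N"
    and a: "a = verifier I X Y"
  shows "wp N a main (\<lambda>_. False) (input_state [I, X, Y])"
proof -
  let ?s = "input_state [I, X, Y]"
  have inp: "?s 0 = I" "?s 1 = X" "?s 2 = Y" "\<And>i. 3 \<le> i \<Longrightarrow> ?s i = []"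
    by (auto simp: input_state_def numeral_2_eq_2)
  have IN: "length I \<le> N" using m by simp
  have fail: "\<not> a" if "\<And>mx nx mu nu L W. I \<noteq> concat (map unary_code [mx, nx, mu, nu, L]) @ W"
    using that unfolding a verifier_def by blast
  show ?thesis unfolding main_def wp_simps(6)
  proof (rule wp_read_unary, goal_cases)
    case (4 mx w1)
    have I1: "I = unary_code mx @ w1" using 4 inp by simp
    have fail': "\<not> a" if "\<nexists>k w. w1 = unary_code k @ w"
      by (rule fail) (use that I1 in \<open>auto dest!: unary_code_prefix\<close>)
    show ?case
    proof (rule wp_read_unary, goal_cases)
      case (4 nx w2)
      have I2: "I = unary_code mx @ unary_code nx @ w2" using 4 I1 by simp
      have fail': "\<not> a" if "\<nexists>k w. w2 = unary_code k @ w"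
        by (rule fail) (use that I2 in \<open>auto dest!: unary_code_prefix\<close>)
      show ?case
      proof (rule wp_read_unary, goal_cases)
        case (4 mu w3)
        have I3: "I = unary_code mx @ unary_code nx @ unary_code mu @ w3" using 4 I2 by simp
        have fail': "\<not> a" if "\<nexists>k w. w3 = unary_code k @ w"
          by (rule fail) (use that I3 in \<open>auto dest!: unary_code_prefix\<close>)
        show ?case
        proof (rule wp_read_unary, goal_cases)
          case (4 nu w4)
          have I4: "I = unary_code mx @ unary_code nx @ unary_code mu @ unary_code nu @ w4" using 4 I3 by simp
          have fail': "\<not> a" if "\<nexists>k w. w4 = unary_code k @ w"
            by (rule fail) (use that I4 in \<open>auto dest!: unary_code_prefix\<close>)
          show ?case
          proof (rule wp_read_unary, goal_cases)
            case (4 L W)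
            have I5: "I = concat (map unary_code [mx, nx, mu, nu, L]) @ W" using 4 I4 by simp
            have a': "a = checks mx nx mu nu L W X Y" unfolding a I5 by (rule verifier_header)
            interpret verifier_run N m mx nx mu nu L W X Y a "?s(0 := w1, 3 := replicate mx True, 0 := w2, 4 := replicate nx True,
                0 := w3, 5 := replicate mu True, 0 := w4, 6 := replicate nu True, 0 := W, 7 := replicate L True)"
              by standard (use m a' inp I5 in auto)
            show ?case by (rule wp_decide) (simp_all add: inp)
          qed (use inp I4 IN fail' in auto)
        qed (use inp I3 IN fail' in auto)
      qed (use inp I2 IN fail' in auto)
    qed (use inp I1 IN fail' in auto)
  next
    case 5
    show ?case by (rule fail) (use 5 inp in auto)
  qed (use inp IN in auto)
qed

theorem verifier_poly_time: "poly_time_decidable 3 (\<lambda>ws. verifier (ws ! 0) (ws ! 1) (ws ! 2))"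
\<comment> \<open>The polynomial is the bound of \<open>wp_main\<close> with
  \<open>m = k + 3\<close> for total input length \<open>k\<close>; 21 in place of 20 makes the
  inequality strict. The summand 3 leaves room for the code of the number 1 in
  \<open>bound_row\<close>. The registers end at 33.\<close>
proof (rule program_poly_time_decidable[where c = main and K = 34 and p =
      "([:3, 1:] * [:3, 1:] + 1) * (6 * [:3, 1:] + 1) + 8 * [:3, 1:] + 21"])
  show "regs main \<subseteq> {..<34}"
    by (simp add: main_def decide_def read_unary_def repeat_def skip_many_def skip_rat_def read_rat_def
        read_nat_def read_bits_def copy_reg_def move_reg_def clear_reg_def bound_row_def form_row_def
        row_def entry_def mul_reg_def add_reg_def le_reg_def)
  fix ws :: "bool list list" assume "length ws = 3"
  then obtain I X Y where ws: "ws = [I, X, Y]"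
    by (auto simp: length_Suc_conv numeral_3_eq_3)
  let ?m = "length I + length X + length Y + 3"
  let ?N = "poly (([:3, 1:] * [:3, 1:] + 1) * (6 * [:3, 1:] + 1) + 8 * [:3, 1:] + 21 :: nat poly) (sum_list (map length ws))"
  have "poly (([:3, 1:] * [:3, 1:] + 1) * (6 * [:3, 1:] + 1) + 8 * [:3, 1:] + 21 :: nat poly) k =
      ((k + 3) * (k + 3) + 1) * (6 * (k + 3) + 1) + 8 * (k + 3) + 21" for k
    by (simp add: algebra_simps)
  moreover have "?m = sum_list (map length ws) + 3" by (simp add: ws)
  ultimately have "?N = (?m * ?m + 1) * (6 * ?m + 1) + 8 * ?m + 21" by (simp only:)
  hence "wp ?N (verifier I X Y) main (\<lambda>_. False) (input_state [I, X, Y])"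
    by (intro wp_main[where m = ?m]) auto
  thus "exec ?N main (input_state ws) = Halted (verifier (ws ! 0) (ws ! 1) (ws ! 2))"
    by (simp add: wp_def ws numeral_2_eq_2 split: outcome.splits)
qed simp


section \<open>Witnesses of polynomial size\<close>


subsection \<open>Small integer points of polyhedra\<close>

definition dot :: "nat \<Rightarrow> (nat \<Rightarrow> int) \<Rightarrow> (nat \<Rightarrow> int) \<Rightarrow> int" where
  "dot n c z = (\<Sum>i<n. c i * z i)"

definition rdot :: "nat \<Rightarrow> (nat \<Rightarrow> int) \<Rightarrow> (nat \<Rightarrow> real) \<Rightarrow> real" where
  "rdot n c z = (\<Sum>i<n. of_int (c i) * z i)"

lemma rdot_of_int: "rdot n c (\<lambda>i. of_int (z i)) = of_int (dot n c z)"
  by (simp add: rdot_def dot_def)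

lemma rdot_add: "rdot n c (\<lambda>i. x i + y i) = rdot n c x + rdot n c y"
  by (simp add: rdot_def distrib_left sum.distrib)

lemma rdot_scale: "rdot n c (\<lambda>i. r * x i) = r * rdot n c x"
  by (simp add: rdot_def sum_distrib_left ac_simps)

lemma rdot_sum: "rdot n c (\<lambda>i. \<Sum>v\<in>G. f v i) = (\<Sum>v\<in>G. rdot n c (f v))"
  unfolding rdot_def sum_distrib_left by (rule sum.swap)

lemma rdot_cong: "(\<And>i. i < n \<Longrightarrow> x i = y i) \<Longrightarrow> rdot n c x = rdot n c y"
  by (simp add: rdot_def)

lemma abs_dot_le:
  assumes "\<And>i. i < n \<Longrightarrow> \<bar>c i\<bar> \<le> A" "\<And>i. i < n \<Longrightarrow> \<bar>z i\<bar> \<le> B"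
  shows "\<bar>dot n c z\<bar> \<le> int n * (A * B)"
proof -
  have "\<bar>dot n c z\<bar> \<le> (\<Sum>i<n. \<bar>c i * z i\<bar>)" unfolding dot_def by (rule sum_abs)
  also have "\<dots> \<le> (\<Sum>i<n. A * B)"
    using assms by (intro sum_mono) (auto simp: abs_mult intro!: mult_mono order_trans[OF abs_ge_zero])
  finally show ?thesis by simp
qed

text \<open>Siegel's lemma, by the pigeonhole principle.\<close>

lemma small_kernel_vector:
  fixes cs :: "(nat \<Rightarrow> int) set" and M :: nat
  assumes "finite cs" "card cs < n" "\<And>c i. c \<in> cs \<Longrightarrow> i < n \<Longrightarrow> \<bar>c i\<bar> \<le> int M"
  shows "\<exists>w. (\<exists>i<n. w i \<noteq> 0) \<and> (\<forall>i<n. \<bar>w i\<bar> \<le> int ((2 * n * M + 1) ^ n)) \<and> (\<forall>c\<in>cs. dot n c w = 0)"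
proof -
  \<comment> \<open>A row maps the box of side \<open>0..B\<close> into an interval of at most
    \<open>q * (B + 1)\<close> integers. Fewer than \<open>n\<close> rows thus allow at most
    \<open>q ^ (n - 1) * (B + 1) ^ (n - 1)\<close> images, and \<open>B = q ^ n\<close> is large
    enough to make this less than the \<open>(B + 1) ^ n\<close> points of the box.\<close>
  define q where "q = 2 * n * M + 1"
  define B where "B = q ^ n"
  define D where "D = ({..<n} \<rightarrow>\<^sub>E {0..int B})"
  define E where "E = (cs \<rightarrow>\<^sub>E {- int (n * M * B)..int (n * M * B)})"
  define f where "f v = restrict (\<lambda>c. dot n c v) cs" for v
  have "card {0..int B} = B + 1" by simp
  hence cD: "card D = (B + 1) ^ n"
    unfolding D_def by (simp only: card_PiE finite_lessThan prod_constant card_lessThan)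
  have "card {- int k..int k} = 2 * k + 1" for k
  proof -
    have "int k + 1 - (- int k) = int (2 * k + 1)" by simp
    thus ?thesis by (simp only: card_atLeastAtMost_int nat_int)
  qed
  from this[of "n * M * B"] have "card {- int (n * M * B)..int (n * M * B)} = 2 * n * M * B + 1"
    by (simp only: mult.assoc)
  hence cE: "card E = (2 * n * M * B + 1) ^ card cs"
    unfolding E_def using assms(1) by (simp only: card_PiE prod_constant)
  have q1: "q \<ge> 1" by (simp add: q_def)
  have "2 * n * M * B + 1 \<le> q * (B + 1)" by (simp add: q_def algebra_simps)
  hence "card E \<le> (q * (B + 1)) ^ card cs" unfolding cE by (rule power_mono) simp
  also have "\<dots> \<le> (q * (B + 1)) ^ (n - 1)"
    using assms(2) q1 by (intro power_increasing) auto
  also have "\<dots> = q ^ (n - 1) * (B + 1) ^ (n - 1)" by (rule power_mult_distrib)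
  also have "\<dots> < (B + 1) * (B + 1) ^ (n - 1)"
  proof (rule mult_strict_right_mono)
    have "q ^ (n - 1) \<le> B" unfolding B_def using q1 by (intro power_increasing) auto
    thus "q ^ (n - 1) < B + 1" by simp
  qed simp
  also have "\<dots> = card D" unfolding cD using assms(2) by (cases n) auto
  finally have less: "card E < card D" .
  have sub: "f ` D \<subseteq> E"
  proof
    fix g assume "g \<in> f ` D"
    then obtain v where v: "v \<in> D" "g = f v" by blast
    have "dot n c v \<in> {- int (n * M * B)..int (n * M * B)}" if "c \<in> cs" for c
    proof -
      have "\<bar>dot n c v\<bar> \<le> int n * (int M * int B)"
        using v(1) assms(3)[OF that] by (intro abs_dot_le) (auto simp: D_def PiE_def Pi_def)
      thus ?thesis by (auto simp: mult.assoc)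
    qed
    thus "g \<in> E" unfolding v(2) f_def E_def by (auto intro!: restrict_PiE_iff[THEN iffD2])
  qed
  have finE: "finite E" unfolding E_def using assms(1) by (intro finite_PiE) auto
  have "\<not> inj_on f D"
    using card_mono[OF finE sub] card_image[of f D] less by auto
  then obtain v v' where v: "v \<in> D" "v' \<in> D" "v \<noteq> v'" "f v = f v'" unfolding inj_on_def by blast
  define w where "w i = v i - v' i" for i
  have "\<exists>i<n. w i \<noteq> 0"
  proof (rule ccontr)
    assume "\<not> (\<exists>i<n. w i \<noteq> 0)"
    hence "v = v'" using v(1,2) unfolding D_def by (intro PiE_ext[of v "{..<n}" _ v']) (auto simp: w_def)
    thus False using v(3) by contradiction
  qed
  moreover have "\<bar>w i\<bar> \<le> int B" if "i < n" for i
  proof -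
    have "v i \<in> {0..int B}" "v' i \<in> {0..int B}" using v(1,2) that by (auto simp: D_def PiE_def Pi_def)
    thus ?thesis by (auto simp: w_def)
  qed
  moreover have "dot n c w = 0" if "c \<in> cs" for c
  proof -
    have "dot n c v = dot n c v'" using fun_cong[OF v(4), of c] that by (simp add: f_def)
    thus ?thesis by (simp add: dot_def w_def right_diff_distrib sum_subtractf)
  qed
  ultimately show ?thesis unfolding B_def q_def by blast
qed

section \<open>Extreme rays and generators of pointed cones\<close>

lemma dependent_vectors:
  fixes w :: "nat \<Rightarrow> nat \<Rightarrow> real"
  shows "\<exists>\<alpha>. (\<exists>j\<le>n. \<alpha> j \<noteq> 0) \<and> (\<forall>i<n. (\<Sum>j\<le>n. \<alpha> j * w j i) = 0)"
proof -
  \<comment> \<open>The vectors become the columns of a square matrix whose last row is zero; a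
    kernel vector of this singular matrix gives the coefficients.\<close>
  define A where "A = mat (Suc n) (Suc n) (\<lambda>(i, j). if i < n then w j i else 0)"
  have A: "A \<in> carrier_mat (Suc n) (Suc n)" by (simp add: A_def)
  have "det A = (\<Sum>j<Suc n. A $$ (n, j) * cofactor A n j)"
    by (rule laplace_expansion_row[OF A]) simp
  also have "\<dots> = 0" by (intro sum.neutral) (auto simp: A_def)
  finally obtain v where v: "v \<in> carrier_vec (Suc n)" "v \<noteq> 0\<^sub>v (Suc n)" "A *\<^sub>v v = 0\<^sub>v (Suc n)"
    using det_0_iff_vec_prod_zero[OF A] by auto
  have "(\<Sum>j\<le>n. v $ j * w j i) = 0" if "i < n" for i
  proof -
    have "(A *\<^sub>v v) $ i = 0" using v(3) that by simp
    moreover have "(A *\<^sub>v v) $ i = (\<Sum>j<Suc n. w j i * v $ j)"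
      using that v(1) by (simp add: A_def scalar_prod_def atLeast0LessThan del: sum.lessThan_Suc)
    ultimately show ?thesis by (simp add: lessThan_Suc_atMost mult.commute del: sum.lessThan_Suc)
  qed
  moreover have "\<exists>j\<le>n. v $ j \<noteq> 0"
  proof (rule ccontr)
    assume "\<not> (\<exists>j\<le>n. v $ j \<noteq> 0)"
    hence "v = 0\<^sub>v (Suc n)" using v(1) by (intro eq_vecI) auto
    thus False using v(2) by contradiction
  qed
  ultimately show ?thesis by (intro exI[of _ "\<lambda>j. v $ j"]) blast
qed

text \<open>The rows have a one-dimensional kernel, hence rank \<open>n - 1\<close>, and Siegel's
  lemma asks for fewer rows than columns. In a minimal equivalent set each row \<open>c\<close> has
  a vector \<open>w c\<close> on which it alone does not vanish; \<open>n\<close> such vectors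
  together with \<open>v\<close> would be independent in dimension \<open>n\<close>.\<close>

lemma few_rows_suffice:
  fixes T :: "(nat \<Rightarrow> int) set" and v :: "nat \<Rightarrow> real"
  assumes fin: "finite T" and v: "i0 < n" "v i0 \<noteq> 0" "\<And>c. c \<in> T \<Longrightarrow> rdot n c v = 0"
    and ker: "\<And>z. (\<forall>c\<in>T. rdot n c z = 0) \<Longrightarrow> \<exists>\<mu>. \<forall>i<n. z i = \<mu> * v i"
  shows "\<exists>T'\<subseteq>T. card T' < n \<and> (\<forall>z. (\<forall>c\<in>T'. rdot n c z = 0) \<longrightarrow> (\<forall>c\<in>T. rdot n c z = 0))"
proof -
  define G where "G T' \<longleftrightarrow> T' \<subseteq> T \<and> (\<forall>z. (\<forall>c\<in>T'. rdot n c z = 0) \<longrightarrow> (\<forall>c\<in>T. rdot n c z = 0))" for T'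
  have "G T" by (simp add: G_def)
  then obtain T' where T': "G T'" and min: "\<And>T''. G T'' \<Longrightarrow> card T' \<le> card T''"
    using ex_has_least_nat[of G T card] by blast
  have fin': "finite T'" using T' fin by (auto simp: G_def intro: finite_subset)
  have "\<exists>z. (\<forall>c'\<in>T' - {c}. rdot n c' z = 0) \<and> rdot n c z \<noteq> 0" if "c \<in> T'" for c
  proof (rule ccontr)
    assume no: "\<nexists>z. (\<forall>c'\<in>T' - {c}. rdot n c' z = 0) \<and> rdot n c z \<noteq> 0"
    have "\<forall>c'\<in>T'. rdot n c' z = 0" if "\<forall>c'\<in>T' - {c}. rdot n c' z = 0" for z
      using no that by (cases "rdot n c z = 0") auto
    hence "G (T' - {c})" using T' unfolding G_def by blast
    hence "card T' \<le> card (T' - {c})" by (rule min)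
    thus False using that fin' by (metis card_Diff1_less not_le)
  qed
  then obtain w where w: "\<And>c c'. c \<in> T' \<Longrightarrow> c' \<in> T' \<Longrightarrow> c' \<noteq> c \<Longrightarrow> rdot n c' (w c) = 0"
    "\<And>c. c \<in> T' \<Longrightarrow> rdot n c (w c) \<noteq> 0"
    by (metis DiffI singletonD)
  have "card T' < n"
  proof (rule ccontr)
    assume "\<not> card T' < n"
    then obtain T2 where T2: "T2 \<subseteq> T'" "card T2 = n" "finite T2"
      by (meson not_less obtain_subset_with_card_n)
    then obtain h where h: "bij_betw h {..<n} T2"
      using ex_bij_betw_nat_finite[of T2] by (auto simp: atLeast0LessThan)
    define u where "u j = (if j < n then w (h j) else v)" for j
    obtain \<alpha> where \<alpha>: "\<exists>j\<le>n. \<alpha> j \<noteq> 0" "\<And>i. i < n \<Longrightarrow> (\<Sum>j\<le>n. \<alpha> j * u j i) = 0"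
      using dependent_vectors[of n u] by blast
    have hT: "h j \<in> T'" if "j < n" for j using h that T2(1) by (auto simp: bij_betw_def)
    have hinj: "h j = h j' \<longleftrightarrow> j = j'" if "j < n" "j' < n" for j j'
      using h that by (auto simp: bij_betw_def inj_on_def)
    \<comment> \<open>The row \<open>h k\<close> vanishes on all vectors of the relation except
      \<open>w (h k)\<close> and so isolates its coefficient. What remains of the relation is a
      multiple of the nonzero \<open>v\<close>.\<close>
    have zero: "\<alpha> k = 0" if k: "k < n" for k
    proof -
      have "0 = rdot n (h k) (\<lambda>i. \<Sum>j\<le>n. \<alpha> j * u j i)"
        using \<alpha>(2) by (simp add: rdot_def)
      also have "\<dots> = (\<Sum>j\<le>n. \<alpha> j * rdot n (h k) (u j))" by (simp only: rdot_sum rdot_scale)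
      also have "\<dots> = (\<Sum>j\<le>n. if j = k then \<alpha> k * rdot n (h k) (w (h k)) else 0)"
      proof (rule sum.cong[OF refl])
        fix j assume "j \<in> {..n}"
        have "h k \<in> T" using hT[OF k] T' by (auto simp: G_def)
        thus "\<alpha> j * rdot n (h k) (u j) = (if j = k then \<alpha> k * rdot n (h k) (w (h k)) else 0)"
          using w(1)[of "h j" "h k"] hT k hinj[of j k] v(3) by (auto simp: u_def)
      qed
      also have "\<dots> = \<alpha> k * rdot n (h k) (w (h k))" using k by simp
      finally show ?thesis using w(2)[OF hT[OF k]] by simp
    qed
    have "0 = (\<Sum>j\<le>n. \<alpha> j * u j i0)" using \<alpha>(2)[OF v(1)] by simp
    also have "\<dots> = \<alpha> n * v i0"
    proof -
      have "(\<Sum>j\<le>n. \<alpha> j * u j i0) = (\<Sum>j\<le>n. if j = n then \<alpha> n * v i0 else 0)"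
        by (rule sum.cong[OF refl]) (use zero in \<open>auto simp: u_def\<close>)
      thus ?thesis by simp
    qed
    finally have "\<alpha> n = 0" using v(2) by simp
    thus False using zero \<alpha>(1) by (metis le_neq_implies_less)
  qed
  thus ?thesis using T' unfolding G_def by blast
qed

text \<open>The unit rows place the cone in the nonnegative orthant, so it contains no line and its
  extreme rays generate it.\<close>

locale pointed_cone =
  fixes n :: nat and C :: "(nat \<Rightarrow> int) set" and M :: nat
  assumes finite_C: "finite C"
    and entries: "\<And>c i. c \<in> C \<Longrightarrow> i < n \<Longrightarrow> \<bar>c i\<bar> \<le> int M"
    and units: "\<And>k. k < n \<Longrightarrow> (\<lambda>i. if i = k then 1 else 0) \<in> C"
begin

definition R :: nat where "R = (2 * n * M + 1) ^ n"

definition K :: "(nat \<Rightarrow> real) \<Rightarrow> bool" where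
  "K z \<longleftrightarrow> (\<forall>c\<in>C. 0 \<le> rdot n c z)"

definition tight :: "(nat \<Rightarrow> real) \<Rightarrow> (nat \<Rightarrow> int) set" where
  "tight z = {c \<in> C. rdot n c z = 0}"

text \<open>All small integer points of the cone rather than only extreme rays: for conic
  combinations the larger set is as good, and its size is bounded by counting a box. Vanishing
  beyond \<open>n\<close> makes a vector determined by its first \<open>n\<close>
  coordinates.\<close>

definition gens :: "(nat \<Rightarrow> int) set" where
  "gens = {v. (\<forall>i<n. 0 \<le> v i \<and> v i \<le> int R) \<and> (\<forall>i\<ge>n. v i = 0) \<and> K (\<lambda>i. of_int (v i))}"

lemma rdot_unit: "k < n \<Longrightarrow> rdot n (\<lambda>i. if i = k then 1 else 0) z = z k"
proof -
  assume "k < n"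
  hence "(\<Sum>i<n. (if i = k then 1 else 0) * z i) = z k"
    by (subst sum.cong[OF refl, of _ _ "\<lambda>i. if i = k then z i else 0"]) auto
  moreover have "real_of_int (if i = k then 1 else 0) = (if i = k then 1 else 0)" for i by simp
  ultimately show ?thesis by (simp only: rdot_def)
qed

lemma K_nonneg: "K z \<Longrightarrow> k < n \<Longrightarrow> 0 \<le> z k"
  using units[of k] rdot_unit[of k z] unfolding K_def by metis

lemma finite_gens: "finite gens" and card_gens: "card gens \<le> (R + 1) ^ n"
proof -
  have sub: "(\<lambda>v. restrict v {..<n}) ` gens \<subseteq> ({..<n} \<rightarrow>\<^sub>E {0..int R})"
    by (rule image_subsetI) (auto simp: gens_def restrict_PiE_iff)
  have inj: "inj_on (\<lambda>v. restrict v {..<n}) gens"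
  proof (rule inj_onI)
    fix v w assume v: "v \<in> gens" "w \<in> gens" "restrict v {..<n} = restrict w {..<n}"
    show "v = w"
    proof
      fix i
      have "restrict v {..<n} i = restrict w {..<n} i" by (simp only: v(3))
      thus "v i = w i" using v(1,2) by (cases "i < n") (simp_all add: gens_def)
    qed
  qed
  have fin: "finite ({..<n} \<rightarrow>\<^sub>E {0..int R})" by (intro finite_PiE) auto
  show "finite gens" using finite_imageD[OF finite_subset[OF sub fin] inj] .
  have "card gens \<le> card ({..<n} \<rightarrow>\<^sub>E {0..int R})"
    using card_mono[OF fin sub] card_image[OF inj] by simp
  moreover have "card {0..int R} = R + 1" by simp
  ultimately show "card gens \<le> (R + 1) ^ n"
    by (simp only: card_PiE finite_lessThan prod_constant card_lessThan)
qed

text \<open>A nonzero point of the cone with an inclusion-maximal set of tight constraints spans an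
  extreme ray.\<close>

lemma extreme_ray:
  assumes y: "K y" "k0 < n" "y k0 \<noteq> 0"
  shows "\<exists>v\<in>gens. (\<exists>i<n. v i \<noteq> 0) \<and> tight y \<subseteq> tight (\<lambda>i. of_int (v i))"
proof -
  define G where "G z \<longleftrightarrow> K z \<and> (\<exists>i<n. z i \<noteq> 0) \<and> tight y \<subseteq> tight z" for z
  have "G y" using y by (auto simp: G_def)
  moreover have "\<forall>z. G z \<longrightarrow> card (tight z) \<le> card C"
    using finite_C by (auto simp: tight_def intro!: card_mono)
  ultimately obtain x where x: "G x" and max: "\<And>z. G z \<Longrightarrow> card (tight z) \<le> card (tight x)"
    using ex_has_greatest_nat[of G y "\<lambda>z. card (tight z)" "card C + 1"] by (metis less_Suc_eq_le Suc_eq_plus1)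
  obtain i0 where i0: "i0 < n" "x i0 \<noteq> 0" using x by (auto simp: G_def)
  have Kx: "\<And>c. c \<in> C \<Longrightarrow> 0 \<le> rdot n c x" using x by (auto simp: G_def K_def)
  have fin: "finite (tight x)" using finite_C by (simp add: tight_def)
  \<comment> \<open>Otherwise one moves from \<open>x\<close> in direction \<open>w\<close> until a
    further constraint becomes tight. The constraints tight at \<open>x\<close> stay tight,
    contradicting maximality; the new point is nonzero since \<open>w\<close> is not a multiple of
    \<open>x\<close>.\<close>
  have pos: "0 \<le> rdot n c w" if w: "\<forall>c\<in>tight x. rdot n c w = 0" "\<nexists>\<mu>. \<forall>i<n. w i = \<mu> * x i" and "c \<in> C" for w c
  proof (rule ccontr)
    assume "\<not> 0 \<le> rdot n c w"
    define N where "N = {c \<in> C. rdot n c w < 0}"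
    have N: "finite N" "N \<noteq> {}" using finite_C \<open>\<not> 0 \<le> rdot n c w\<close> \<open>c \<in> C\<close> by (auto simp: N_def)
    \<comment> \<open>The step length at which constraint \<open>c\<close> becomes tight; the least
      one is taken, so that no constraint is violated.\<close>
    define g where "g c = rdot n c x / (- rdot n c w)" for c
    obtain c0 where c0: "c0 \<in> N" "\<And>c. c \<in> N \<Longrightarrow> g c0 \<le> g c"
      using N by (metis arg_min_if_finite(1) arg_min_least)
    define z where "z i = x i + g c0 * w i" for i
    have dz: "rdot n c z = rdot n c x + g c0 * rdot n c w" for c
      unfolding z_def by (simp only: rdot_add rdot_scale)
    have g0: "0 \<le> g c0" using c0(1) Kx[of c0] by (auto simp: g_def N_def intro: divide_nonneg_neg)
    have "0 \<le> rdot n c z" if "c \<in> C" for c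
    proof (cases "c \<in> N")
      case True
      hence "rdot n c w < 0" by (simp add: N_def)
      thus ?thesis using c0(2)[OF True] unfolding dz g_def[of c] by (simp add: field_simps)
    next
      case False
      thus ?thesis using that Kx[OF that] g0 unfolding dz by (auto simp: N_def)
    qed
    hence "K z" by (simp add: K_def)
    moreover have "\<exists>i<n. z i \<noteq> 0"
    proof (rule ccontr)
      assume no: "\<not> (\<exists>i<n. z i \<noteq> 0)"
      hence "g c0 \<noteq> 0" using i0 by (auto simp: z_def)
      hence "\<forall>i<n. w i = (- 1 / g c0) * x i" using no by (auto simp: z_def field_simps)
      thus False using w(2) by blast
    qed
    moreover have sub: "tight x \<subseteq> tight z" using w(1) by (auto simp: tight_def dz)
    moreover have "tight y \<subseteq> tight x" using x by (simp add: G_def)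
    ultimately have "G z" by (auto simp: G_def)
    have "rdot n c0 w \<noteq> 0" using c0(1) by (simp add: N_def)
    hence "c0 \<in> tight z" "c0 \<notin> tight x" using c0(1) w(1) by (auto simp: tight_def N_def dz g_def)
    hence "tight x \<subset> tight z" using sub by blast
    hence "card (tight x) < card (tight z)"
      using finite_C by (intro psubset_card_mono) (auto simp: tight_def)
    thus False using max[OF \<open>G z\<close>] by simp
  qed
  \<comment> \<open>If \<open>z\<close> is not a multiple of \<open>x\<close>, then
    \<open>pos\<close> applies to \<open>z\<close> and to its negative. So every constraint vanishes
    on \<open>z\<close>, in particular the unit rows, and \<open>z\<close> is the zero multiple of
    \<open>x\<close> after all.\<close>
  have ker: "\<exists>\<mu>. \<forall>i<n. z i = \<mu> * x i" if z: "\<forall>c\<in>tight x. rdot n c z = 0" for z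
  proof (rule ccontr)
    assume no: "\<nexists>\<mu>. \<forall>i<n. z i = \<mu> * x i"
    have "rdot n c (\<lambda>i. (-1) * z i) = 0" if "c \<in> tight x" for c
      using z that unfolding rdot_scale by simp
    moreover have "\<nexists>\<mu>. \<forall>i<n. (-1) * z i = \<mu> * x i"
    proof
      assume "\<exists>\<mu>. \<forall>i<n. (-1) * z i = \<mu> * x i"
      then obtain \<mu> where "\<forall>i<n. (-1) * z i = \<mu> * x i" by blast
      hence "\<forall>i<n. z i = (- \<mu>) * x i" by (auto simp: minus_equation_iff)
      thus False using no by blast
    qed
    ultimately have "0 \<le> rdot n c (\<lambda>i. (-1) * z i)" if "c \<in> C" for c using pos that by blast
    hence "rdot n c z \<le> 0" if "c \<in> C" for c using that unfolding rdot_scale by force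
    moreover have "0 \<le> rdot n c z" if "c \<in> C" for c using pos[OF z no that] .
    ultimately have "rdot n c z = 0" if "c \<in> C" for c using that by force
    hence "z i = 0" if "i < n" for i using units[OF that] rdot_unit[OF that] that by metis
    hence "\<forall>i<n. z i = 0 * x i" by simp
    thus False using no by blast
  qed
  have "\<exists>T\<subseteq>tight x. card T < n \<and> (\<forall>z. (\<forall>c\<in>T. rdot n c z = 0) \<longrightarrow> (\<forall>c\<in>tight x. rdot n c z = 0))"
    by (rule few_rows_suffice[OF fin i0 _ ker]) (simp_all add: tight_def)
  then obtain T where T: "T \<subseteq> tight x" "card T < n" "\<And>z. (\<forall>c\<in>T. rdot n c z = 0) \<Longrightarrow> (\<forall>c\<in>tight x. rdot n c z = 0)"
    by blast
  have "\<exists>w. (\<exists>i<n. w i \<noteq> 0) \<and> (\<forall>i<n. \<bar>w i\<bar> \<le> int R) \<and> (\<forall>c\<in>T. dot n c w = 0)"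
    unfolding R_def
  proof (rule small_kernel_vector)
    show "finite T" by (rule finite_subset[OF T(1) fin])
    show "\<bar>c i\<bar> \<le> int M" if "c \<in> T" "i < n" for c i
      using that T(1) entries by (auto simp: tight_def)
  qed (rule T(2))
  then obtain w where w: "\<exists>i<n. w i \<noteq> 0" "\<And>i. i < n \<Longrightarrow> \<bar>w i\<bar> \<le> int R" "\<And>c. c \<in> T \<Longrightarrow> dot n c w = 0"
    by blast
  have "\<forall>c\<in>tight x. rdot n c (\<lambda>i. of_int (w i)) = 0"
    by (rule T(3)) (simp add: rdot_of_int w(3))
  then obtain \<mu> where \<mu>: "\<And>i. i < n \<Longrightarrow> of_int (w i) = \<mu> * x i" using ker by meson
  have \<mu>0: "\<mu> \<noteq> 0" using w(1) \<mu> by auto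
  \<comment> \<open>On the first \<open>n\<close> coordinates \<open>w\<close> is a multiple of the
    nonnegative \<open>x\<close>, so taking absolute values merely makes the factor
    positive.\<close>
  define v where "v i = (if i < n then \<bar>w i\<bar> else 0)" for i
  have vx: "of_int (v i) = \<bar>\<mu>\<bar> * x i" if "i < n" for i
  proof -
    have "real_of_int (v i) = \<bar>real_of_int (w i)\<bar>" using that by (simp add: v_def)
    also have "\<dots> = \<bar>\<mu>\<bar> * x i" using \<mu>[OF that] K_nonneg[of x i] x that by (simp add: G_def abs_mult)
    finally show ?thesis .
  qed
  have dv: "rdot n c (\<lambda>i. of_int (v i)) = \<bar>\<mu>\<bar> * rdot n c x" for c
    using rdot_cong[of n "\<lambda>i. of_int (v i)" "\<lambda>i. \<bar>\<mu>\<bar> * x i" c] vx rdot_scale by simp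
  have "K (\<lambda>i. of_int (v i))" using Kx unfolding K_def dv by simp
  hence "v \<in> gens" using w(2) by (simp add: gens_def v_def)
  moreover have "\<exists>i<n. v i \<noteq> 0" using w(1) by (auto simp: v_def)
  moreover have "tight y \<subseteq> tight (\<lambda>i. of_int (v i))"
    using x unfolding G_def by (auto simp: tight_def dv)
  ultimately show ?thesis by blast
qed

text \<open>Subtract from \<open>y\<close> the largest multiple of a generator from
  \<open>extreme_ray\<close> that stays in the cone. The tight constraints of \<open>y\<close>
  remain tight and one more becomes tight, so the number of slack constraints decreases.\<close>

lemma conic_combination:
  assumes "K y"
  shows "\<exists>l. (\<forall>v\<in>gens. 0 \<le> l v) \<and> (\<forall>i<n. y i = (\<Sum>v\<in>gens. l v * of_int (v i)))"
  using assms
proof (induction "card (C - tight y)" arbitrary: y rule: less_induct)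
  case less
  show ?case
  proof (cases "\<exists>i<n. y i \<noteq> 0")
    case False
    thus ?thesis by (intro exI[of _ "\<lambda>_. 0"]) simp
  next
    case True
    then obtain v k where v: "v \<in> gens" "k < n" "v k \<noteq> 0" "tight y \<subseteq> tight (\<lambda>i. of_int (v i))"
      using extreme_ray[OF less.prems] by blast
    let ?v = "\<lambda>i. real_of_int (v i)"
    have Kv: "\<And>c. c \<in> C \<Longrightarrow> 0 \<le> rdot n c ?v" using v(1) by (auto simp: gens_def K_def)
    have Ky: "\<And>c. c \<in> C \<Longrightarrow> 0 \<le> rdot n c y" using less.prems by (auto simp: K_def)
    define P where "P = {c \<in> C. 0 < rdot n c ?v}"
    \<comment> \<open>A unit row is positive on \<open>v\<close>, so the multiple that can be
      subtracted is bounded.\<close>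
    have "0 < rdot n (\<lambda>i. if i = k then 1 else 0) ?v"
      using v(1-3) unfolding rdot_unit[OF v(2)] by (simp add: gens_def order.strict_iff_order)
    hence P: "finite P" "P \<noteq> {}" using finite_C units[OF v(2)] by (auto simp: P_def)
    define g where "g c = rdot n c y / rdot n c ?v" for c
    obtain c0 where c0: "c0 \<in> P" "\<And>c. c \<in> P \<Longrightarrow> g c0 \<le> g c"
      using P by (metis arg_min_if_finite(1) arg_min_least)
    have g0: "0 \<le> g c0" using c0(1) Ky by (auto simp: g_def P_def)
    define z where "z i = y i + (- g c0) * ?v i" for i
    have dz: "rdot n c z = rdot n c y + (- g c0) * rdot n c ?v" for c
      unfolding z_def by (simp only: rdot_add rdot_scale)
    have "0 \<le> rdot n c z" if "c \<in> C" for c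
    proof (cases "c \<in> P")
      case True
      thus ?thesis using c0(2)[OF True] unfolding dz g_def[of c] by (simp add: P_def field_simps)
    next
      case False
      hence "rdot n c ?v = 0" using that Kv[OF that] by (auto simp: P_def)
      thus ?thesis using that Ky[OF that] unfolding dz by simp
    qed
    hence Kz: "K z" by (simp add: K_def)
    have "tight y \<subseteq> tight z" using v(4) by (auto simp: tight_def dz)
    moreover have "c0 \<in> tight z" "c0 \<notin> tight y"
      using c0(1) v(4) by (auto simp: tight_def P_def dz g_def)
    ultimately have "C - tight z \<subset> C - tight y" using c0(1) by (auto simp: P_def)
    hence "card (C - tight z) < card (C - tight y)" using finite_C by (intro psubset_card_mono) auto
    from less.hyps[OF this Kz] obtain l where l: "\<forall>v\<in>gens. 0 \<le> l v"
      "\<And>i. i < n \<Longrightarrow> z i = (\<Sum>v\<in>gens. l v * of_int (v i))" by blast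
    define l' where "l' u = l u + (if u = v then g c0 else 0)" for u
    have "y i = (\<Sum>u\<in>gens. l' u * of_int (u i))" if "i < n" for i
    proof -
      have "(\<Sum>u\<in>gens. l' u * of_int (u i)) = z i + (\<Sum>u\<in>gens. if u = v then g c0 * of_int (v i) else 0)"
        unfolding l(2)[OF that] l'_def sum.distrib[symmetric] by (intro sum.cong) (auto simp: algebra_simps)
      thus ?thesis using v(1) finite_gens by (simp add: z_def)
    qed
    moreover have "\<forall>u\<in>gens. 0 \<le> l' u" using l(1) g0 by (simp add: l'_def)
    ultimately show ?thesis by blast
  qed
qed

end

section \<open>Homogenisation and integer decomposition\<close>

definition ray_bound :: "nat \<Rightarrow> nat \<Rightarrow> nat" where
  "ray_bound n M = (2 * Suc n * M + 1) ^ Suc n"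

text \<open>A sum over at most \<open>(R + 1) ^ (n + 1)\<close> generators in dimension
  \<open>n + 1\<close>, where \<open>R = ray_bound n M\<close> bounds their entries and all
  coefficients are at most 1.\<close>

definition point_bound :: "nat \<Rightarrow> nat \<Rightarrow> nat" where
  "point_bound n M = (ray_bound n M + 1) ^ Suc n * ray_bound n M"

lemma dot_add_mult: "dot n c (\<lambda>i. x i + r * y i) = dot n c x + r * dot n c y"
  by (simp add: dot_def distrib_left sum.distrib sum_distrib_left ac_simps)

text \<open>Homogenise the polyhedron to a cone in one more dimension, write the point as a conic
  combination of small generators and split off the integer parts of the coefficients of the
  recession directions.\<close>

theorem polyhedron_decomposition:
  fixes Cons :: "((nat \<Rightarrow> int) \<times> int) set" and M :: nat
  assumes fin: "finite Cons" and M: "1 \<le> M"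
    and entries: "\<And>c d i. (c, d) \<in> Cons \<Longrightarrow> i < n \<Longrightarrow> \<bar>c i\<bar> \<le> int M"
      "\<And>c d. (c, d) \<in> Cons \<Longrightarrow> \<bar>d\<bar> \<le> int M"
    and z: "\<And>i. i < n \<Longrightarrow> 0 \<le> z i" "\<And>c d. (c, d) \<in> Cons \<Longrightarrow> dot n c z \<le> d"
  shows "\<exists>z0 G k. finite G \<and> (\<forall>i<n. 0 \<le> z0 i \<and> z0 i \<le> int (point_bound n M)) \<and>
     (\<forall>(c, d)\<in>Cons. dot n c z0 \<le> d) \<and>
     (\<forall>r\<in>G. (\<forall>i<n. 0 \<le> r i \<and> r i \<le> int (point_bound n M)) \<and> (\<forall>(c, d)\<in>Cons. dot n c r \<le> 0) \<and> 0 \<le> k r) \<and>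
     (\<forall>i<n. z i = z0 i + (\<Sum>r\<in>G. k r * r i))"
proof -
  \<comment> \<open>Coordinate \<open>n\<close> is the homogenising one: the constraint with row
    \<open>c\<close> and right-hand side \<open>d\<close> becomes the row (-c, d), so that points of
    the polyhedron sit at height 1 and recession directions at height 0.\<close>
  define hom where "hom cd i = (if i < n then - fst cd i else snd cd)" for cd :: "(nat \<Rightarrow> int) \<times> int" and i
  define C where "C = hom ` Cons \<union> (\<lambda>k i. if i = k then 1 else 0) ` {..<Suc n}"
  interpret pointed_cone "Suc n" C M
  proof
    show "finite C" using fin by (simp add: C_def)
    show "\<bar>c i\<bar> \<le> int M" if "c \<in> C" "i < Suc n" for c i
      using that entries M by (auto simp: C_def hom_def split: if_splits)
  qed (auto simp: C_def)
  have RS: "R = ray_bound n M" by (simp add: R_def ray_bound_def)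
  have hom_dot: "rdot (Suc n) (hom (c, d)) y = of_int d * y n - rdot n c y" for c d y
  proof -
    have "rdot (Suc n) (hom (c, d)) y = (\<Sum>i<n. - (of_int (c i) * y i)) + of_int d * y n"
      unfolding rdot_def by (simp add: hom_def)
    thus ?thesis by (simp add: rdot_def sum_negf)
  qed
  have K_iff: "K y \<longleftrightarrow> (\<forall>i\<le>n. 0 \<le> y i) \<and> (\<forall>(c, d)\<in>Cons. rdot n c y \<le> of_int d * y n)" for y
  proof
    assume K: "K y"
    show "(\<forall>i\<le>n. 0 \<le> y i) \<and> (\<forall>(c, d)\<in>Cons. rdot n c y \<le> of_int d * y n)"
    proof (intro conjI allI impI ballI)
      show "0 \<le> y i" if "i \<le> n" for i using K_nonneg[OF K] that by simp
      show "case cd of (c, d) \<Rightarrow> rdot n c y \<le> of_int d * y n" if "cd \<in> Cons" for cd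
      proof (cases cd)
        case (Pair c d)
        have "hom (c, d) \<in> C" using that Pair by (auto simp: C_def)
        hence "0 \<le> rdot (Suc n) (hom (c, d)) y" using K by (simp add: K_def)
        thus ?thesis using Pair by (simp add: hom_dot)
      qed
    qed
  next
    assume a: "(\<forall>i\<le>n. 0 \<le> y i) \<and> (\<forall>(c, d)\<in>Cons. rdot n c y \<le> of_int d * y n)"
    show "K y" unfolding K_def
    proof
      fix c' assume "c' \<in> C"
      then consider k where "k < Suc n" "c' = (\<lambda>i. if i = k then 1 else 0)" | c d where "(c, d) \<in> Cons" "c' = hom (c, d)"
        unfolding C_def by (auto simp: image_iff)
      thus "0 \<le> rdot (Suc n) c' y"
        using a by cases (auto simp: rdot_unit hom_dot)
    qed
  qed
  define y where "y i = (if i < n then real_of_int (z i) else 1)" for i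
  have ydot: "rdot n c y = of_int (dot n c z)" for c
    using rdot_cong[of n y "\<lambda>i. of_int (z i)" c] by (simp add: y_def rdot_of_int)
  have "K y" unfolding K_iff ydot using z by (auto simp: y_def)
  then obtain l where l: "\<And>v. v \<in> gens \<Longrightarrow> 0 \<le> l v" "\<And>i. i < Suc n \<Longrightarrow> y i = (\<Sum>v\<in>gens. l v * of_int (v i))"
    using conic_combination by blast
  define k where "k v = \<lfloor>l v\<rfloor>" for v
  define G where "G = {v \<in> gens. v n = 0}"
  define m where "m v = (if v n = 0 then l v - of_int (k v) else l v)" for v :: "nat \<Rightarrow> int"
  \<comment> \<open>Only integer multiples of integer directions are removed, so \<open>z0\<close>
    is integral although the coefficients \<open>m\<close> that represent it are real.\<close>
  define z0 where "z0 i = z i - (\<Sum>r\<in>G. k r * r i)" for i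
  define y0 where "y0 i = (if i < n then real_of_int (z0 i) else 1)" for i
  have finG: "finite G" using finite_gens by (simp add: G_def)
  have sumG: "(\<Sum>r\<in>G. f r) = (\<Sum>v\<in>gens. if v n = 0 then f v else 0)" for f :: "(nat \<Rightarrow> int) \<Rightarrow> real"
    unfolding G_def using finite_gens by (simp add: sum.inter_filter)
  have y0: "y0 i = (\<Sum>v\<in>gens. m v * of_int (v i))" if "i < Suc n" for i
  proof -
    have "y0 i = y i - (\<Sum>r\<in>G. of_int (k r) * of_int (r i))"
    proof (cases "i < n")
      case False
      hence "i = n" using that by simp
      thus ?thesis by (simp add: y0_def y_def G_def)
    qed (simp add: y0_def y_def z0_def)
    also have "\<dots> = (\<Sum>v\<in>gens. l v * of_int (v i) - (if v n = 0 then of_int (k v) * of_int (v i) else 0))"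
      unfolding sumG l(2)[OF that] sum_subtractf ..
    also have "\<dots> = (\<Sum>v\<in>gens. m v * of_int (v i))"
      by (intro sum.cong) (auto simp: m_def algebra_simps)
    finally show ?thesis .
  qed
  have gens_n: "0 \<le> v n" if "v \<in> gens" for v using that by (simp add: gens_def)
  have m0: "0 \<le> m v" if "v \<in> gens" for v
    using l(1)[OF that] by (simp add: m_def k_def)
  \<comment> \<open>A direction keeps the fractional part of its coefficient. A generator of
    positive integer height \<open>v n\<close> has a coefficient at most 1, because the weighted
    heights add up to the height 1 of \<open>y\<close>.\<close>
  have m1: "m v \<le> 1" if v: "v \<in> gens" for v
  proof (cases "v n = 0")
    case True
    have "l v - of_int \<lfloor>l v\<rfloor> < 1" by linarith
    thus ?thesis using True by (simp add: m_def k_def)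
  next
    case False
    hence vn: "1 \<le> real_of_int (v n)" using gens_n[OF v] by linarith
    have "l v \<le> l v * of_int (v n)" using l(1)[OF v] vn by (simp add: mult_le_cancel_left1)
    also have "\<dots> \<le> (\<Sum>v\<in>gens. l v * of_int (v n))"
      using finite_gens v l(1) gens_n by (intro member_le_sum) auto
    also have "\<dots> = 1" using l(2)[of n] by (simp add: y_def)
    finally show ?thesis using False by (simp add: m_def)
  qed
  have Ky0: "K y0"
    unfolding K_def
  proof
    fix c assume c: "c \<in> C"
    have "rdot (Suc n) c y0 = rdot (Suc n) c (\<lambda>i. \<Sum>v\<in>gens. m v * of_int (v i))"
      by (rule rdot_cong) (rule y0)
    also have "\<dots> = (\<Sum>v\<in>gens. m v * rdot (Suc n) c (\<lambda>i. of_int (v i)))" by (simp only: rdot_sum rdot_scale)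
    also have "0 \<le> \<dots>" using c m0 by (intro sum_nonneg mult_nonneg_nonneg) (auto simp: gens_def K_def)
    finally show "0 \<le> rdot (Suc n) c y0" .
  qed
  have y0dot: "rdot n c y0 = of_int (dot n c z0)" for c
    using rdot_cong[of n y0 "\<lambda>i. of_int (z0 i)" c] by (simp add: y0_def rdot_of_int)
  have z0_sat: "0 \<le> z0 i" if "i < n" for i
  proof -
    have "0 \<le> y0 i" using Ky0 that by (auto simp: K_iff)
    thus ?thesis using that by (simp add: y0_def)
  qed
  have z0_cons: "\<forall>(c, d)\<in>Cons. dot n c z0 \<le> d"
  proof (safe)
    fix c d assume "(c, d) \<in> Cons"
    hence "rdot n c y0 \<le> of_int d * y0 n" using Ky0 by (auto simp: K_iff)
    hence "real_of_int (dot n c z0) \<le> of_int d" by (simp add: y0dot y0_def[of n])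
    thus "dot n c z0 \<le> d" by simp
  qed
  have z0_le: "z0 i \<le> int (point_bound n M)" if i: "i < n" for i
  proof -
    have "real_of_int (z0 i) = (\<Sum>v\<in>gens. m v * of_int (v i))" using y0[of i] i by (simp add: y0_def)
    also have "\<dots> \<le> (\<Sum>v\<in>gens. real R)"
    proof (rule sum_mono)
      fix v assume v: "v \<in> gens"
      have "0 \<le> v i" "v i \<le> int R" using v i by (auto simp: gens_def)
      hence vi: "0 \<le> real_of_int (v i)" "real_of_int (v i) \<le> real R" by linarith+
      have "m v * of_int (v i) \<le> 1 * of_int (v i)" using m1[OF v] vi by (intro mult_right_mono) auto
      thus "m v * of_int (v i) \<le> real R" using vi by simp
    qed
    also have "\<dots> = real (card gens * R)" by simp
    also have "\<dots> \<le> real ((R + 1) ^ Suc n * R)" unfolding of_nat_le_iff using card_gens by (rule mult_right_mono) simp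
    also have "\<dots> = of_int (int (point_bound n M))" by (simp add: point_bound_def RS)
    finally show ?thesis by (simp only: of_int_le_iff)
  qed
  have "1 \<le> (R + 1) ^ Suc n" by (rule one_le_power) simp
  from mult_right_mono[OF this, of R] have R_le: "int R \<le> int (point_bound n M)"
    by (simp only: point_bound_def RS of_nat_le_iff mult_1)
  have G_sat: "(\<forall>i<n. 0 \<le> r i \<and> r i \<le> int (point_bound n M)) \<and> (\<forall>(c, d)\<in>Cons. dot n c r \<le> 0) \<and> 0 \<le> k r"
    if r: "r \<in> G" for r
  proof (intro conjI)
    have r': "r \<in> gens" "r n = 0" using r by (auto simp: G_def)
    have "0 \<le> r i \<and> r i \<le> int R" if "i < n" for i using r'(1) that by (simp add: gens_def)
    thus "\<forall>i<n. 0 \<le> r i \<and> r i \<le> int (point_bound n M)" using R_le order_trans by blast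
    have "K (\<lambda>i. of_int (r i))" using r'(1) by (simp add: gens_def)
    hence "\<forall>(c, d)\<in>Cons. rdot n c (\<lambda>i. of_int (r i)) \<le> 0" using r'(2) unfolding K_iff by auto
    thus "\<forall>(c, d)\<in>Cons. dot n c r \<le> 0" by (simp add: rdot_of_int)
    show "0 \<le> k r" using l(1)[OF r'(1)] by (simp add: k_def)
  qed
  show ?thesis
    by (intro exI[of _ z0] exI[of _ G] exI[of _ k])
      (use finG z0_sat z0_cons z0_le G_sat in \<open>simp add: z0_def\<close>)
qed


subsection \<open>Small witnesses and small counterexamples\<close>

lemma dot_cong: "(\<And>i. i < n \<Longrightarrow> c i = c' i) \<Longrightarrow> (\<And>i. i < n \<Longrightarrow> x i = x' i) \<Longrightarrow> dot n c x = dot n c' x'"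
  by (simp add: dot_def)

lemma finite_bounded_rows: "finite {c :: nat \<Rightarrow> int. (\<forall>j<n. \<bar>c j\<bar> \<le> B) \<and> (\<forall>j\<ge>n. c j = 0)}" (is "finite ?S")
proof (rule finite_imageD)
  have "(\<lambda>v. restrict v {..<n}) ` ?S \<subseteq> ({..<n} \<rightarrow>\<^sub>E {- B..B})"
    by (rule image_subsetI) (auto simp: restrict_PiE_iff abs_le_iff)
  thus "finite ((\<lambda>v. restrict v {..<n}) ` ?S)"
    by (rule finite_subset) (auto intro: finite_PiE)
  show "inj_on (\<lambda>v. restrict v {..<n}) ?S"
  proof (rule inj_onI)
    fix v w assume v: "v \<in> ?S" "w \<in> ?S" "restrict v {..<n} = restrict w {..<n}"
    show "v = w"
    proof
      fix i
      have "restrict v {..<n} i = restrict w {..<n} i" by (simp only: v(3))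
      thus "v i = w i" using v(1,2) by (cases "i < n") simp_all
    qed
  qed
qed

definition bilin :: "nat \<Rightarrow> nat \<Rightarrow> (nat \<Rightarrow> nat \<Rightarrow> int) \<Rightarrow> (nat \<Rightarrow> int) \<Rightarrow> (nat \<Rightarrow> int) \<Rightarrow> int" where
  "bilin n k H x u = dot n (\<lambda>i. dot k (H i) x) u"

lemma bilin_row: "bilin n k H x u = dot k (\<lambda>j. dot n (\<lambda>i. H i j) u) x"
proof -
  have "bilin n k H x u = (\<Sum>i<n. \<Sum>j<k. H i j * x j * u i)"
    by (simp add: bilin_def dot_def sum_distrib_right)
  also have "\<dots> = (\<Sum>j<k. \<Sum>i<n. H i j * x j * u i)" by (rule sum.swap)
  also have "\<dots> = dot k (\<lambda>j. dot n (\<lambda>i. H i j) u) x"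
    by (simp add: dot_def sum_distrib_right sum_distrib_left ac_simps)
  finally show ?thesis .
qed

lemma dot_add: "dot n c (\<lambda>i. x i + y i) = dot n c x + dot n c y"
  by (simp add: dot_def distrib_left sum.distrib)

lemma dot_sum: "dot n c (\<lambda>i. \<Sum>r\<in>G. k r * r i) = (\<Sum>r\<in>G. k r * dot n c r)"
proof -
  have "dot n c (\<lambda>i. \<Sum>r\<in>G. k r * r i) = (\<Sum>i<n. \<Sum>r\<in>G. k r * (c i * r i))"
    by (simp add: dot_def sum_distrib_left ac_simps)
  also have "\<dots> = (\<Sum>r\<in>G. \<Sum>i<n. k r * (c i * r i))" by (rule sum.swap)
  finally show ?thesis by (simp add: dot_def sum_distrib_left)
qed

text \<open>Only the small point of the decomposition is needed, since it satisfies the additional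
  constraint as well. Integrality turns a positive value into a value of at least 1. The entries of
  the added row are sums of \<open>nx\<close> products, whence the enlarged entry bound.\<close>

lemma small_counterexample:
  fixes B :: "nat \<Rightarrow> nat \<Rightarrow> int" and M Bx :: nat
  assumes M: "1 \<le> M" and B: "\<And>i j. i < mu \<Longrightarrow> j < nu \<Longrightarrow> \<bar>B i j\<bar> \<le> int M" "\<And>i. i < mu \<Longrightarrow> \<bar>b i\<bar> \<le> int M"
    and H: "\<And>i j. i < nu \<Longrightarrow> j < nx \<Longrightarrow> \<bar>H i j\<bar> \<le> int M"
    and x: "\<And>j. j < nx \<Longrightarrow> 0 \<le> x j \<and> x j \<le> int Bx"
    and u: "\<And>i. i < nu \<Longrightarrow> 0 \<le> u i" "\<And>i. i < mu \<Longrightarrow> dot nu (B i) u \<le> b i" "0 < bilin nu nx H x u"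
  shows "\<exists>u'. (\<forall>i<nu. 0 \<le> u' i \<and> u' i \<le> int (point_bound nu (M + nx * (M * Bx)))) \<and>
     (\<forall>i<mu. dot nu (B i) u' \<le> b i) \<and> 0 < bilin nu nx H x u'"
proof -
  define h where "h i = - dot nx (H i) x" for i
  define Cons where "Cons = insert (h, - 1) ((\<lambda>i. (B i, b i)) ` {..<mu})"
  have hdot: "dot nu h v = - bilin nu nx H x v" for v
    by (simp add: bilin_def dot_def h_def sum_negf)
  let ?M = "M + nx * (M * Bx)"
  have hb: "\<bar>h i\<bar> \<le> int ?M" if "i < nu" for i
  proof -
    have "\<bar>dot nx (H i) x\<bar> \<le> int nx * (int M * int Bx)"
      using H[OF that] x by (intro abs_dot_le) auto
    thus ?thesis by (simp add: h_def)
  qed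
  have "\<exists>z0 G k. finite G \<and> (\<forall>i<nu. 0 \<le> z0 i \<and> z0 i \<le> int (point_bound nu ?M)) \<and>
     (\<forall>(c, d)\<in>Cons. dot nu c z0 \<le> d) \<and>
     (\<forall>r\<in>G. (\<forall>i<nu. 0 \<le> r i \<and> r i \<le> int (point_bound nu ?M)) \<and> (\<forall>(c, d)\<in>Cons. dot nu c r \<le> 0) \<and> 0 \<le> k r) \<and>
     (\<forall>i<nu. u i = z0 i + (\<Sum>r\<in>G. k r * r i))"
  proof (rule polyhedron_decomposition)
    show "finite Cons" by (simp add: Cons_def)
    show "1 \<le> ?M" using M by simp
    fix c d assume cd: "(c, d) \<in> Cons"
    then consider "c = h" "d = - 1" | i where "i < mu" "c = B i" "d = b i" by (auto simp: Cons_def)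
    note cases = this
    show "\<bar>c i\<bar> \<le> int ?M" if "i < nu" for i
      using cases
    proof cases
      case (2 k)
      have "\<bar>c i\<bar> \<le> int M" using 2 B(1) that by simp
      thus ?thesis by (rule order_trans) simp
    qed (use hb that in auto)
    show "\<bar>d\<bar> \<le> int ?M"
      using cases
    proof cases
      case 1
      thus ?thesis using M by (auto intro: order_trans[of _ "int M"])
    next
      case (2 k)
      have "\<bar>d\<bar> \<le> int M" using 2 B(2) by simp
      thus ?thesis by (rule order_trans) simp
    qed
    show "dot nu c u \<le> d" using cases by cases (use u hdot in auto)
  qed (rule u(1))
  then obtain z0 where z0: "\<forall>i<nu. 0 \<le> z0 i \<and> z0 i \<le> int (point_bound nu ?M)" "\<forall>(c, d)\<in>Cons. dot nu c z0 \<le> d"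
    by blast
  have "dot nu h z0 \<le> - 1" "\<forall>i<mu. dot nu (B i) z0 \<le> b i" using z0(2) by (auto simp: Cons_def)
  thus ?thesis using z0(1) by (intro exI[of _ z0]) (simp add: hdot)
qed

text \<open>All small rows that are nonpositive at \<open>x\<close> are imposed on the new point,
  wherever they come from; they are finitely many, and the decomposition bound does not grow with
  their number. Among them are the rows induced by the small points and the small recession
  directions of \<open>u\<close>.\<close>

lemma small_witness:
  fixes A B :: "nat \<Rightarrow> nat \<Rightarrow> int" and M :: nat
  assumes M: "1 \<le> M" and A: "\<And>i j. i < mx \<Longrightarrow> j < nx \<Longrightarrow> \<bar>A i j\<bar> \<le> int M" "\<And>i. i < mx \<Longrightarrow> \<bar>a i\<bar> \<le> int M"
    and B: "\<And>i j. i < mu \<Longrightarrow> j < nu \<Longrightarrow> \<bar>B i j\<bar> \<le> int M" "\<And>i. i < mu \<Longrightarrow> \<bar>b i\<bar> \<le> int M"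
    and H: "\<And>l i j. l < L \<Longrightarrow> i < nu \<Longrightarrow> j < nx \<Longrightarrow> \<bar>H l i j\<bar> \<le> int M"
    and x: "\<And>j. j < nx \<Longrightarrow> 0 \<le> x j" "\<And>i. i < mx \<Longrightarrow> dot nx (A i) x \<le> a i"
    and ux: "\<And>u l. (\<forall>i<nu. 0 \<le> u i) \<Longrightarrow> (\<forall>i<mu. dot nu (B i) u \<le> b i) \<Longrightarrow> l < L \<Longrightarrow> bilin nu nx (H l) x u \<le> 0"
  shows "\<exists>x'. (\<forall>j<nx. 0 \<le> x' j \<and> x' j \<le> int (point_bound nx (M + nu * (M * point_bound nu M)))) \<and>
     (\<forall>i<mx. dot nx (A i) x' \<le> a i) \<and>
     (\<forall>u l. (\<forall>i<nu. 0 \<le> u i) \<longrightarrow> (\<forall>i<mu. dot nu (B i) u \<le> b i) \<longrightarrow> l < L \<longrightarrow> bilin nu nx (H l) x' u \<le> 0)"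
proof -
  let ?S = "point_bound nu M"
  let ?M = "M + nu * (M * ?S)"
  define V where "V = {c. (\<forall>j<nx. \<bar>c j\<bar> \<le> int ?M) \<and> (\<forall>j\<ge>nx. c j = 0) \<and> dot nx c x \<le> 0}"
  define Cons where "Cons = (\<lambda>c. (c, 0)) ` V \<union> (\<lambda>i. (A i, a i)) ` {..<mx}"
  have "finite V" unfolding V_def by (rule finite_subset[OF _ finite_bounded_rows[of nx "int ?M"]]) auto
  hence fin: "finite Cons" by (simp add: Cons_def)
  have "\<exists>z0 G k. finite G \<and> (\<forall>i<nx. 0 \<le> z0 i \<and> z0 i \<le> int (point_bound nx ?M)) \<and>
     (\<forall>(c, d)\<in>Cons. dot nx c z0 \<le> d) \<and>
     (\<forall>r\<in>G. (\<forall>i<nx. 0 \<le> r i \<and> r i \<le> int (point_bound nx ?M)) \<and> (\<forall>(c, d)\<in>Cons. dot nx c r \<le> 0) \<and> 0 \<le> k r) \<and>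
     (\<forall>i<nx. x i = z0 i + (\<Sum>r\<in>G. k r * r i))"
  proof (rule polyhedron_decomposition[OF fin])
    show "1 \<le> ?M" using M by simp
    fix c d assume cd: "(c, d) \<in> Cons"
    then consider "c \<in> V" "d = 0" | i where "i < mx" "c = A i" "d = a i" by (auto simp: Cons_def)
    note cases = this
    show "\<bar>c i\<bar> \<le> int ?M" if "i < nx" for i
      using cases
    proof cases
      case (2 k)
      have "\<bar>c i\<bar> \<le> int M" using 2 A(1) that by simp
      thus ?thesis by (rule order_trans) simp
    qed (use that in \<open>simp add: V_def\<close>)
    show "\<bar>d\<bar> \<le> int ?M"
      using cases
    proof cases
      case (2 k)
      have "\<bar>d\<bar> \<le> int M" using 2 A(2) by simp
      thus ?thesis by (rule order_trans) simp
    qed simp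
    show "dot nx c x \<le> d" using cases by cases (use x in \<open>auto simp: V_def\<close>)
  qed (rule x(1))
  then obtain y where y: "\<forall>i<nx. 0 \<le> y i \<and> y i \<le> int (point_bound nx ?M)" "\<forall>(c, d)\<in>Cons. dot nx c y \<le> d"
    by blast
  have yV: "dot nx c y \<le> 0" if "c \<in> V" for c using y(2) that by (auto simp: Cons_def)
  have yA: "\<forall>i<mx. dot nx (A i) y \<le> a i" using y(2) by (auto simp: Cons_def)
  have transfer: "bilin nu nx (H l) y v \<le> 0"
    if v: "\<And>i. i < nu \<Longrightarrow> 0 \<le> v i \<and> v i \<le> int ?S" and l: "l < L" and xv: "bilin nu nx (H l) x v \<le> 0" for v l
  proof -
    define c where "c j = (if j < nx then dot nu (\<lambda>i. H l i j) v else 0)" for j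
    have "\<bar>c j\<bar> \<le> int ?M" if "j < nx" for j
    proof -
      have "\<bar>dot nu (\<lambda>i. H l i j) v\<bar> \<le> int nu * (int M * int ?S)"
        using H[OF l _ that] v by (intro abs_dot_le) auto
      thus ?thesis using that by (simp add: c_def)
    qed
    moreover have d: "dot nx c z = bilin nu nx (H l) z v" for z
      unfolding bilin_row by (rule dot_cong) (simp_all add: c_def)
    ultimately have "c \<in> V" using xv by (simp add: V_def c_def)
    from yV[OF this] show ?thesis by (simp only: d)
  qed
  have "bilin nu nx (H l) y u \<le> 0" if u: "\<forall>i<nu. 0 \<le> u i" "\<forall>i<mu. dot nu (B i) u \<le> b i" and l: "l < L" for u l
  proof -
    define CB where "CB = (\<lambda>i. (B i, b i)) ` {..<mu}"
    have "\<exists>z0 G k. finite G \<and> (\<forall>i<nu. 0 \<le> z0 i \<and> z0 i \<le> int ?S) \<and>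
       (\<forall>(c, d)\<in>CB. dot nu c z0 \<le> d) \<and>
       (\<forall>r\<in>G. (\<forall>i<nu. 0 \<le> r i \<and> r i \<le> int ?S) \<and> (\<forall>(c, d)\<in>CB. dot nu c r \<le> 0) \<and> 0 \<le> k r) \<and>
       (\<forall>i<nu. u i = z0 i + (\<Sum>r\<in>G. k r * r i))"
      by (rule polyhedron_decomposition) (use M B u in \<open>auto simp: CB_def\<close>)
    then obtain z0 G k where raw: "\<forall>i<nu. 0 \<le> z0 i \<and> z0 i \<le> int ?S" "\<forall>(c, d)\<in>CB. dot nu c z0 \<le> d"
       "\<forall>r\<in>G. (\<forall>i<nu. 0 \<le> r i \<and> r i \<le> int ?S) \<and> (\<forall>(c, d)\<in>CB. dot nu c r \<le> 0) \<and> 0 \<le> k r"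
       "\<forall>i<nu. u i = z0 i + (\<Sum>r\<in>G. k r * r i)" by blast
    have z0: "\<And>i. i < nu \<Longrightarrow> 0 \<le> z0 i \<and> z0 i \<le> int ?S" "\<forall>i<mu. dot nu (B i) z0 \<le> b i"
      and G: "\<And>r i. r \<in> G \<Longrightarrow> i < nu \<Longrightarrow> 0 \<le> r i \<and> r i \<le> int ?S" "\<And>r. r \<in> G \<Longrightarrow> \<forall>i<mu. dot nu (B i) r \<le> 0"
        "\<And>r. r \<in> G \<Longrightarrow> 0 \<le> k r"
      and eq: "\<And>i. i < nu \<Longrightarrow> u i = z0 i + (\<Sum>r\<in>G. k r * r i)"
      using raw unfolding CB_def by auto
    have x0: "bilin nu nx (H l) x z0 \<le> 0" using z0 l by (intro ux) auto
    have xr: "bilin nu nx (H l) x r \<le> 0" if r: "r \<in> G" for r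
    proof (rule ccontr)
      assume pos: "\<not> bilin nu nx (H l) x r \<le> 0"
      \<comment> \<open>A positive value at \<open>r\<close> is at least 1 by integrality, so for
        this \<open>t\<close> the feasible point \<open>z0 + t * r\<close> would have value at least
        1.\<close>
      define t where "t = 1 - bilin nu nx (H l) x z0"
      have t: "0 \<le> t" using x0 by (simp add: t_def)
      let ?u = "\<lambda>i. z0 i + t * r i"
      have "bilin nu nx (H l) x ?u \<le> 0"
      proof (rule ux)
        show "\<forall>i<nu. 0 \<le> ?u i" using z0 G(1)[OF r] t by simp
        show "\<forall>i<mu. dot nu (B i) ?u \<le> b i"
        proof (intro allI impI)
          fix i assume i: "i < mu"
          have "t * dot nu (B i) r \<le> 0" using t G(2)[OF r] i by (simp add: mult_nonneg_nonpos)
          thus "dot nu (B i) ?u \<le> b i" using z0(2) i unfolding dot_add_mult by force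
        qed
      qed (rule l)
      moreover have "t * 1 \<le> t * bilin nu nx (H l) x r" using t pos by (intro mult_left_mono) auto
      ultimately show False unfolding bilin_def dot_add_mult by (simp add: t_def bilin_def)
    qed
    have "bilin nu nx (H l) y u = bilin nu nx (H l) y z0 + (\<Sum>r\<in>G. k r * bilin nu nx (H l) y r)"
      unfolding bilin_def using dot_cong[of nu _ _ u "\<lambda>i. z0 i + (\<Sum>r\<in>G. k r * r i)"] eq
      by (simp add: dot_add dot_sum)
    also have "\<dots> \<le> 0 + 0"
    proof (intro add_mono sum_nonpos mult_nonneg_nonpos)
      show "bilin nu nx (H l) y z0 \<le> 0" using z0(1) l x0 by (rule transfer)
      show "bilin nu nx (H l) y r \<le> 0" if "r \<in> G" for r using G(1)[OF that] l xr[OF that] by (rule transfer)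
    qed (rule G(3))
    finally show ?thesis by simp
  qed
  thus ?thesis using y(1) yA by (intro exI[of _ y]) blast
qed


subsection \<open>Exponential bounds\<close>

text \<open>For entries up to \<open>2 ^ e\<close> the generators are bounded by
  \<open>2 ^ r\<close> with \<open>r = (n + 1) * (n + e + 2)\<close>, and the point bound then has
  the exponent \<open>(r + 1) * (n + 1) + r\<close>.\<close>

definition bound_exp :: "nat \<Rightarrow> nat \<Rightarrow> nat" where
  "bound_exp n e = ((n + 1) * (n + e + 2) + 1) * (n + 1) + (n + 1) * (n + e + 2)"

lemma bound_exp_mono: "n \<le> n' \<Longrightarrow> bound_exp n e \<le> bound_exp n' e"
  unfolding bound_exp_def by (intro add_mono mult_mono) auto

lemma point_bound_le:
  assumes "1 \<le> M" "M \<le> 2 ^ e"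
  shows "point_bound n M \<le> 2 ^ bound_exp n e"
proof -
  define r where "r = (n + 1) * (n + e + 2)"
  have "2 * Suc n * M + 1 \<le> 4 * ((n + 1) * M)" using assms(1) by (cases M) auto
  also have "\<dots> \<le> 4 * (2 ^ n * 2 ^ e)"
  proof (intro mult_left_mono mult_mono)
    show "n + 1 \<le> 2 ^ n" using less_exp[of n] by linarith
  qed (use assms in simp_all)
  also have "\<dots> = 2 ^ (n + e + 2)" by (simp add: power_add)
  finally have "ray_bound n M \<le> (2 ^ (n + e + 2)) ^ Suc n" unfolding ray_bound_def by (rule power_mono) simp
  also have "\<dots> = 2 ^ ((n + e + 2) * Suc n)" by (rule power_mult[symmetric])
  also have "(n + e + 2) * Suc n = r" by (simp add: r_def)
  finally have ray: "ray_bound n M \<le> 2 ^ r" .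
  moreover have "(1 :: nat) \<le> 2 ^ r" "(2 :: nat) ^ (r + 1) = 2 ^ r + 2 ^ r" by simp_all
  ultimately have "ray_bound n M + 1 \<le> 2 ^ (r + 1)" by linarith
  hence "(ray_bound n M + 1) ^ Suc n \<le> (2 ^ (r + 1)) ^ Suc n" by (rule power_mono) simp
  also have "\<dots> = 2 ^ ((r + 1) * (n + 1))" unfolding power_mult[symmetric] by simp
  finally have "point_bound n M \<le> 2 ^ ((r + 1) * (n + 1)) * 2 ^ r"
    unfolding point_bound_def using ray by (intro mult_mono) auto
  thus ?thesis by (simp only: bound_exp_def power_add r_def)
qed

lemma bound_sum_le:
  assumes "k \<le> n" "(M :: nat) \<le> 2 ^ e" "S \<le> 2 ^ f"
  shows "M + k * (M * S) \<le> 2 ^ (n + e + f + 1)"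
proof -
  have "k \<le> 2 ^ n" using assms(1) less_exp[of n] by linarith
  hence "k * (M * S) \<le> 2 ^ n * (2 ^ e * 2 ^ f)" using assms by (intro mult_mono) auto
  moreover have "(2 :: nat) ^ e \<le> 2 ^ (n + e + f)" by (rule power_increasing) auto
  hence "M \<le> 2 ^ (n + e + f)" using assms(2) by linarith
  ultimately have "M + k * (M * S) \<le> 2 ^ (n + e + f) + 2 ^ (n + e + f)" by (simp add: power_add)
  thus ?thesis by simp
qed


subsection \<open>Instances as streams of rational numbers\<close>

lemma rats_codes_Nil: "w \<in> rats_codes [] \<longleftrightarrow> w = []"
  by (simp add: rats_codes_def)

lemma rats_codes_Cons: "w \<in> rats_codes (r # es) \<longleftrightarrow> (\<exists>S. parse_rat w = Some (r, S) \<and> S \<in> rats_codes es)"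
proof
  assume "w \<in> rats_codes (r # es)"
  then obtain ws where "w = concat ws" "list_all2 (\<lambda>w r. w \<in> rat_codes r) ws (r # es)"
    unfolding rats_codes_def by blast
  then obtain c ws' where "w = c @ concat ws'" "c \<in> rat_codes r" "list_all2 (\<lambda>w r. w \<in> rat_codes r) ws' es"
    by (auto simp: list_all2_Cons2)
  thus "\<exists>S. parse_rat w = Some (r, S) \<and> S \<in> rats_codes es"
    unfolding parse_rat_iff rats_codes_def by blast
next
  assume "\<exists>S. parse_rat w = Some (r, S) \<and> S \<in> rats_codes es"
  then obtain c ws where c: "w = c @ concat ws" "c \<in> rat_codes r" "list_all2 (\<lambda>w r. w \<in> rat_codes r) ws es"
    unfolding parse_rat_iff rats_codes_def by blast
  hence "w = concat (c # ws)" "list_all2 (\<lambda>w r. w \<in> rat_codes r) (c # ws) (r # es)" by simp_all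
  thus "w \<in> rats_codes (r # es)" unfolding rats_codes_def by blast
qed

lemma drop_rats_front:
  "drop_rats w (Suc i) = (case parse_rat w of None \<Rightarrow> None | Some (q, S) \<Rightarrow> drop_rats S i)"
  by (induction i) (auto simp: drop_rats.simps(2) split: option.splits)

lemma rat_at_front: "parse_rat w = Some (q, S) \<Longrightarrow> rat_at w 0 = q \<and> rat_at w (Suc i) = rat_at S i"
  by (simp add: rat_at_def drop_rats_front)

lemma rats_codes_drop_rats:
  "w \<in> rats_codes es \<longleftrightarrow> drop_rats w (length es) = Some [] \<and> (\<forall>i<length es. rat_at w i = es ! i)"
proof (induction es arbitrary: w)
  case (Cons r es)
  show ?case
  proof (cases "parse_rat w")
    case (Some p)
    obtain q S where p: "p = (q, S)" by force
    show ?thesis using Some p Cons[of S] rat_at_front[of w q S]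
      by (auto simp: rats_codes_Cons drop_rats_front All_less_Suc2)
  qed (simp add: rats_codes_Cons drop_rats_front)
qed (simp add: rats_codes_Nil)

lemma bits_val_less: "bits_val bs < 2 ^ length bs"
  by (induction bs) auto

lemma less_nat_bits: "n < 2 ^ length (nat_bits n)"
  using bits_val_less[of "nat_bits n"] by simp

text \<open>\<open>D\<close> is the product of all denominators. Values multiply while code lengths
  add, so \<open>D\<close> is at most 2 to the length of \<open>w\<close>; a scaled entry is its
  numerator times the other denominators.\<close>

lemma common_denominator:
  "w \<in> rats_codes es \<Longrightarrow> \<exists>D > 0. D \<le> 2 ^ length w \<and>
     (\<forall>r \<in> set es. \<exists>z :: int. r * of_nat D = of_int z \<and> \<bar>z\<bar> \<le> 2 ^ (2 * length w))"
proof (induction es arbitrary: w)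
  case Nil
  show ?case by (rule exI[of _ 1]) simp
next
  case (Cons r es)
  then obtain S where S: "parse_rat w = Some (r, S)" "S \<in> rats_codes es" by (auto simp: rats_codes_Cons)
  obtain D where D: "0 < D" "D \<le> 2 ^ length S"
    "\<And>r. r \<in> set es \<Longrightarrow> \<exists>z :: int. r * of_nat D = of_int z \<and> \<bar>z\<bar> \<le> 2 ^ (2 * length S)"
    using Cons.IH[OF S(2)] by blast
  obtain sg m d where p: "parse_frac w = Some (sg, m, d, S)" "r = frac_val sg m d"
    using S(1) by (auto simp: parse_rat_def)
  have d0: "0 < d" using parse_frac_SomeD(2)[OF p(1)] .
  let ?m = "length (nat_bits m)"
  let ?d = "length (nat_bits d)"
  have len: "length w = 3 + 2 * ?m + 2 * ?d + length S"
    using parse_frac_SomeD(1)[OF p(1)] by (simp add: nat_code_def length_concat comp_def sum_list_triv)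
  have md: "m \<le> 2 ^ ?m" "d \<le> 2 ^ ?d" using less_nat_bits[of m] less_nat_bits[of d] by linarith+
  have "d * D \<le> 2 ^ ?d * 2 ^ length S" using md D by (intro mult_mono) auto
  also have "\<dots> \<le> 2 ^ length w" unfolding power_add[symmetric] len by (rule power_increasing) auto
  finally have 1: "d * D \<le> 2 ^ length w" .
  have 2: "\<exists>z :: int. r' * of_nat (d * D) = of_int z \<and> \<bar>z\<bar> \<le> 2 ^ (2 * length w)" if r': "r' \<in> set es" for r'
  proof -
    obtain z :: int where z: "r' * of_nat D = of_int z" "\<bar>z\<bar> \<le> 2 ^ (2 * length S)" using D(3)[OF r'] by blast
    have "int d \<le> 2 ^ ?d" using md(2) by (metis of_nat_le_iff of_nat_numeral of_nat_power)
    hence "\<bar>z\<bar> * int d \<le> 2 ^ (2 * length S) * 2 ^ ?d" using z(2) by (intro mult_mono) simp_all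
    hence "\<bar>z * int d\<bar> \<le> 2 ^ (2 * length S) * 2 ^ ?d" by (simp add: abs_mult)
    also have "\<dots> \<le> 2 ^ (2 * length w)" unfolding power_add[symmetric] len by (rule power_increasing) auto
    finally have "\<bar>z * int d\<bar> \<le> 2 ^ (2 * length w)" .
    moreover have "r' * of_nat (d * D) = (r' * of_nat D) * of_nat d" by simp
    hence "r' * of_nat (d * D) = of_int (z * int d)" by (simp add: z(1))
    ultimately show ?thesis by blast
  qed
  have 3: "\<exists>z :: int. r * of_nat (d * D) = of_int z \<and> \<bar>z\<bar> \<le> 2 ^ (2 * length w)"
  proof -
    define z where "z = (if sg then - int m else int m) * int D"
    have "\<bar>z\<bar> = int (m * D)" by (simp add: z_def abs_mult)
    also have "m * D \<le> 2 ^ ?m * 2 ^ length S" using md D by (intro mult_mono) auto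
    also have "\<dots> \<le> 2 ^ (2 * length w)" unfolding power_add[symmetric] len by (rule power_increasing) auto
    finally have "\<bar>z\<bar> \<le> 2 ^ (2 * length w)" by simp
    moreover have "r * of_nat (d * D) = of_int z" using d0 by (simp add: p(2) frac_val_def z_def)
    ultimately show ?thesis by blast
  qed
  show ?case using 1 2 3 D(1) d0 by (intro exI[of _ "d * D"]) auto
qed

definition feasible_x :: "nat \<Rightarrow> nat \<Rightarrow> nat \<Rightarrow> bool list \<Rightarrow> (nat \<Rightarrow> nat) \<Rightarrow> bool" where
  "feasible_x mx nx mu W x \<longleftrightarrow> (\<forall>i < mx. row_sum (rat_at W) (mx + mu + i * nx) nx x \<le> rat_at W i)"

definition feasible_u :: "nat \<Rightarrow> nat \<Rightarrow> nat \<Rightarrow> nat \<Rightarrow> bool list \<Rightarrow> (nat \<Rightarrow> nat) \<Rightarrow> bool" where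
  "feasible_u mx nx mu nu W u \<longleftrightarrow>
     (\<forall>i < mu. row_sum (rat_at W) (mx + mu + mx * nx + i * nu) nu u \<le> rat_at W (mx + i))"

definition forms_nonpos :: "nat \<Rightarrow> nat \<Rightarrow> nat \<Rightarrow> nat \<Rightarrow> nat \<Rightarrow> bool list \<Rightarrow> (nat \<Rightarrow> nat) \<Rightarrow> (nat \<Rightarrow> nat) \<Rightarrow> bool" where
  "forms_nonpos mx nx mu nu L W x u \<longleftrightarrow>
     (\<forall>l < L. form_sum (rat_at W) (mx + mu + mx * nx + mu * nu + l * (nu * nx)) nu nx x u \<le> 0)"

lemma checks_iff:
  "checks mx nx mu nu L W X Y \<longleftrightarrow> drop_rats W (mx + mu + mx * nx + mu * nu + L * (nu * nx)) = Some [] \<and>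
     feasible_x mx nx mu W (nat_at X) \<and> (feasible_u mx nx mu nu W (nat_at Y) \<longrightarrow> forms_nonpos mx nx mu nu L W (nat_at X) (nat_at Y))"
  by (simp add: checks_def feasible_x_def feasible_u_def forms_nonpos_def)

text \<open>Scaled entries are at most \<open>2 ^ (2 * n)\<close>. The inner
  \<open>bound_exp\<close> is for the small points and directions of \<open>u\<close>; combining
  these with H gives the coefficients of the constraints on \<open>x\<close>, whose size is the
  argument of the outer one.\<close>

definition x_exp :: "nat \<Rightarrow> nat" where
  "x_exp n = bound_exp n (n + 2 * n + bound_exp n (2 * n) + 1)"

definition u_exp :: "nat \<Rightarrow> nat \<Rightarrow> nat" where
  "u_exp n k = bound_exp n (n + 2 * n + k + 1)"

text \<open>\<open>n\<close> will be the length of the instance; it bounds the dimensions because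
  these are written in unary.\<close>

locale static_stream =
  fixes n mx nx mu nu L :: nat and W :: "bool list"
  assumes dims: "mx \<le> n" "nx \<le> n" "mu \<le> n" "nu \<le> n" "L \<le> n" "length W \<le> n"
    and stream: "drop_rats W (mx + mu + mx * nx + mu * nu + L * (nu * nx)) = Some []"
begin

abbreviation "oA \<equiv> mx + mu"
abbreviation "oB \<equiv> mx + mu + mx * nx"
abbreviation "oH \<equiv> mx + mu + mx * nx + mu * nu"
abbreviation "oEnd \<equiv> mx + mu + mx * nx + mu * nu + L * (nu * nx)"

lemma scaled: "\<exists>D e. 0 < D \<and> (\<forall>k<oEnd. rat_at W k * of_nat D = of_int (e k) \<and> \<bar>e k\<bar> \<le> int (2 ^ (2 * n)))"
proof -
  define es where "es = map (rat_at W) [0..<oEnd]"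
  have "W \<in> rats_codes es" unfolding rats_codes_drop_rats using stream by (simp add: es_def)
  from common_denominator[OF this] obtain D where D: "0 < D" "\<And>r. r \<in> set es \<Longrightarrow> \<exists>z :: int. r * of_nat D = of_int z \<and> \<bar>z\<bar> \<le> 2 ^ (2 * length W)"
    by blast
  have "\<exists>z :: int. rat_at W k * of_nat D = of_int z \<and> \<bar>z\<bar> \<le> int (2 ^ (2 * n))" if "k < oEnd" for k
  proof -
    have "rat_at W k \<in> set es" using that by (simp add: es_def)
    then obtain z :: int where z: "rat_at W k * of_nat D = of_int z" "\<bar>z\<bar> \<le> 2 ^ (2 * length W)" using D(2) by blast
    have "(2 :: int) ^ (2 * length W) \<le> 2 ^ (2 * n)" using dims by (intro power_increasing) auto
    with z(2) have "\<bar>z\<bar> \<le> 2 ^ (2 * n)" by (rule order_trans)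
    thus ?thesis using z(1) by (intro exI[of _ z]) simp
  qed
  hence "\<exists>e. \<forall>k<oEnd. rat_at W k * of_nat D = of_int (e k) \<and> \<bar>e k\<bar> \<le> int (2 ^ (2 * n))" by metis
  thus ?thesis using D(1) by blast
qed

text \<open>Multiplying all data by a common denominator preserves every inequality, as it is
  positive, and reduces both claims to their integer versions.\<close>

lemma small_solutions:
  shows "feasible_x mx nx mu W x \<Longrightarrow> (\<And>u. feasible_u mx nx mu nu W u \<Longrightarrow> forms_nonpos mx nx mu nu L W x u) \<Longrightarrow>
      \<exists>x'. (\<forall>j<nx. x' j \<le> 2 ^ x_exp n) \<and> feasible_x mx nx mu W x' \<and> (\<forall>u. feasible_u mx nx mu nu W u \<longrightarrow> forms_nonpos mx nx mu nu L W x' u)"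
    and "(\<And>j. j < nx \<Longrightarrow> x j \<le> 2 ^ k) \<Longrightarrow> feasible_u mx nx mu nu W u \<Longrightarrow> \<not> forms_nonpos mx nx mu nu L W x u \<Longrightarrow>
      \<exists>u'. (\<forall>j<nu. u' j \<le> 2 ^ u_exp n k) \<and> feasible_u mx nx mu nu W u' \<and> \<not> forms_nonpos mx nx mu nu L W x u'"
proof -
  obtain D e where D: "0 < D" and e: "\<And>k. k < oEnd \<Longrightarrow> rat_at W k * of_nat D = of_int (e k)"
    "\<And>k. k < oEnd \<Longrightarrow> \<bar>e k\<bar> \<le> int (2 ^ (2 * n))"
    using scaled by blast
  define A where "A i j = e (oA + i * nx + j)" for i j
  define B where "B i j = e (oB + i * nu + j)" for i j
  define H where "H l i j = e (oH + l * (nu * nx) + i * nx + j)" for l i j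
  define b where "b i = e (mx + i)" for i
  have D': "(of_nat D :: rat) > 0" using D by simp
  have iA: "oA + i * nx + j < oEnd" if "i < mx" "j < nx" for i j
    using mult_Suc_le[OF that(1), of nx] that(2) by linarith
  have iB: "oB + i * nu + j < oEnd" if "i < mu" "j < nu" for i j
    using mult_Suc_le[OF that(1), of nu] that(2) by linarith
  have iH: "oH + l * (nu * nx) + i * nx + j < oEnd" if "l < L" "i < nu" "j < nx" for l i j
    using mult_Suc_le[OF that(1), of "nu * nx"] mult_Suc_le[OF that(2), of nx] that(3) by linarith
  have row: "row_sum (rat_at W) i k y * of_nat D = of_int (dot k (\<lambda>j. e (i + j)) (\<lambda>j. int (y j)))"
    if "\<And>j. j < k \<Longrightarrow> i + j < oEnd" for i k y
  proof -
    have "row_sum (rat_at W) i k y * of_nat D = (\<Sum>j<k. (rat_at W (i + j) * of_nat D) * of_nat (y j))"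
      by (simp add: row_sum_def sum_distrib_right sum_distrib_left ac_simps)
    also have "\<dots> = (\<Sum>j<k. of_int (e (i + j)) * of_nat (y j))"
      using that by (intro sum.cong) (auto simp: e(1))
    finally show ?thesis by (simp add: dot_def)
  qed
  have okA': "feasible_x mx nx mu W y \<longleftrightarrow> (\<forall>i<mx. dot nx (A i) (\<lambda>j. int (y j)) \<le> e i)" for y
  proof -
    have "row_sum (rat_at W) (oA + i * nx) nx y \<le> rat_at W i \<longleftrightarrow> dot nx (A i) (\<lambda>j. int (y j)) \<le> e i" if "i < mx" for i
    proof -
      have "row_sum (rat_at W) (oA + i * nx) nx y \<le> rat_at W i \<longleftrightarrow>
          row_sum (rat_at W) (oA + i * nx) nx y * of_nat D \<le> rat_at W i * of_nat D"
        using D' by simp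
      also have "\<dots> \<longleftrightarrow> (of_int (dot nx (A i) (\<lambda>j. int (y j))) :: rat) \<le> of_int (e i)"
        using row[of nx "oA + i * nx" y] iA[OF that] e(1)[of i] that by (simp add: A_def[abs_def])
      finally show ?thesis by (simp only: of_int_le_iff)
    qed
    thus ?thesis by (simp add: feasible_x_def)
  qed
  have okB': "feasible_u mx nx mu nu W y \<longleftrightarrow> (\<forall>i<mu. dot nu (B i) (\<lambda>j. int (y j)) \<le> b i)" for y
  proof -
    have "row_sum (rat_at W) (oB + i * nu) nu y \<le> rat_at W (mx + i) \<longleftrightarrow> dot nu (B i) (\<lambda>j. int (y j)) \<le> b i" if "i < mu" for i
    proof -
      have "row_sum (rat_at W) (oB + i * nu) nu y \<le> rat_at W (mx + i) \<longleftrightarrow>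
          row_sum (rat_at W) (oB + i * nu) nu y * of_nat D \<le> rat_at W (mx + i) * of_nat D"
        using D' by simp
      also have "\<dots> \<longleftrightarrow> (of_int (dot nu (B i) (\<lambda>j. int (y j))) :: rat) \<le> of_int (b i)"
        using row[of nu "oB + i * nu" y] iB[OF that] e(1)[of "mx + i"] that by (simp add: B_def[abs_def] b_def)
      finally show ?thesis by (simp only: of_int_le_iff)
    qed
    thus ?thesis by (simp add: feasible_u_def)
  qed
  have okH': "forms_nonpos mx nx mu nu L W y v \<longleftrightarrow> (\<forall>l<L. bilin nu nx (H l) (\<lambda>j. int (y j)) (\<lambda>j. int (v j)) \<le> 0)" for y v
  proof -
    have "form_sum (rat_at W) (oH + l * (nu * nx)) nu nx y v \<le> 0 \<longleftrightarrow>
        bilin nu nx (H l) (\<lambda>j. int (y j)) (\<lambda>j. int (v j)) \<le> 0" if l: "l < L" for l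
    proof -
      have "form_sum (rat_at W) (oH + l * (nu * nx)) nu nx y v * of_nat D =
         (\<Sum>i<nu. (row_sum (rat_at W) (oH + l * (nu * nx) + i * nx) nx y * of_nat D) * of_nat (v i))"
        by (simp add: form_sum_def sum_distrib_right sum_distrib_left ac_simps)
      also have "\<dots> = (\<Sum>i<nu. of_int (dot nx (H l i) (\<lambda>j. int (y j))) * of_nat (v i))"
        using iH[OF l] by (intro sum.cong) (simp_all add: row H_def[abs_def])
      also have "\<dots> = of_int (bilin nu nx (H l) (\<lambda>j. int (y j)) (\<lambda>j. int (v j)))"
        by (simp add: bilin_def dot_def[of nu])
      finally have eq: "form_sum (rat_at W) (oH + l * (nu * nx)) nu nx y v * of_nat D =
         of_int (bilin nu nx (H l) (\<lambda>j. int (y j)) (\<lambda>j. int (v j)))" .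
      have "form_sum (rat_at W) (oH + l * (nu * nx)) nu nx y v \<le> 0 \<longleftrightarrow>
         form_sum (rat_at W) (oH + l * (nu * nx)) nu nx y v * of_nat D \<le> 0"
        using D' by (simp add: mult_le_0_iff)
      thus ?thesis unfolding eq by simp
    qed
    thus ?thesis by (simp add: forms_nonpos_def)
  qed
  let ?M = "2 ^ (2 * n) :: nat"
  have bA: "\<bar>A i j\<bar> \<le> int ?M" if "i < mx" "j < nx" for i j unfolding A_def by (rule e(2)[OF iA[OF that]])
  have ba: "\<bar>e i\<bar> \<le> int ?M" if "i < mx" for i using that by (intro e(2)) simp
  have bB: "\<bar>B i j\<bar> \<le> int ?M" if "i < mu" "j < nu" for i j unfolding B_def by (rule e(2)[OF iB[OF that]])
  have bb: "\<bar>b i\<bar> \<le> int ?M" if "i < mu" for i unfolding b_def using that by (intro e(2)) simp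
  have bH: "\<bar>H l i j\<bar> \<le> int ?M" if "l < L" "i < nu" "j < nx" for l i j
    unfolding H_def by (rule e(2)[OF iH[OF that]])
  have M1: "1 \<le> ?M" by simp
  note M1 = M1 trans_le_add1[OF M1]
  have nat_int: "dot k c (\<lambda>j. int (nat (z j))) = dot k c z" if "\<And>j. j < k \<Longrightarrow> 0 \<le> z j" for k c z
    using that by (simp add: dot_def)
  {
    assume x: "feasible_x mx nx mu W x" "\<And>u. feasible_u mx nx mu nu W u \<Longrightarrow> forms_nonpos mx nx mu nu L W x u"
    let ?S = "point_bound nu ?M"
    let ?T = "point_bound nx (?M + nu * (?M * ?S))"
    have "\<exists>x'. (\<forall>j<nx. 0 \<le> x' j \<and> x' j \<le> int ?T) \<and> (\<forall>i<mx. dot nx (A i) x' \<le> e i) \<and>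
     (\<forall>u l. (\<forall>i<nu. 0 \<le> u i) \<longrightarrow> (\<forall>i<mu. dot nu (B i) u \<le> b i) \<longrightarrow> l < L \<longrightarrow> bilin nu nx (H l) x' u \<le> 0)"
    proof (rule small_witness)
      show "dot nx (A i) (\<lambda>j. int (x j)) \<le> e i" if "i < mx" for i using x(1) that by (simp add: okA')
      show "bilin nu nx (H l) (\<lambda>j. int (x j)) u \<le> 0"
        if u: "\<forall>i<nu. 0 \<le> u i" "\<forall>i<mu. dot nu (B i) u \<le> b i" and l: "l < L" for u l
      proof -
        have eq: "dot nu c (\<lambda>j. int (nat (u j))) = dot nu c u" for c by (rule nat_int) (use u in simp)
        have "feasible_u mx nx mu nu W (\<lambda>j. nat (u j))" unfolding okB' eq by (rule u(2))
        from x(2)[OF this] l show ?thesis unfolding okH' bilin_def eq by blast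
      qed
    qed (use bA ba bB bb bH in auto)
    then obtain x' where x': "\<And>j. j < nx \<Longrightarrow> 0 \<le> x' j" "\<And>j. j < nx \<Longrightarrow> x' j \<le> int ?T"
      "\<forall>i<mx. dot nx (A i) x' \<le> e i"
      "\<And>u l. (\<forall>i<nu. 0 \<le> u i) \<Longrightarrow> (\<forall>i<mu. dot nu (B i) u \<le> b i) \<Longrightarrow> l < L \<Longrightarrow> bilin nu nx (H l) x' u \<le> 0"
      by blast
    let ?x = "\<lambda>j. nat (x' j)"
    have "?S \<le> 2 ^ bound_exp nu (2 * n)" by (rule point_bound_le[OF M1(1)]) simp
    also have "\<dots> \<le> 2 ^ bound_exp n (2 * n)" using bound_exp_mono[OF dims(4)] by (intro power_increasing) auto
    finally have "?M + nu * (?M * ?S) \<le> 2 ^ (n + 2 * n + bound_exp n (2 * n) + 1)"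
      by (intro bound_sum_le dims) auto
    hence "?T \<le> 2 ^ bound_exp nx (n + 2 * n + bound_exp n (2 * n) + 1)" by (rule point_bound_le[OF M1(2)])
    also have "\<dots> \<le> 2 ^ x_exp n" unfolding x_exp_def using bound_exp_mono[OF dims(2)] by (intro power_increasing) auto
    finally have T: "?T \<le> 2 ^ x_exp n" .
    have eq: "dot nx c (\<lambda>j. int (?x j)) = dot nx c x'" for c by (rule nat_int) (rule x'(1))
    have 1: "?x j \<le> 2 ^ x_exp n" if "j < nx" for j
    proof -
      have "?x j \<le> ?T" using x'(2)[OF that] by linarith
      thus ?thesis using T by linarith
    qed
    have 2: "feasible_x mx nx mu W ?x" unfolding okA' eq by (rule x'(3))
    have 3: "forms_nonpos mx nx mu nu L W ?x u" if "feasible_u mx nx mu nu W u" for u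
      unfolding okH' bilin_def eq
    proof (intro allI impI)
      fix l assume "l < L"
      from x'(4)[OF _ that[unfolded okB'] this] show "dot nu (\<lambda>i. dot nx (H l i) x') (\<lambda>j. int (u j)) \<le> 0"
        by (simp add: bilin_def)
    qed
    show "\<exists>x'. (\<forall>j<nx. x' j \<le> 2 ^ x_exp n) \<and> feasible_x mx nx mu W x' \<and>
        (\<forall>u. feasible_u mx nx mu nu W u \<longrightarrow> forms_nonpos mx nx mu nu L W x' u)"
      by (intro exI[of _ ?x] conjI allI impI 1 2 3)
  }
  {
    assume xu: "\<And>j. j < nx \<Longrightarrow> x j \<le> 2 ^ k" "feasible_u mx nx mu nu W u" "\<not> forms_nonpos mx nx mu nu L W x u"
    obtain l where l: "l < L" "0 < bilin nu nx (H l) (\<lambda>j. int (x j)) (\<lambda>j. int (u j))"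
      using xu(3) by (auto simp: okH' not_le)
    let ?T = "point_bound nu (?M + nx * (?M * 2 ^ k))"
    have "\<exists>u'. (\<forall>i<nu. 0 \<le> u' i \<and> u' i \<le> int ?T) \<and> (\<forall>i<mu. dot nu (B i) u' \<le> b i) \<and>
        0 < bilin nu nx (H l) (\<lambda>j. int (x j)) u'"
    proof (rule small_counterexample)
      show "\<And>j. j < nx \<Longrightarrow> 0 \<le> int (x j) \<and> int (x j) \<le> int (2 ^ k)" using xu(1) by (simp only: of_nat_le_iff) simp
      show "\<And>i. i < mu \<Longrightarrow> dot nu (B i) (\<lambda>j. int (u j)) \<le> b i" using xu(2) by (simp add: okB')
    qed (use bB bb bH l in auto)
    then obtain u' where u': "\<And>i. i < nu \<Longrightarrow> 0 \<le> u' i" "\<And>i. i < nu \<Longrightarrow> u' i \<le> int ?T"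
      "\<forall>i<mu. dot nu (B i) u' \<le> b i" "0 < bilin nu nx (H l) (\<lambda>j. int (x j)) u'" by blast
    let ?u = "\<lambda>j. nat (u' j)"
    have "?M + nx * (?M * 2 ^ k) \<le> 2 ^ (n + 2 * n + k + 1)" by (intro bound_sum_le dims) auto
    hence "?T \<le> 2 ^ bound_exp nu (n + 2 * n + k + 1)" by (rule point_bound_le[OF M1(2)])
    also have "\<dots> \<le> 2 ^ u_exp n k" unfolding u_exp_def using bound_exp_mono[OF dims(4)] by (intro power_increasing) auto
    finally have T: "?T \<le> 2 ^ u_exp n k" .
    have eq: "dot nu c (\<lambda>j. int (?u j)) = dot nu c u'" for c by (rule nat_int) (rule u'(1))
    have 1: "?u j \<le> 2 ^ u_exp n k" if "j < nu" for j
    proof -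
      have "?u j \<le> ?T" using u'(2)[OF that] by linarith
      thus ?thesis using T by linarith
    qed
    have 2: "feasible_u mx nx mu nu W ?u" unfolding okB' eq by (rule u'(3))
    have 3: "\<not> forms_nonpos mx nx mu nu L W x ?u"
      unfolding okH' bilin_def eq using u'(4) l(1) unfolding bilin_def by force
    show "\<exists>u'. (\<forall>j<nu. u' j \<le> 2 ^ u_exp n k) \<and> feasible_u mx nx mu nu W u' \<and> \<not> forms_nonpos mx nx mu nu L W x u'"
      by (intro exI[of _ ?u] conjI allI impI 1 2 3)
  }
qed

end


section \<open>Encodings of vectors of natural numbers\<close>

lemma length_nat_code [simp]: "length (nat_code n) = 2 * length (nat_bits n) + 1"
  by (simp add: nat_code_def length_concat comp_def sum_list_triv)

lemma length_nat_bits: "n < 2 ^ k \<Longrightarrow> length (nat_bits n) \<le> k"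
proof (induction k arbitrary: n)
  case (Suc k)
  show ?case
  proof (cases "n = 0")
    case False
    thus ?thesis using Suc.IH[of "n div 2"] Suc.prems by (simp add: nat_bits_pos less_mult_imp_div_less)
  qed simp
qed simp

lemma first_nat_nat_code [simp]: "first_nat (nat_code n @ w) = n" "after_nat (nat_code n @ w) = w"
  by (simp_all add: first_nat_def after_nat_def nat_code_def)

lemma nat_at_Suc: "nat_at w (Suc j) = nat_at (after_nat w) j"
  by (simp add: nat_at_def funpow_swap1)

lemma nat_at_code: "j < length xs \<Longrightarrow> nat_at (concat (map nat_code xs)) j = xs ! j"
proof (induction xs arbitrary: j)
  case (Cons x xs)
  show ?case
  proof (cases j)
    case 0
    thus ?thesis by (simp add: nat_at_def)
  next
    case (Suc i)
    thus ?thesis using Cons by (simp add: nat_at_Suc)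
  qed
qed simp

lemma encode_numbers:
  assumes "\<And>j. j < m \<Longrightarrow> x j \<le> 2 ^ k"
  shows "\<exists>w. length w \<le> m * (2 * k + 3) \<and> (\<forall>j<m. nat_at w j = x j)"
proof (intro exI conjI allI impI)
  let ?w = "concat (map nat_code (map x [0..<m]))"
  show "nat_at ?w j = x j" if "j < m" for j using that by (subst nat_at_code) simp_all
  \<comment> \<open>A number up to \<open>2 ^ k\<close> has at most \<open>k + 1\<close> digits;
    each takes two symbols, and one more ends the code.\<close>
  have "length (nat_code (x j)) \<le> 2 * k + 3" if "j < m" for j
  proof -
    have "(2 :: nat) ^ k < 2 ^ Suc k" by simp
    hence "x j < 2 ^ Suc k" using assms[OF that] by linarith
    thus ?thesis using length_nat_bits[of "x j" "Suc k"] by simp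
  qed
  hence "(\<Sum>j\<leftarrow>[0..<m]. length (nat_code (x j))) \<le> (\<Sum>j\<leftarrow>[0..<m]. 2 * k + 3)"
    by (intro sum_list_mono) simp
  also have "\<dots> = m * (2 * k + 3)" by (simp only: sum_list_triv length_upt diff_zero) simp
  finally show "length ?w \<le> m * (2 * k + 3)" by (simp only: length_concat map_map comp_def)
qed

text \<open>Limits what an arbitrary word can denote, since the verifier also meets witnesses that
  are not outputs of \<open>encode_numbers\<close>.\<close>

lemma nat_at_le: "nat_at w j \<le> 2 ^ length w"
proof -
  let ?v = "(after_nat ^^ j) w"
  have "bits_val (code_bits ?v) < 2 ^ length (code_bits ?v)" by (rule bits_val_less)
  moreover have "length (code_bits ?v) \<le> length w"
    using length_code_bits[of ?v] length_after_nat_pow[of j w] by linarith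
  hence "(2 :: nat) ^ length (code_bits ?v) \<le> 2 ^ length w" by (intro power_increasing) simp_all
  ultimately have "bits_val (code_bits ?v) \<le> 2 ^ length w" by linarith
  thus ?thesis by (simp only: nat_at_def first_nat_def)
qed

lemma row_sum_cong: "(\<And>j. j < k \<Longrightarrow> x j = y j) \<Longrightarrow> row_sum e i k x = row_sum e i k y"
  by (simp add: row_sum_def)

lemma feasible_x_cong: "(\<And>j. j < nx \<Longrightarrow> x j = y j) \<Longrightarrow> feasible_x mx nx mu W x \<longleftrightarrow> feasible_x mx nx mu W y"
  unfolding feasible_x_def using row_sum_cong[of nx x y] by simp

lemma feasible_u_cong: "(\<And>j. j < nu \<Longrightarrow> u j = v j) \<Longrightarrow> feasible_u mx nx mu nu W u \<longleftrightarrow> feasible_u mx nx mu nu W v"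
  unfolding feasible_u_def using row_sum_cong[of nu u v] by simp

lemma forms_nonpos_cong:
  assumes "\<And>j. j < nx \<Longrightarrow> x j = y j" "\<And>j. j < nu \<Longrightarrow> u j = v j"
  shows "forms_nonpos mx nx mu nu L W x u \<longleftrightarrow> forms_nonpos mx nx mu nu L W y v"
proof -
  have "form_sum e i nu nx x u = form_sum e i nu nx y v" for e i
    unfolding form_sum_def using assms(2) row_sum_cong[of nx x y, OF assms(1)]
    by (intro sum.cong) auto
  thus ?thesis by (simp add: forms_nonpos_def)
qed


subsection \<open>From streams to instances\<close>

definition stream_instance :: "nat \<Rightarrow> nat \<Rightarrow> nat \<Rightarrow> nat \<Rightarrow> nat \<Rightarrow> bool list \<Rightarrow> static_instance" where
  "stream_instance mx nx mu nu L W = (let e = rat_at W in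
     \<lparr>vec_a = vec mx e, vec_b = vec mu (\<lambda>i. e (mx + i)),
      mat_A = mat mx nx (\<lambda>(i, j). e (mx + mu + i * nx + j)),
      mat_B = mat mu nu (\<lambda>(i, j). e (mx + mu + mx * nx + i * nu + j)),
      mats_H = map (\<lambda>l. mat nu nx (\<lambda>(i, j). e (mx + mu + mx * nx + mu * nu + l * (nu * nx) + i * nx + j))) [0..<L]\<rparr>)"

lemma map_upt_shift: "map (\<lambda>j. g (k + j)) [0..<c] = map g [k..<k + c]"
  by (rule nth_equalityI) auto

lemma concat_blocks: "concat (map (\<lambda>i. map g [i * c..<i * c + c]) [0..<r]) = map g [0..<r * c]"
proof (induction r)
  case (Suc r)
  have "[0..<Suc r * c] = [0..<r * c] @ [r * c..<r * c + c]"
    using upt_add_eq_append[of 0 "r * c" c] by (simp add: add.commute)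
  thus ?case using Suc by simp
qed simp

lemma entries_mat:
  "concat (mat_to_list (mat r c (\<lambda>(i, j). g (k + i * c + j)))) = map g [k..<k + r * c]"
proof -
  have "concat (mat_to_list (mat r c (\<lambda>(i, j). g (k + i * c + j)))) =
     concat (map (\<lambda>i. map (\<lambda>j. g (k + i * c + j)) [0..<c]) [0..<r])"
    unfolding mat_to_list_def by (intro arg_cong[of _ _ concat] map_cong refl) auto
  also have "\<dots> = concat (map (\<lambda>i. map (\<lambda>m. g (k + m)) [i * c..<i * c + c]) [0..<r])"
    using map_upt_shift[of "\<lambda>m. g (k + m)"] by (simp add: add.assoc)
  also have "\<dots> = map g [k..<k + r * c]" unfolding concat_blocks by (rule map_upt_shift)
  finally show ?thesis .
qed

lemma list_of_vec_vec: "list_of_vec (vec n f) = map f [0..<n]"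
  by (rule nth_equalityI) (auto simp: list_of_vec_index)

lemma entries_stream_instance:
  "instance_entries (stream_instance mx nx mu nu L W) =
     map (rat_at W) [0..<mx + mu + mx * nx + mu * nu + L * (nu * nx)]"
proof -
  let ?e = "rat_at W"
  let ?h = "mx + mu + mx * nx + mu * nu"
  have H: "concat (map (concat \<circ> mat_to_list) (map (\<lambda>l. mat nu nx (\<lambda>(i, j). ?e (?h + l * (nu * nx) + i * nx + j))) [0..<L])) =
     map ?e [?h..<?h + L * (nu * nx)]"
  proof -
    have "map (concat \<circ> mat_to_list) (map (\<lambda>l. mat nu nx (\<lambda>(i, j). ?e (?h + l * (nu * nx) + i * nx + j))) [0..<L]) =
       map (\<lambda>l. map ?e [?h + l * (nu * nx)..<?h + l * (nu * nx) + nu * nx]) [0..<L]"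
      using entries_mat[of nu nx ?e] by simp
    also have "\<dots> = map (\<lambda>l. map (\<lambda>m. ?e (?h + m)) [l * (nu * nx)..<l * (nu * nx) + nu * nx]) [0..<L]"
    proof (rule map_cong[OF refl])
      fix l
      show "map ?e [?h + l * (nu * nx)..<?h + l * (nu * nx) + nu * nx] =
        map (\<lambda>m. ?e (?h + m)) [l * (nu * nx)..<l * (nu * nx) + nu * nx]"
        by (rule nth_equalityI) (auto simp: add.assoc)
    qed
    finally show ?thesis by (simp only: concat_blocks map_upt_shift)
  qed
  have split: "map ?e [0..<k] @ map ?e [k..<k + c] @ xs = map ?e [0..<k + c] @ xs" for k c xs
    using upt_add_eq_append[of 0 k c] by simp
  have "instance_entries (stream_instance mx nx mu nu L W) =
     map ?e [0..<mx] @ map ?e [mx..<mx + mu] @ map ?e [mx + mu..<mx + mu + mx * nx] @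
     map ?e [mx + mu + mx * nx..<?h] @ map ?e [?h..<?h + L * (nu * nx)] @ []"
    unfolding instance_entries_def stream_instance_def Let_def
    by (simp only: static_instance.simps H list_of_vec_vec entries_mat map_upt_shift append_Nil2)
  also have "\<dots> = map ?e [0..<?h + L * (nu * nx)]" unfolding split by simp
  finally show ?thesis .
qed

lemma wf_stream_instance: "wf_instance (stream_instance mx nx mu nu L W)"
  by (auto simp: wf_instance_def stream_instance_def Let_def)

lemma dims_stream_instance: "instance_dims (stream_instance mx nx mu nu L W) = [mx, nx, mu, nu, L]"
  by (simp add: instance_dims_def stream_instance_def Let_def)

lemma code_stream_instance:
  assumes "drop_rats W (mx + mu + mx * nx + mu * nu + L * (nu * nx)) = Some []"
  shows "concat (map unary_code [mx, nx, mu, nu, L]) @ W \<in> instance_codes (stream_instance mx nx mu nu L W)"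
proof -
  have "W \<in> rats_codes (instance_entries (stream_instance mx nx mu nu L W))"
    unfolding rats_codes_drop_rats entries_stream_instance using assms by simp
  thus ?thesis unfolding instance_codes_def dims_stream_instance by blast
qed

text \<open>Instead of decoding \<open>I\<close> component by component, the instance read off the
  stream is shown to share its code; as codes determine instances, it is \<open>I\<close>.\<close>

lemma instance_code_stream:
  assumes "wf_instance I" "w \<in> instance_codes I"
  obtains mx nx mu nu L W where "w = concat (map unary_code [mx, nx, mu, nu, L]) @ W"
    "drop_rats W (mx + mu + mx * nx + mu * nu + L * (nu * nx)) = Some []" "I = stream_instance mx nx mu nu L W"
proof -
  obtain W where W: "w = concat (map unary_code (instance_dims I)) @ W" "W \<in> rats_codes (instance_entries I)"
    using assms(2) unfolding instance_codes_def by blast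
  let ?mx = "dim_row (mat_A I)" and ?nx = "dim_col (mat_A I)"
  let ?mu = "dim_row (mat_B I)" and ?nu = "dim_col (mat_B I)"
  let ?L = "length (mats_H I)"
  have "length (concat (map (concat \<circ> mat_to_list) Hs)) = length Hs * (?nu * ?nx)"
    if "\<forall>H \<in> set Hs. H \<in> carrier_mat ?nu ?nx" for Hs :: "rat mat list"
    using that by (induction Hs) auto
  hence "length (instance_entries I) = ?mx + ?mu + ?mx * ?nx + ?mu * ?nu + ?L * (?nu * ?nx)"
    using assms(1) by (auto simp: instance_entries_def wf_instance_def)
  hence drop_rats: "drop_rats W (?mx + ?mu + ?mx * ?nx + ?mu * ?nu + ?L * (?nu * ?nx)) = Some []"
    using W(2) unfolding rats_codes_drop_rats by simp
  have w: "w = concat (map unary_code [?mx, ?nx, ?mu, ?nu, ?L]) @ W"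
    using W(1) by (simp add: instance_dims_def)
  have "w \<in> instance_codes (stream_instance ?mx ?nx ?mu ?nu ?L W)"
    unfolding w by (rule code_stream_instance[OF drop_rats])
  hence "I = stream_instance ?mx ?nx ?mu ?nu ?L W"
    using instance_code_unique[OF assms(1) wf_stream_instance assms(2)] by blast
  thus ?thesis using that w drop_rats by blast
qed

section \<open>Integer points as vectors of natural numbers\<close>

lemma of_rat_row: "(\<Sum>j<n. of_rat (f j) * real (x j)) = of_rat (\<Sum>j<n. f j * of_nat (x j))"
  by (simp add: of_rat_sum of_rat_mult)

lemma mult_vec_nat:
  assumes "i < dim_row A"
  shows "(map_mat of_rat A *\<^sub>v vec (dim_col A) (\<lambda>j. real (x j))) $ i =
    of_rat (\<Sum>j<dim_col A. A $$ (i, j) * of_nat (x j))"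
  using assms by (simp add: scalar_prod_def atLeast0LessThan of_rat_row[symmetric])

lemma integer_points_iff:
  assumes "a \<in> carrier_vec (dim_row A)"
  shows "v \<in> integer_points A a \<longleftrightarrow> (\<exists>x. v = vec (dim_col A) (\<lambda>j. real (x j)) \<and>
    (\<forall>i<dim_row A. (\<Sum>j<dim_col A. A $$ (i, j) * of_nat (x j)) \<le> a $ i))"
proof -
  have le: "map_mat of_rat A *\<^sub>v vec (dim_col A) (\<lambda>j. real (x j)) \<le> map_vec of_rat a \<longleftrightarrow>
    (\<forall>i<dim_row A. (\<Sum>j<dim_col A. A $$ (i, j) * of_nat (x j)) \<le> a $ i)" for x
  proof -
    have "map_mat of_rat A *\<^sub>v vec (dim_col A) (\<lambda>j. real (x j)) \<le> map_vec of_rat a \<longleftrightarrow>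
      (\<forall>i<dim_row A. (map_mat of_rat A *\<^sub>v vec (dim_col A) (\<lambda>j. real (x j))) $ i \<le> of_rat (a $ i))"
      using assms by (auto simp: less_eq_vec_def)
    thus ?thesis by (simp only: mult_vec_nat of_rat_less_eq cong: imp_cong)
  qed
  show ?thesis
  proof
    assume v: "v \<in> integer_points A a"
    define x where "x j = nat \<lfloor>v $ j\<rfloor>" for j
    have vx: "v = vec (dim_col A) (\<lambda>j. real (x j))"
    proof (rule eq_vecI)
      show "v $ j = vec (dim_col A) (\<lambda>j. real (x j)) $ j" if "j < dim_vec (vec (dim_col A) (\<lambda>j. real (x j)))" for j
      proof -
        have j: "j < dim_col A" using that by simp
        have "0\<^sub>v (dim_col A) \<le> v" "v \<in> carrier_vec (dim_col A)" and int: "v $ j \<in> \<int>"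
          using v j by (simp_all add: integer_points_def)
        hence pos: "0 \<le> v $ j" using j by (simp add: less_eq_vec_def)
        obtain z where "v $ j = of_int z" using int by (rule Ints_cases)
        thus ?thesis using j pos by (simp add: x_def)
      qed
    qed (use v in \<open>auto simp: integer_points_def\<close>)
    have "map_mat of_rat A *\<^sub>v v \<le> map_vec of_rat a" using v by (simp add: integer_points_def)
    thus "\<exists>x. v = vec (dim_col A) (\<lambda>j. real (x j)) \<and>
        (\<forall>i<dim_row A. (\<Sum>j<dim_col A. A $$ (i, j) * of_nat (x j)) \<le> a $ i)"
      using vx le[of x] by auto
  next
    assume "\<exists>x. v = vec (dim_col A) (\<lambda>j. real (x j)) \<and>
        (\<forall>i<dim_row A. (\<Sum>j<dim_col A. A $$ (i, j) * of_nat (x j)) \<le> a $ i)"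
    then obtain x where x: "v = vec (dim_col A) (\<lambda>j. real (x j))"
      "\<forall>i<dim_row A. (\<Sum>j<dim_col A. A $$ (i, j) * of_nat (x j)) \<le> a $ i" by blast
    have "map_mat of_rat A *\<^sub>v v \<le> map_vec of_rat a" unfolding x(1) le by (rule x(2))
    moreover have "v \<in> carrier_vec (dim_col A)" "0\<^sub>v (dim_col A) \<le> v" "\<forall>i<dim_col A. v $ i \<in> \<int>"
      by (simp_all add: x(1) less_eq_vec_def)
    ultimately show "v \<in> integer_points A a" by (simp add: integer_points_def)
  qed
qed

lemma static_yes_stream:
  "static_yes (stream_instance mx nx mu nu L W) \<longleftrightarrow>
     (\<exists>x. feasible_x mx nx mu W x \<and> (\<forall>u. feasible_u mx nx mu nu W u \<longrightarrow> forms_nonpos mx nx mu nu L W x u))"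
proof -
  let ?I = "stream_instance mx nx mu nu L W"
  let ?e = "rat_at W"
  let ?h = "mx + mu + mx * nx + mu * nu"
  define H where "H l = mat nu nx (\<lambda>(i, j). ?e (?h + l * (nu * nx) + i * nx + j))" for l
  have X: "v \<in> Xd ?I \<longleftrightarrow> (\<exists>x. v = vec nx (\<lambda>j. real (x j)) \<and> feasible_x mx nx mu W x)" for v
    unfolding Xd_def by (subst integer_points_iff)
      (simp_all add: stream_instance_def Let_def feasible_x_def row_sum_def)
  have U: "v \<in> Ud ?I \<longleftrightarrow> (\<exists>u. v = vec nu (\<lambda>j. real (u j)) \<and> feasible_u mx nx mu nu W u)" for v
    unfolding Ud_def by (subst integer_points_iff)
      (simp_all add: stream_instance_def Let_def feasible_u_def row_sum_def)
  have mats: "set (mats_H ?I) = H ` {..<L}"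
    by (auto simp: stream_instance_def Let_def H_def)
  have form: "vec nu (\<lambda>j. real (u j)) \<bullet> (map_mat of_rat (H l) *\<^sub>v vec nx (\<lambda>j. real (x j))) =
     of_rat (form_sum ?e (?h + l * (nu * nx)) nu nx x u)" for l x u
  proof -
    have d: "dim_row (H l) = nu" "dim_col (H l) = nx" by (simp_all add: H_def)
    have "vec nu (\<lambda>j. real (u j)) \<bullet> (map_mat of_rat (H l) *\<^sub>v vec nx (\<lambda>j. real (x j))) =
       (\<Sum>i<nu. real (u i) * (map_mat of_rat (H l) *\<^sub>v vec nx (\<lambda>j. real (x j))) $ i)"
      by (simp add: scalar_prod_def d atLeast0LessThan)
    also have "\<dots> = (\<Sum>i<nu. of_rat (row_sum ?e (?h + l * (nu * nx) + i * nx) nx x) * real (u i))"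
    proof (rule sum.cong[OF refl])
      fix i assume "i \<in> {..<nu}"
      hence i: "i < nu" by simp
      have "(map_mat of_rat (H l) *\<^sub>v vec nx (\<lambda>j. real (x j))) $ i =
         (of_rat (\<Sum>j<nx. H l $$ (i, j) * of_nat (x j)) :: real)"
        using mult_vec_nat[of i "H l" x] i by (simp only: d)
      also have "(\<Sum>j<nx. H l $$ (i, j) * of_nat (x j)) = row_sum ?e (?h + l * (nu * nx) + i * nx) nx x"
        unfolding row_sum_def using i by (intro sum.cong) (simp_all add: H_def)
      finally show "real (u i) * (map_mat of_rat (H l) *\<^sub>v vec nx (\<lambda>j. real (x j))) $ i =
         of_rat (row_sum ?e (?h + l * (nu * nx) + i * nx) nx x) * real (u i)" by simp
    qed
    also have "\<dots> = of_rat (form_sum ?e (?h + l * (nu * nx)) nu nx x u)"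
      unfolding form_sum_def by (rule of_rat_row)
    finally show ?thesis .
  qed
  have H': "(\<forall>M \<in> set (mats_H ?I). vec nu (\<lambda>j. real (u j)) \<bullet> (map_mat of_rat M *\<^sub>v vec nx (\<lambda>j. real (x j))) \<le> 0)
      \<longleftrightarrow> forms_nonpos mx nx mu nu L W x u" for x u
    unfolding mats forms_nonpos_def by (auto simp: form of_rat_le_0_iff)
  show ?thesis
  proof
    assume "static_yes ?I"
    then obtain v where v: "v \<in> Xd ?I" "\<forall>u \<in> Ud ?I. \<forall>M \<in> set (mats_H ?I). u \<bullet> (map_mat of_rat M *\<^sub>v v) \<le> 0"
      unfolding static_yes_def by blast
    obtain x where x: "v = vec nx (\<lambda>j. real (x j))" "feasible_x mx nx mu W x" using v(1) X by blast
    have "forms_nonpos mx nx mu nu L W x u" if "feasible_u mx nx mu nu W u" for u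
      using v(2) U[of "vec nu (\<lambda>j. real (u j))"] that unfolding H'[symmetric] x(1) by blast
    thus "\<exists>x. feasible_x mx nx mu W x \<and> (\<forall>u. feasible_u mx nx mu nu W u \<longrightarrow> forms_nonpos mx nx mu nu L W x u)"
      using x(2) by blast
  next
    assume "\<exists>x. feasible_x mx nx mu W x \<and> (\<forall>u. feasible_u mx nx mu nu W u \<longrightarrow> forms_nonpos mx nx mu nu L W x u)"
    then obtain x where x: "feasible_x mx nx mu W x" "\<And>u. feasible_u mx nx mu nu W u \<Longrightarrow> forms_nonpos mx nx mu nu L W x u" by blast
    have "\<forall>M \<in> set (mats_H ?I). w \<bullet> (map_mat of_rat M *\<^sub>v vec nx (\<lambda>j. real (x j))) \<le> 0" if w: "w \<in> Ud ?I" for w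
    proof -
      obtain u where "w = vec nu (\<lambda>j. real (u j))" "feasible_u mx nx mu nu W u" using w U by blast
      thus ?thesis using x(2) H' by blast
    qed
    moreover have "vec nx (\<lambda>j. real (x j)) \<in> Xd ?I" using X x(1) by blast
    ultimately show "static_yes ?I" unfolding static_yes_def by blast
  qed
qed


subsection \<open>Membership in the second level\<close>

text \<open>Closure properties spare the explicit computation of the two polynomials that bound the
  witnesses.\<close>

definition poly_fun :: "(nat \<Rightarrow> nat) \<Rightarrow> bool" where
  "poly_fun f \<longleftrightarrow> (\<exists>p. \<forall>n. f n = poly p n)"

lemma poly_fun_const: "poly_fun (\<lambda>_. c)"
  unfolding poly_fun_def by (rule exI[of _ "[:c:]"]) simp

lemma poly_fun_id: "poly_fun (\<lambda>n. n)"
  unfolding poly_fun_def by (rule exI[of _ "[:0, 1:]"]) simp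

lemma poly_fun_add: "poly_fun f \<Longrightarrow> poly_fun g \<Longrightarrow> poly_fun (\<lambda>n. f n + g n)"
  unfolding poly_fun_def by (metis poly_add)

lemma poly_fun_mult: "poly_fun f \<Longrightarrow> poly_fun g \<Longrightarrow> poly_fun (\<lambda>n. f n * g n)"
  unfolding poly_fun_def by (metis poly_mult)

lemmas poly_fun_intros = poly_fun_const poly_fun_id poly_fun_add poly_fun_mult

lemma poly_fun_bound_exp: "poly_fun e \<Longrightarrow> poly_fun (\<lambda>n. bound_exp n (e n))"
  unfolding bound_exp_def by (intro poly_fun_intros)

definition x_size :: "nat \<Rightarrow> nat" where
  "x_size n = n * (2 * x_exp n + 3)"

text \<open>The exponent handed to \<open>u_exp\<close> is \<open>x_size n\<close> and not
  \<open>x_exp n\<close>: a counterexample has to exist against every bad word \<open>X\<close> of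
  the permitted length, whose coordinates may be as large as \<open>2 ^ x_size n\<close>
  allows.\<close>

definition u_size :: "nat \<Rightarrow> nat" where
  "u_size n = n * (2 * u_exp n (x_size n) + 3)"

lemma poly_fun_x_size: "poly_fun x_size"
proof -
  have "poly_fun (\<lambda>n. n * (2 * bound_exp n (n + 2 * n + bound_exp n (2 * n) + 1) + 3))"
    by (intro poly_fun_intros poly_fun_bound_exp)
  thus ?thesis by (simp add: x_size_def[abs_def] x_exp_def)
qed

lemma poly_fun_u_size: "poly_fun u_size"
proof -
  have "poly_fun (\<lambda>n. n * (2 * bound_exp n (n + 2 * n + x_size n + 1) + 3))"
    by (intro poly_fun_intros poly_fun_bound_exp poly_fun_x_size)
  thus ?thesis by (simp add: u_size_def[abs_def] u_exp_def)
qed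

lemma Static_iff:
  "I \<in> Static \<longleftrightarrow> (\<exists>X. length X \<le> x_size (length I) \<and> (\<forall>Y. length Y \<le> u_size (length I) \<longrightarrow> verifier I X Y))"
proof
  assume "I \<in> Static"
  then obtain J where J: "wf_instance J" "I \<in> instance_codes J" "static_yes J" unfolding Static_def by blast
  then obtain mx nx mu nu L W where I: "I = concat (map unary_code [mx, nx, mu, nu, L]) @ W"
    "drop_rats W (mx + mu + mx * nx + mu * nu + L * (nu * nx)) = Some []" "J = stream_instance mx nx mu nu L W"
    using instance_code_stream by metis
  let ?n = "length I"
  interpret static_stream ?n mx nx mu nu L W
    by standard (use I in auto)
  obtain x where "feasible_x mx nx mu W x" "\<And>u. feasible_u mx nx mu nu W u \<Longrightarrow> forms_nonpos mx nx mu nu L W x u"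
    using J(3) unfolding I(3) static_yes_stream by blast
  from small_solutions(1)[OF this] obtain x' where x': "\<And>j. j < nx \<Longrightarrow> x' j \<le> 2 ^ x_exp ?n"
    "feasible_x mx nx mu W x'" "\<And>u. feasible_u mx nx mu nu W u \<Longrightarrow> forms_nonpos mx nx mu nu L W x' u" by blast
  obtain X where X: "length X \<le> nx * (2 * x_exp ?n + 3)" "\<And>j. j < nx \<Longrightarrow> nat_at X j = x' j"
    using encode_numbers[of nx x' "x_exp ?n"] x'(1) by blast
  have "nx * (2 * x_exp ?n + 3) \<le> x_size ?n" unfolding x_size_def using dims by (intro mult_right_mono) auto
  \<comment> \<open>A genuine solution passes against every \<open>Y\<close>, of whatever
    length.\<close>
  moreover have "verifier I X Y" for Y
  proof -
    have "feasible_x mx nx mu W (nat_at X)" using x'(2) feasible_x_cong[of nx "nat_at X" x'] X(2) by blast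
    moreover have "forms_nonpos mx nx mu nu L W (nat_at X) u" if "feasible_u mx nx mu nu W u" for u
      using x'(3)[OF that] forms_nonpos_cong[of nx "nat_at X" x' nu u u] X(2) by blast
    ultimately have "checks mx nx mu nu L W X Y" unfolding checks_iff using I(2) by blast
    thus ?thesis unfolding I(1) verifier_header .
  qed
  ultimately show "\<exists>X. length X \<le> x_size ?n \<and> (\<forall>Y. length Y \<le> u_size ?n \<longrightarrow> verifier I X Y)"
    using X(1) order_trans by blast
next
  let ?n = "length I"
  assume "\<exists>X. length X \<le> x_size ?n \<and> (\<forall>Y. length Y \<le> u_size ?n \<longrightarrow> verifier I X Y)"
  then obtain X where X: "length X \<le> x_size ?n" "\<And>Y. length Y \<le> u_size ?n \<Longrightarrow> verifier I X Y" by blast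
  \<comment> \<open>The empty \<open>Y\<close> already certifies that \<open>I\<close> is a code and
    that \<open>X\<close> denotes a feasible point.\<close>
  have "verifier I X []" by (rule X(2)) simp
  then obtain mx nx mu nu L W where I: "I = concat (map unary_code [mx, nx, mu, nu, L]) @ W"
    and c: "checks mx nx mu nu L W X []" unfolding verifier_def by blast
  have drop_rats: "drop_rats W (mx + mu + mx * nx + mu * nu + L * (nu * nx)) = Some []" and A: "feasible_x mx nx mu W (nat_at X)"
    using c by (simp_all add: checks_iff)
  interpret static_stream ?n mx nx mu nu L W
    by standard (use I drop_rats in auto)
  have "forms_nonpos mx nx mu nu L W (nat_at X) u" if u: "feasible_u mx nx mu nu W u" for u
  proof (rule ccontr)
    assume no: "\<not> forms_nonpos mx nx mu nu L W (nat_at X) u"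
    have "nat_at X j \<le> 2 ^ x_size ?n" for j
    proof -
      have "(2 :: nat) ^ length X \<le> 2 ^ x_size ?n" using X(1) by (intro power_increasing) simp_all
      thus ?thesis using nat_at_le[of X j] by linarith
    qed
    from small_solutions(2)[OF this u no] obtain u' where u': "\<And>j. j < nu \<Longrightarrow> u' j \<le> 2 ^ u_exp ?n (x_size ?n)"
      "feasible_u mx nx mu nu W u'" "\<not> forms_nonpos mx nx mu nu L W (nat_at X) u'" by blast
    obtain Y where Y: "length Y \<le> nu * (2 * u_exp ?n (x_size ?n) + 3)" "\<And>j. j < nu \<Longrightarrow> nat_at Y j = u' j"
      using encode_numbers[of nu u' "u_exp ?n (x_size ?n)"] u'(1) by blast
    have "nu * (2 * u_exp ?n (x_size ?n) + 3) \<le> u_size ?n"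
      unfolding u_size_def using dims by (intro mult_right_mono) auto
    hence "verifier I X Y" using X(2) Y(1) by simp
    hence "checks mx nx mu nu L W X Y" unfolding I verifier_header .
    moreover have "feasible_u mx nx mu nu W (nat_at Y)" using u'(2) feasible_u_cong[of nu "nat_at Y" u'] Y(2) by blast
    ultimately have "forms_nonpos mx nx mu nu L W (nat_at X) (nat_at Y)" by (simp add: checks_iff)
    thus False using u'(3) forms_nonpos_cong[of nx "nat_at X" "nat_at X" nu "nat_at Y" u'] Y(2) by blast
  qed
  hence "static_yes (stream_instance mx nx mu nu L W)" unfolding static_yes_stream using A by blast
  moreover have "I \<in> instance_codes (stream_instance mx nx mu nu L W)"
    unfolding I by (rule code_stream_instance[OF drop_rats])
  ultimately show "I \<in> Static" unfolding Static_def using wf_stream_instance by blast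
qed

theorem theorem9:
  shows "Static \<in> Sigma2p"
proof -
  obtain p where p: "\<And>n. x_size n = poly p n" using poly_fun_x_size unfolding poly_fun_def by blast
  obtain q where q: "\<And>n. u_size n = poly q n" using poly_fun_u_size unfolding poly_fun_def by blast
  let ?P = "\<lambda>ws. verifier (ws ! 0) (ws ! 1) (ws ! 2)"
  have "\<forall>I. I \<in> Static \<longleftrightarrow> (\<exists>X. length X \<le> poly p (length I) \<and>
      (\<forall>Y. length Y \<le> poly q (length I) \<longrightarrow> ?P [I, X, Y]))"
    using Static_iff p q by (simp add: numeral_2_eq_2)
  thus ?thesis unfolding Sigma2p_def using verifier_poly_time by blast
qed

end
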